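(* Let $k\ge 3$ be an integer. For each integer $N\ge 2$ let $\mathcal{B}_{N,k}$ be the smallest constant such that the inequality $$\Big\|\sum_{n=-N}^N a_n e(nx-n^2x^k)\Big\|_{L^2(-1,1)}\le \mathcal{B}_{N,k}\Big(\sum_{n=-N}^N|a_n|^2\Big)^{1/2}$$ holds for arbitrary $a_n\in\mathbb{C}$, $-N\le n\le N$. Then there are constants $c,C,A>0$, depending on $k$ but not on $N$, such that for all $N\ge 2$ $$c\,N^{\frac{k-2}{6(k-1)}}\le \mathcal{B}_{N,k}\le C(\log N)^{A} N^{\frac{k-2}{6(k-1)}}.$$
   Context: $e(z)=e^{2\pi i z}$. The $L^2(-1,1)$ norm is taken in the real variable $x$. *)

theory Defs
  imports "HOL-Analysis.Analysis"
begin

definition e_char :: "complex \<Rightarrow> complex" where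
  "e_char z = exp (2 * of_real pi * \<i> * z)"

text \<open>
  The integral is the Bochner integral, so this is the usual norm only for square-integrable
  functions; for other measurable functions it is 0 rather than infinity. Below it is applied to
  trigonometric sums on a bounded interval only.
\<close>
definition L2_norm_on :: "real set \<Rightarrow> (real \<Rightarrow> complex) \<Rightarrow> real" where
  "L2_norm_on S f = sqrt (LINT x:S|lborel. (norm (f x))\<^sup>2)"

definition curve_sum :: "nat \<Rightarrow> nat \<Rightarrow> (int \<Rightarrow> complex) \<Rightarrow> real \<Rightarrow> complex" where
  "curve_sum N k a x =
     (\<Sum>n = - int N..int N. a n * e_char (of_real (real_of_int n * x - (real_of_int n)\<^sup>2 * x ^ k)))"

definition admissible_const :: "nat \<Rightarrow> nat \<Rightarrow> real \<Rightarrow> bool" where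
  "admissible_const N k B \<longleftrightarrow>
     (\<forall>a :: int \<Rightarrow> complex. L2_norm_on {-1<..<1} (curve_sum N k a)
        \<le> B * sqrt (\<Sum>n = - int N..int N. (norm (a n))\<^sup>2))"

text \<open>The least admissible constant exists; see \<open>admissible_best_const\<close> below.\<close>
definition best_const :: "nat \<Rightarrow> nat \<Rightarrow> real" where
  "best_const N k = (LEAST B. admissible_const N k B)"

lemma norm_e_char_of_real [simp]: "norm (e_char (of_real t)) = 1"
proof -
  have "2 * of_real pi * \<i> * of_real t = \<i> * of_real (2 * pi * t)"
    by simp
  then show ?thesis
    unfolding e_char_def by (metis norm_exp_i_times)
qed

lemma norm_curve_sum_le:
  "(norm (curve_sum N k a x))\<^sup>2 \<le> (2 * real N + 1) * (\<Sum>n = - int N..int N. (norm (a n))\<^sup>2)"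
proof -
  have "norm (curve_sum N k a x) \<le> (\<Sum>n = - int N..int N. norm (a n))"
    unfolding curve_sum_def by (rule sum_norm_le) (simp add: norm_mult del: of_real_diff of_real_mult of_real_power)
  then have "(norm (curve_sum N k a x))\<^sup>2 \<le> (\<Sum>n = - int N..int N. norm (a n))\<^sup>2"
    by (rule power_mono) simp
  also have "\<dots> \<le> real (card {- int N..int N}) * (\<Sum>n = - int N..int N. (norm (a n))\<^sup>2)"
    using Cauchy_Schwarz_ineq_sum[of "\<lambda>n. 1" "\<lambda>n. norm (a n)" "{- int N..int N}"] by simp
  also have "real (card {- int N..int N}) = 2 * real N + 1"
    by simp
  finally show ?thesis .
qed

lemma admissible_crude: "admissible_const N k (sqrt (2 * (2 * real N + 1)))"
  unfolding admissible_const_def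
proof
  fix a :: "int \<Rightarrow> complex"
  let ?S = "\<Sum>n = - int N..int N. (norm (a n))\<^sup>2"
  let ?c = "(2 * real N + 1) * ?S"
  have c0: "0 \<le> ?c" by (simp add: sum_nonneg)
  have "(LINT x:{-1<..<1}|lborel. (norm (curve_sum N k a x))\<^sup>2)
      \<le> (LINT x:{-1<..<1::real}|lborel. ?c)"
    unfolding set_lebesgue_integral_def
  proof (rule integral_mono')
    show "integrable lborel (\<lambda>x. indicat_real {-1<..<1::real} x *\<^sub>R ?c)"
      by (intro integrable_scaleR_left) (simp add: integrable_indicator_iff)
  qed (use norm_curve_sum_le c0 in \<open>auto intro!: mult_left_mono simp: indicator_def\<close>)
  also have "\<dots> = 2 * ?c"
    by (simp add: set_lebesgue_integral_def)
  finally show "L2_norm_on {-1<..<1} (curve_sum N k a) \<le> sqrt (2 * (2 * real N + 1)) * sqrt ?S"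
    unfolding L2_norm_on_def real_sqrt_mult[symmetric]
    by (simp only: real_sqrt_le_iff mult.assoc)
qed

lemma admissible_best_const:
  shows "admissible_const N k (best_const N k)"
    and "admissible_const N k B \<Longrightarrow> best_const N k \<le> B"
proof -
  let ?A = "{B. admissible_const N k B}"
  have nonneg: "0 \<le> B" if "admissible_const N k B" for B
  proof -
    let ?a = "\<lambda>n::int. if n = 0 then 1 else 0 :: complex"
    have "(\<Sum>n = - int N..int N. (norm (?a n))\<^sup>2) = (\<Sum>n = - int N..int N. if n = 0 then 1 else 0)"
      by (rule sum.cong) auto
    then have "(\<Sum>n = - int N..int N. (norm (?a n))\<^sup>2) = 1"
      by simp
    moreover have "0 \<le> L2_norm_on {-1<..<1} (curve_sum N k ?a)"
      unfolding L2_norm_on_def set_lebesgue_integral_def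
      by (simp add: integral_nonneg_AE)
    ultimately show ?thesis
      using that[unfolded admissible_const_def, rule_format, of ?a] by simp
  qed
  have ne: "?A \<noteq> {}" using admissible_crude by blast
  have bdd: "bdd_below ?A" using nonneg by (auto simp: bdd_below_def)
  have closed: "closed ?A"
    unfolding admissible_const_def
    by (intro closed_Collect_all closed_Collect_le continuous_intros)
  have adm: "admissible_const N k (Inf ?A)"
    using closed_contains_Inf[OF ne bdd closed] by simp
  have le: "Inf ?A \<le> B" if "admissible_const N k B" for B
    using cInf_lower[OF _ bdd] that by simp
  have "best_const N k = Inf ?A"
    unfolding best_const_def by (rule Least_equality) (use adm le in auto)
  with adm le show "admissible_const N k (best_const N k)"
    and "admissible_const N k B \<Longrightarrow> best_const N k \<le> B" by auto
qed

end

theory Submission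
  imports Defs "HOL-Complex_Analysis.Cauchy_Integral_Theorem"
begin

text \<open>
  Upper bound: the square of the norm is a Hermitian form whose kernel is
  \<open>\<integral> e((n - m) (x - (n + m) x\<^sup>k)) dx\<close>. With \<open>h = n - m\<close>, \<open>s = n + m\<close> and the critical point
  \<open>x\<^sub>0 = (k s) powr (-1 / (k - 1))\<close>, stationary phase gives
  \<open>c (x\<^sub>0 / h) powr (1/2) e((1 - 1/k) h x\<^sub>0) + O(1/h)\<close>; the error costs a logarithm by Schur's test.
  For \<open>n, m\<close> of size \<open>M\<close> and \<open>h\<close> of size \<open>H\<close>, put \<open>X = M powr (-1 / (k - 1))\<close>.
  Schur's test bounds the main term \<open>P\<close> by \<open>(X H) powr (1/2)\<close>. The phase of \<open>P P*\<close> has increments of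
  size \<open>|n - n'| H X / M\<^sup>2\<close>, at most \<open>1/2\<close>, so the Kusmin-Landau inequality bounds \<open>P\<close> by \<open>M / H\<close>
  up to a logarithm. The smaller of both bounds is at most \<open>(X M) powr (1/3)\<close>, which is
  \<open>M powr ((k - 2) / (3 (k - 1)))\<close>.

  Lower bound: for \<open>n = n\<^sub>0 + j\<close> and \<open>x = x\<^sub>0 - t\<close> near a point with \<open>2 k n\<^sub>0 x\<^sub>0\<^sup>k\<^sup>-\<^sup>1 = 1\<close>, where the mixed
  derivative of the phase vanishes, all terms stay coherent as long as \<open>j t\<^sup>2\<close> is small against \<open>x\<^sub>0\<close>
  and \<open>j\<^sup>2 t\<close> is small against \<open>n\<^sub>0\<close>.
\<close>

section \<open>Oscillatory integrals\<close>

text \<open>Schur's test alone loses at large \<open>H\<close>: at \<open>H = M\<close> it gives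
  \<open>(X M)^(1/2)\<close>. Cancellation in the sum over \<open>m\<close> has to be used there,
  but the coefficients \<open>a m\<close> are arbitrary. Passing to \<open>P P*\<close> is what
  removes them from that sum, so that a pure exponential sum with monotone weights remains. The two
  bounds meet at \<open>H^3 = M^2 / X\<close>, where both equal \<open>(X M)^(1/3)\<close>. The
  lower bound has the same scale: \<open>j t^2 = x0\<close> and \<open>j^2 t = n0\<close> give
  \<open>j = (n0^2 / x0)^(1/3)\<close>. The critical distance of the upper bound is thus the length
  of the longest coherent block, and this is why the exponents agree. Three logarithms are charged
  to the square of the norm: one for the sum of \<open>1 / |n - n'|\<close> over correlations, one
  for the number of scales \<open>H\<close>, one for the number of blocks \<open>M\<close>. Hence
  the exponent \<open>3/2\<close>. Frequencies of opposite sign are not paired, since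
  \<open>n + m\<close> could then be small or zero. For \<open>x > 0\<close> they are separated by
  the triangle inequality, and differences of negative frequencies have no stationary point. The
  half \<open>x < 0\<close> is reflected to \<open>x > 0\<close>.\<close>

definition ee :: "real \<Rightarrow> complex" where
  "ee t = cis (2 * pi * t)"

lemma e_char_of_real: "e_char (of_real t) = ee t"
  by (simp add: e_char_def ee_def cis_conv_exp mult_ac)

lemma norm_ee [simp]: "norm (ee t) = 1"
  by (simp add: ee_def)

lemma ee_0 [simp]: "ee 0 = 1"
  by (simp add: ee_def)

lemma ee_add: "ee (s + t) = ee s * ee t"
  by (simp add: ee_def cis_mult distrib_left)

lemma ee_minus: "ee (- t) = cnj (ee t)"
  by (simp add: ee_def cis_cnj)

lemma ee_diff: "ee (s - t) = ee s * cnj (ee t)"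
  by (metis ee_add ee_minus uminus_add_conv_diff add.commute)

lemma continuous_on_ee [continuous_intros]:
  "continuous_on S f \<Longrightarrow> continuous_on S (\<lambda>x. ee (f x))"
  unfolding ee_def by (intro continuous_intros)

lemma has_vector_derivative_ee:
  assumes "(f has_real_derivative f') (at x within S)"
  shows "((\<lambda>x. ee (f x)) has_vector_derivative (of_real (2 * pi * f') * \<i> * ee (f x))) (at x within S)"
proof -
  have "((\<lambda>y. cis (2 * pi * f y)) has_derivative (\<lambda>y. ((2 * pi * f') * y) *\<^sub>R (\<i> * cis (2 * pi * f x)))) (at x within S)"
    using assms by (auto intro!: derivative_eq_intros simp: has_field_derivative_def)
  then show ?thesis
    unfolding ee_def has_vector_derivative_def
    by (rule has_derivative_eq_rhs) (auto simp: fun_eq_iff scaleR_conv_of_real algebra_simps)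
qed

text \<open>Integration by parts: the derivative of \<open>r ee (l \<psi>)\<close> is
  \<open>2 pi i l\<close> times the integrand plus \<open>r' ee (l \<psi>)\<close>. The auxiliary
  \<open>R\<close> bounds the variation of \<open>r\<close> by \<open>R b - R a\<close>. It serves a
  monotone \<open>r\<close>, with \<open>R\<close> equal to \<open>r\<close> up to sign, as well as
  an \<open>r\<close> with bounded derivative, with \<open>R\<close> linear.\<close>

lemma oscillatory_integral_bound:
  fixes r r' R R' \<psi> \<psi>' :: "real \<Rightarrow> real" and l :: real
  assumes ab: "a \<le> b" and l: "l > 0"
    and psi: "\<And>u. u \<in> {a..b} \<Longrightarrow> (\<psi> has_real_derivative \<psi>' u) (at u within {a..b})"
    and r: "\<And>u. u \<in> {a..b} \<Longrightarrow> (r has_real_derivative r' u) (at u within {a..b})"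
    and R: "\<And>u. u \<in> {a..b} \<Longrightarrow> (R has_real_derivative R' u) (at u within {a..b})"
    and le: "\<And>u. u \<in> {a..b} \<Longrightarrow> \<bar>r' u\<bar> \<le> R' u"
    and cont: "continuous_on {a..b} \<psi>'" "continuous_on {a..b} r'"
  shows "norm (integral {a..b} (\<lambda>u. of_real (r u * \<psi>' u) * ee (l * \<psi> u)))
           \<le> (\<bar>r a\<bar> + \<bar>r b\<bar> + (R b - R a)) / (2 * pi * l)"
proof -
  let ?G = "\<lambda>u. of_real (r u) * ee (l * \<psi> u)"
  let ?I = "integral {a..b} (\<lambda>u. of_real (r u * \<psi>' u) * ee (l * \<psi> u))"
  let ?J = "integral {a..b} (\<lambda>u. of_real (r' u) * ee (l * \<psi> u))"
  have cpsi: "continuous_on {a..b} \<psi>" and cr: "continuous_on {a..b} r"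
    using psi r DERIV_continuous_on by blast+
  have i1: "(\<lambda>u. of_real (r u * \<psi>' u) * ee (l * \<psi> u)) integrable_on {a..b}"
    and i2: "(\<lambda>u. of_real (r' u) * ee (l * \<psi> u)) integrable_on {a..b}"
    by (intro integrable_continuous_real continuous_intros cpsi cr cont)+
  have "(?G has_vector_derivative (of_real (r' u) * ee (l * \<psi> u)
      + of_real (2 * pi * l) * \<i> * (of_real (r u * \<psi>' u) * ee (l * \<psi> u)))) (at u within {a..b})"
    if u: "u \<in> {a..b}" for u
  proof -
    have "((\<lambda>u. l * \<psi> u) has_real_derivative l * \<psi>' u) (at u within {a..b})"
      using psi[OF u] by (auto intro!: derivative_eq_intros)
    from has_vector_derivative_mult[OF has_vector_derivative_of_real[OF r[OF u]] has_vector_derivative_ee[OF this]]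
    show ?thesis by (simp add: algebra_simps)
  qed
  then have "((\<lambda>u. of_real (r' u) * ee (l * \<psi> u)
      + of_real (2 * pi * l) * \<i> * (of_real (r u * \<psi>' u) * ee (l * \<psi> u))) has_integral (?G b - ?G a)) {a..b}"
    by (intro fundamental_theorem_of_calculus ab)
  moreover have "((\<lambda>u. of_real (r' u) * ee (l * \<psi> u)
      + of_real (2 * pi * l) * \<i> * (of_real (r u * \<psi>' u) * ee (l * \<psi> u))) has_integral
        (?J + of_real (2 * pi * l) * \<i> * ?I)) {a..b}"
    by (intro has_integral_add has_integral_mult_right integrable_integral i1 i2)
  ultimately have eq: "?J + of_real (2 * pi * l) * \<i> * ?I = ?G b - ?G a"
    by (rule has_integral_unique[symmetric])
  have "(R' has_integral (R b - R a)) {a..b}"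
    using R by (intro fundamental_theorem_of_calculus ab) (simp add: has_real_derivative_iff_has_vector_derivative)
  then have "norm ?J \<le> R b - R a"
    using integral_norm_bound_integral[OF i2, of R'] le
    by (metis has_integral_integrable_integral mult.right_neutral norm_ee norm_mult norm_of_real)
  moreover have "norm (?G b - ?G a) \<le> \<bar>r a\<bar> + \<bar>r b\<bar>"
    using norm_triangle_ineq4[of "?G b" "?G a"] by (simp add: norm_mult)
  ultimately have "norm ((?G b - ?G a) - ?J) \<le> \<bar>r a\<bar> + \<bar>r b\<bar> + (R b - R a)"
    by (rule order_trans[OF norm_triangle_ineq4 add_mono, rotated])
  moreover have "of_real (2 * pi * l) * \<i> * ?I = (?G b - ?G a) - ?J"
    using eq by (simp add: algebra_simps)
  moreover have "norm (of_real (2 * pi * l) * \<i> * ?I) = 2 * pi * l * norm ?I"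
    using l by (simp add: norm_mult)
  ultimately have "2 * pi * l * norm ?I \<le> \<bar>r a\<bar> + \<bar>r b\<bar> + (R b - R a)"
    by simp
  then show ?thesis
    using l by (simp add: pos_le_divide_eq mult_ac)
qed

text \<open>With amplitude \<open>1 / \<phi>'\<close> the integrand of the integration by parts is
  the bare exponential. Since \<open>\<phi>'\<close> increases, the boundary values and the
  variation of \<open>1 / \<phi>'\<close> add up to \<open>2 / \<phi>' a\<close>; a remaining factor
  \<open>1 / pi\<close> is given away.\<close>

lemma first_derivative_test:
  fixes \<phi> \<phi>' \<phi>'' :: "real \<Rightarrow> real"
  assumes ab: "a \<le> b" and l: "l > 0"
    and phi: "\<And>u. u \<in> {a..b} \<Longrightarrow> (\<phi> has_real_derivative \<phi>' u) (at u within {a..b})"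
    and phi': "\<And>u. u \<in> {a..b} \<Longrightarrow> (\<phi>' has_real_derivative \<phi>'' u) (at u within {a..b})"
    and pos: "\<phi>' a > 0" and nonneg: "\<And>u. u \<in> {a..b} \<Longrightarrow> \<phi>'' u \<ge> 0"
    and cont: "continuous_on {a..b} \<phi>''"
  shows "norm (integral {a..b} (\<lambda>u. ee (l * \<phi> u))) \<le> 1 / (l * \<phi>' a)"
proof -
  have mono: "\<phi>' a \<le> \<phi>' u" if "u \<in> {a..b}" for u
  proof (rule DERIV_nonneg_imp_increasing_open[of a u])
    show "continuous_on {a..u} \<phi>'"
      using that by (intro continuous_on_subset[OF DERIV_continuous_on[OF phi']]) auto
  next
    fix x assume x: "a < x" "x < u"
    then have "x \<in> {a..b}" "x \<in> interior {a..b}" using that by auto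
    then show "\<exists>y. (\<phi>' has_real_derivative y) (at x) \<and> 0 \<le> y"
      using phi'[of x] nonneg[of x] at_within_interior by metis
  qed (use that in auto)
  have p: "\<phi>' u > 0" if "u \<in> {a..b}" for u
    using mono[OF that] pos by linarith
  have cphi': "continuous_on {a..b} \<phi>'"
    by (rule DERIV_continuous_on[OF phi'])
  have "norm (integral {a..b} (\<lambda>u. of_real (1 / \<phi>' u * \<phi>' u) * ee (l * \<phi> u)))
    \<le> (\<bar>1 / \<phi>' a\<bar> + \<bar>1 / \<phi>' b\<bar> + ((- 1 / \<phi>' b) - (- 1 / \<phi>' a))) / (2 * pi * l)"
  proof (rule oscillatory_integral_bound[OF ab l phi, where r' = "\<lambda>u. - (\<phi>'' u / (\<phi>' u)\<^sup>2)" and R' = "\<lambda>u. \<phi>'' u / (\<phi>' u)\<^sup>2"])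
    fix u assume u: "u \<in> {a..b}"
    show "((\<lambda>u. 1 / \<phi>' u) has_real_derivative - (\<phi>'' u / (\<phi>' u)\<^sup>2)) (at u within {a..b})"
      and "((\<lambda>u. - 1 / \<phi>' u) has_real_derivative (\<phi>'' u / (\<phi>' u)\<^sup>2)) (at u within {a..b})"
      using p[OF u] by (auto intro!: derivative_eq_intros phi'[OF u] simp: power2_eq_square)
    show "\<bar>- (\<phi>'' u / (\<phi>' u)\<^sup>2)\<bar> \<le> \<phi>'' u / (\<phi>' u)\<^sup>2"
      using nonneg[OF u] by simp
  qed (use p in \<open>auto intro!: continuous_intros cphi' cont simp: less_imp_neq[symmetric]\<close>)
  moreover have "integral {a..b} (\<lambda>u. of_real (1 / \<phi>' u * \<phi>' u) * ee (l * \<phi> u)) = integral {a..b} (\<lambda>u. ee (l * \<phi> u))"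
    using p by (intro integral_cong) (simp add: less_imp_neq[symmetric])
  moreover have "(\<bar>1 / \<phi>' a\<bar> + \<bar>1 / \<phi>' b\<bar> + ((- 1 / \<phi>' b) - (- 1 / \<phi>' a))) / (2 * pi * l) = 1 / (pi * (l * \<phi>' a))"
    using p[of a] p[of b] ab l by (simp add: field_simps)
  moreover have "1 / (pi * (l * \<phi>' a)) \<le> 1 / (l * \<phi>' a)"
    using mult_pos_pos[OF l pos] pi_gt3 by (intro divide_left_mono) (auto simp: mult_le_cancel_right1)
  ultimately show ?thesis by simp
qed

section \<open>Continuously differentiable amplitudes\<close>

lemma C1_differentiable_on_realE:
  fixes f :: "real \<Rightarrow> real"
  assumes "f C1_differentiable_on S"
  obtains f' where "\<And>x. x \<in> S \<Longrightarrow> (f has_real_derivative f' x) (at x)" "continuous_on S f'"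
  using assms by (auto simp: C1_differentiable_on_def has_real_derivative_iff_has_vector_derivative)

lemma C1_differentiable_on_inverse:
  fixes f :: "real \<Rightarrow> real"
  assumes "f C1_differentiable_on S" and nz: "\<And>x. x \<in> S \<Longrightarrow> f x \<noteq> 0"
  shows "(\<lambda>x. inverse (f x)) C1_differentiable_on S"
proof -
  obtain f' where f': "\<And>x. x \<in> S \<Longrightarrow> (f has_real_derivative f' x) (at x)" and c: "continuous_on S f'"
    using C1_differentiable_on_realE[OF assms(1)] by blast
  have cf: "continuous_on S f"
    using C1_differentiable_imp_continuous_on assms(1) .
  have "((\<lambda>x. inverse (f x)) has_real_derivative - (f' x / (f x)\<^sup>2)) (at x)" if "x \<in> S" for x
    using nz[OF that] by (auto intro!: derivative_eq_intros f'[OF that] simp: field_simps power2_eq_square)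
  moreover have "continuous_on S (\<lambda>x. - (f' x / (f x)\<^sup>2))"
    using nz by (intro continuous_intros c cf) auto
  ultimately show ?thesis
    by (auto simp: C1_differentiable_on_def has_real_derivative_iff_has_vector_derivative intro!: exI[of _ "\<lambda>x. - (f' x / (f x)\<^sup>2)"])
qed

lemma C1_differentiable_on_sqrt:
  fixes f :: "real \<Rightarrow> real"
  assumes "f C1_differentiable_on S" and pos: "\<And>x. x \<in> S \<Longrightarrow> f x > 0"
  shows "(\<lambda>x. sqrt (f x)) C1_differentiable_on S"
proof -
  obtain f' where f': "\<And>x. x \<in> S \<Longrightarrow> (f has_real_derivative f' x) (at x)" and c: "continuous_on S f'"
    using C1_differentiable_on_realE[OF assms(1)] by blast
  have cf: "continuous_on S f"
    using C1_differentiable_imp_continuous_on assms(1) .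
  have "((\<lambda>x. sqrt (f x)) has_real_derivative f' x / (2 * sqrt (f x))) (at x)" if "x \<in> S" for x
    using pos[OF that] by (auto intro!: derivative_eq_intros f'[OF that] simp: field_simps)
  moreover have "continuous_on S (\<lambda>x. f' x / (2 * sqrt (f x)))"
    using pos by (intro continuous_intros c cf) (auto dest: pos)
  ultimately show ?thesis
    by (auto simp: C1_differentiable_on_def has_real_derivative_iff_has_vector_derivative intro!: exI[of _ "\<lambda>x. f' x / (2 * sqrt (f x))"])
qed

lemma C1_differentiable_on_poly: "poly (p :: real poly) C1_differentiable_on S"
  unfolding C1_differentiable_on_def
  by (intro exI[of _ "poly (pderiv p)"])
     (auto intro!: continuous_intros poly_DERIV simp flip: has_real_derivative_iff_has_vector_derivative)

section \<open>Fresnel integrals and stationary phase\<close>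

lemma convergent_at_infinity_rate:
  fixes F :: "real \<Rightarrow> complex"
  assumes b: "\<And>Z Z'. 0 < Z \<Longrightarrow> Z \<le> Z' \<Longrightarrow> norm (F Z' - F Z) \<le> 1 / Z"
  obtains c where "\<And>Z. 0 < Z \<Longrightarrow> norm (F Z - c) \<le> 1 / Z"
proof -
  have "Cauchy (\<lambda>n. F (real (Suc n)))"
  proof (rule metric_CauchyI)
    fix e :: real assume "e > 0"
    then obtain M :: nat where M: "inverse (real (Suc M)) < e" using reals_Archimedean by blast
    have *: "dist (F (real (Suc m))) (F (real (Suc n))) < e" if "M \<le> m" "m \<le> n" for m n
    proof -
      have "dist (F (real (Suc m))) (F (real (Suc n))) \<le> 1 / real (Suc m)"
        using b[of "real (Suc m)" "real (Suc n)"] that by (simp add: dist_norm norm_minus_commute)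
      also have "\<dots> \<le> inverse (real (Suc M))"
        using that by (simp add: field_simps)
      finally show ?thesis using M by linarith
    qed
    show "\<exists>M. \<forall>m\<ge>M. \<forall>n\<ge>M. dist (F (real (Suc m))) (F (real (Suc n))) < e"
      by (metis * dist_commute nle_le)
  qed
  then obtain c where c: "(\<lambda>n. F (real (Suc n))) \<longlonglongrightarrow> c"
    using Cauchy_convergent_iff convergent_def by blast
  have "norm (F Z - c) \<le> 1 / Z" if "0 < Z" for Z
  proof (rule tendsto_upperbound)
    show "(\<lambda>n. norm (F Z - F (real (Suc n)))) \<longlonglongrightarrow> norm (F Z - c)"
      by (intro tendsto_intros c)
    have "norm (F Z - F (real (Suc n))) \<le> 1 / Z" if "n \<ge> nat \<lceil>Z\<rceil>" for n
      using b[of Z "real (Suc n)"] \<open>0 < Z\<close> that by (subst norm_minus_commute) linarith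
    then show "\<forall>\<^sub>F n in sequentially. norm (F Z - F (real (Suc n))) \<le> 1 / Z"
      by (rule eventually_sequentiallyI)
  qed auto
  then show ?thesis using that by blast
qed

text \<open>The function \<open>ee (y\<^sup>2)\<close> extends to an entire function, which has a
  primitive on the whole plane; \<open>F\<close> is its restriction to the real line. The limits at
  both infinities exist, with rate \<open>1 / Z\<close>, by the first derivative test. They enter
  stationary phase through \<open>c - d\<close>, the complete Fresnel integral.\<close>

lemma fresnel_antiderivative:
  obtains F c d where "\<And>y. (F has_vector_derivative ee (y\<^sup>2)) (at y)"
    and "\<And>Z. Z > 0 \<Longrightarrow> norm (F Z - c) \<le> 1 / Z"
    and "\<And>Z. Z > 0 \<Longrightarrow> norm (F (- Z) - d) \<le> 1 / Z"
proof -
  have "(\<lambda>z. exp (2 * of_real pi * \<i> * z\<^sup>2)) holomorphic_on UNIV"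
    by (intro holomorphic_intros)
  then obtain g where g: "\<And>z. (g has_field_derivative exp (2 * of_real pi * \<i> * z\<^sup>2)) (at z)"
    using holomorphic_convex_primitive'[of UNIV] by auto
  define F where "F y = g (of_real y)" for y :: real
  have F: "(F has_vector_derivative ee (y\<^sup>2)) (at y)" for y
    using has_vector_derivative_real_field[OF g[of "of_real y"]]
    unfolding F_def ee_def by (simp add: cis_conv_exp mult_ac o_def)
  have cont: "continuous_on S (\<lambda>y. ee (y\<^sup>2))" for S
    by (intro continuous_intros)
  have I: "norm (F b - F a) \<le> 1 / a" if "0 < a" "a \<le> b" for a b
  proof -
    have "norm (integral {a..b} (\<lambda>u. ee (1 * u\<^sup>2))) \<le> 1 / (1 * (2 * a))"
      by (rule first_derivative_test[where \<phi>'' = "\<lambda>_. 2"]) (use that in \<open>auto intro!: derivative_eq_intros\<close>)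
    moreover have "((\<lambda>y. ee (y\<^sup>2)) has_integral F b - F a) {a..b}"
      using that F by (intro fundamental_theorem_of_calculus) (auto intro: has_vector_derivative_at_within)
    ultimately have "norm (F b - F a) \<le> 1 / (2 * a)"
      by (simp add: integral_unique)
    also have "\<dots> \<le> 1 / a" using that by (simp add: field_simps)
    finally show ?thesis .
  qed
  \<comment> \<open>Because \<open>ee (y\<^sup>2)\<close> is even, this is a second antiderivative.
    Its increments agree with those of \<open>F\<close>, so the behaviour at minus infinity follows
    from that at plus infinity.\<close>
  define H where "H y = - F (- y)" for y
  have H: "(H has_vector_derivative ee (y\<^sup>2)) (at y)" for y
  proof -
    have "((F \<circ> uminus) has_vector_derivative (- 1) *\<^sub>R ee ((- y)\<^sup>2)) (at y)"
      by (rule vector_diff_chain_at) (use F[of "- y"] in \<open>auto intro!: derivative_eq_intros simp: has_real_derivative_iff_has_vector_derivative[symmetric]\<close>)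
    from has_vector_derivative_minus[OF this] show ?thesis
      by (simp add: H_def[abs_def] o_def)
  qed
  have HI: "norm (H b - H a) \<le> 1 / a" if "0 < a" "a \<le> b" for a b
  proof -
    have "((\<lambda>y. ee (y\<^sup>2)) has_integral F b - F a) {a..b}" "((\<lambda>y. ee (y\<^sup>2)) has_integral H b - H a) {a..b}"
      using that F H by (intro fundamental_theorem_of_calculus; auto intro: has_vector_derivative_at_within)+
    then have "H b - H a = F b - F a" by (rule has_integral_unique[symmetric])
    then show ?thesis using I that by metis
  qed
  obtain c where c: "\<And>Z. Z > 0 \<Longrightarrow> norm (F Z - c) \<le> 1 / Z"
    using convergent_at_infinity_rate[of F] I by blast
  obtain d where d: "\<And>Z. Z > 0 \<Longrightarrow> norm (H Z - d) \<le> 1 / Z"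
    using convergent_at_infinity_rate[of H] HI by blast
  have "norm (F (- Z) - (- d)) \<le> 1 / Z" if "Z > 0" for Z
    using d[OF that] unfolding H_def by (metis minus_diff_minus minus_minus norm_minus_cancel)
  with F c that show ?thesis by blast
qed

text \<open>
  With \<open>w = (u - z) sqrt p\<close> the phase is \<open>w\<^sup>2\<close>. The constant amplitude splits as
  \<open>1 = w' / w' z + r \<psi>'\<close> with a \<open>C\<^sup>1\<close> function \<open>r\<close>: the first part is a Fresnel integral, the
  second one is integrated by parts.
\<close>
lemma stationary_phase:
  fixes p :: "real poly" and a b z :: real
  assumes az: "a < z" and zb: "z < b"
    and p: "\<And>u. u \<in> {a..b} \<Longrightarrow> poly p u > 0"
    and q: "\<And>u. u \<in> {a..b} \<Longrightarrow> 2 * poly p u + (u - z) * poly (pderiv p) u > 0"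
  shows "\<exists>c D. \<forall>l>0. norm (integral {a..b} (\<lambda>u. ee (l * ((u - z)\<^sup>2 * poly p u))) - c / of_real (sqrt l)) \<le> D / l"
proof -
  define p0 where "p0 = poly p z"
  have p0: "p0 > 0" using p[of z] az zb by (simp add: p0_def)
  \<comment> \<open>The quotient \<open>P1\<close> allows the zero of \<open>\<psi>'\<close> at the
    stationary point to be cancelled algebraically, so that the amplitude \<open>r\<close> is
    visibly smooth across \<open>z\<close>.\<close>
  have "[:- z, 1:] dvd (p - [:p0:])"
    by (simp add: poly_eq_0_iff_dvd[symmetric] p0_def)
  then obtain P1 where P1': "p - [:p0:] = [:- z, 1:] * P1" by (elim dvdE)
  have P1: "poly p u - p0 = (u - z) * poly P1 u" for u
    using arg_cong[OF P1', of "\<lambda>p. poly p u"] by (simp add: algebra_simps)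
  define s where "s u = sqrt (poly p u)" for u
  define s0 where "s0 = sqrt p0"
  define q' where "q' u = 2 * poly p u + (u - z) * poly (pderiv p) u" for u
  define \<psi> where "\<psi> u = (u - z)\<^sup>2 * poly p u" for u
  define \<psi>' where "\<psi>' u = (u - z) * q' u" for u
  define w where "w u = (u - z) * s u" for u
  define w' where "w' u = q' u / (2 * s u)" for u
  \<comment> \<open>This is \<open>(1 - w' u / s0) / \<psi>' u\<close> after cancelling
    \<open>u - z\<close>. The numerator vanishes at \<open>z\<close> since \<open>w' z = s0\<close>,
    and \<open>s u - s0 = (u - z) P1 u / (s0 + s u)\<close> exhibits the factor.\<close>
  define r where "r u = - (2 * s u * poly P1 u * inverse (s0 + s u) + poly (pderiv p) u) * inverse (2 * q' u * s u * s0)" for u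
  have s: "s u > 0" "s u * s u = poly p u" if "u \<in> {a..b}" for u
    using p[OF that] by (auto simp: s_def)
  have s0: "s0 > 0" "s0 * s0 = p0" using p0 by (auto simp: s0_def)
  have q': "q' u > 0" if "u \<in> {a..b}" for u
    using q[OF that] by (simp add: q'_def)
  have C1s: "s C1_differentiable_on {a..b}"
    unfolding s_def[abs_def] by (intro C1_differentiable_on_sqrt C1_differentiable_on_poly p)
  have C1q: "q' C1_differentiable_on {a..b}"
    unfolding q'_def[abs_def] by (intro derivative_intros C1_differentiable_on_poly)
  have C1r: "r C1_differentiable_on {a..b}"
    unfolding r_def[abs_def]
    by (intro derivative_intros C1_differentiable_on_inverse C1_differentiable_on_poly C1s C1q)
       (use s s0 q' in \<open>force simp: less_imp_neq add_pos_pos\<close>)+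
  obtain r' where r': "\<And>u. u \<in> {a..b} \<Longrightarrow> (r has_real_derivative r' u) (at u)"
    and cr': "continuous_on {a..b} r'"
    using C1_differentiable_on_realE[OF C1r] by blast
  have "compact (r' ` {a..b})"
    using cr' by (intro compact_continuous_image) auto
  then obtain K where K: "\<And>u. u \<in> {a..b} \<Longrightarrow> \<bar>r' u\<bar> \<le> K"
    using compact_imp_bounded bounded_iff by (metis imageI real_norm_def)
  have dw: "(w has_real_derivative w' u) (at u)" if u: "u \<in> {a..b}" for u
  proof -
    have "(s has_real_derivative poly (pderiv p) u / (2 * s u)) (at u)"
      unfolding s_def using p[OF u]
      by (auto intro!: derivative_eq_intros poly_DERIV simp: field_simps)
    then have "(w has_real_derivative s u + (u - z) * (poly (pderiv p) u / (2 * s u))) (at u)"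
      unfolding w_def by (auto intro!: derivative_eq_intros)
    also have "s u + (u - z) * (poly (pderiv p) u / (2 * s u)) = w' u"
      using s(1)[OF u] unfolding w'_def q'_def s(2)[OF u, symmetric] by (simp add: field_simps)
    finally show ?thesis .
  qed
  have dpsi: "(\<psi> has_real_derivative \<psi>' u) (at u)" for u
    unfolding \<psi>_def \<psi>'_def q'_def
    by (auto intro!: derivative_eq_intros poly_DERIV simp: algebra_simps power2_eq_square)
  have psiw: "\<psi> u = (w u)\<^sup>2" if "u \<in> {a..b}" for u
    using s[OF that] by (simp add: \<psi>_def w_def power2_eq_square)
  have key: "1 = w' u / s0 + r u * \<psi>' u" if u: "u \<in> {a..b}" for u
  proof -
    have e: "(u - z) * poly P1 u = (s u - s0) * (s0 + s u)"
      using P1[of u] s(2)[OF u] s0(2) by (simp add: algebra_simps)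
    have n: "s0 + s u \<noteq> 0" "s u \<noteq> 0" "s0 \<noteq> 0" "q' u \<noteq> 0" using s[OF u] s0 q'[OF u] by auto
    have "r u * \<psi>' u = - (2 * s u * ((u - z) * poly P1 u) * inverse (s0 + s u) + (u - z) * poly (pderiv p) u) / (2 * s u * s0)"
      using n by (simp add: r_def \<psi>'_def divide_simps) (simp add: algebra_simps)
    also have "\<dots> = - (2 * s u * (s u - s0) + (u - z) * poly (pderiv p) u) / (2 * s u * s0)"
      unfolding e using n by simp
    also have "2 * s u * (s u - s0) + (u - z) * poly (pderiv p) u = q' u - 2 * s u * s0"
      using s(2)[OF u] by (simp add: q'_def algebra_simps)
    finally show ?thesis
      using n by (simp add: w'_def divide_simps)
  qed
  obtain F c d where F: "\<And>y. (F has_vector_derivative ee (y\<^sup>2)) (at y)"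
    and c: "\<And>Z. Z > 0 \<Longrightarrow> norm (F Z - c) \<le> 1 / Z"
    and d: "\<And>Z. Z > 0 \<Longrightarrow> norm (F (- Z) - d) \<le> 1 / Z"
    using fresnel_antiderivative by metis
  have wa: "w a < 0" "w b > 0" using az zb s[of a] s[of b] by (auto simp: w_def mult_less_0_iff)
  \<comment> \<open>The first summand comes from the two Fresnel tails at
    \<open>w a < 0 < w b\<close>, the second from integration by parts with the linear majorant
    \<open>R u = K u\<close>.\<close>
  define D where "D = (1 / w b + 1 / (- w a)) / s0 + (\<bar>r a\<bar> + \<bar>r b\<bar> + (K * b - K * a)) / (2 * pi)"
  have cpsi: "continuous_on {a..b} \<psi>" "continuous_on {a..b} \<psi>'"
    unfolding \<psi>_def \<psi>'_def q'_def by (intro continuous_intros)+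
  have cs: "continuous_on {a..b} s" "continuous_on {a..b} q'" "continuous_on {a..b} r"
    using C1s C1q C1r C1_differentiable_imp_continuous_on by blast+
  have cw': "continuous_on {a..b} w'"
    unfolding w'_def using s(1) by (intro continuous_intros cs) force+
  have "norm (integral {a..b} (\<lambda>u. ee (l * \<psi> u)) - ((c - d) / of_real s0) / of_real (sqrt l)) \<le> D / l" if l: "l > 0" for l
  proof -
    let ?A = "integral {a..b} (\<lambda>u. of_real (w' u / s0) * ee (l * \<psi> u))"
    let ?B = "integral {a..b} (\<lambda>u. of_real (r u * \<psi>' u) * ee (l * \<psi> u))"
    have "integral {a..b} (\<lambda>u. ee (l * \<psi> u))
        = integral {a..b} (\<lambda>u. of_real (w' u / s0) * ee (l * \<psi> u) + of_real (r u * \<psi>' u) * ee (l * \<psi> u))"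
    proof (rule integral_cong)
      fix u assume "u \<in> {a..b}"
      then have "(1::complex) = of_real (w' u / s0) + of_real (r u * \<psi>' u)"
        using key by (metis of_real_1 of_real_add)
      then show "ee (l * \<psi> u) = of_real (w' u / s0) * ee (l * \<psi> u) + of_real (r u * \<psi>' u) * ee (l * \<psi> u)"
        by (metis distrib_right mult_1)
    qed
    also have "\<dots> = ?A + ?B"
      using s0 by (intro integral_add integrable_continuous_real continuous_intros cw' cpsi cs) auto
    finally have AB: "integral {a..b} (\<lambda>u. ee (l * \<psi> u)) = ?A + ?B" .
    have "((\<lambda>u. F (sqrt l * w u) / of_real (s0 * sqrt l)) has_vector_derivative of_real (w' u / s0) * ee (l * \<psi> u)) (at u within {a..b})"
      if u: "u \<in> {a..b}" for u
    proof -
      have "((F \<circ> (\<lambda>u. sqrt l * w u)) has_vector_derivative (sqrt l * w' u) *\<^sub>R ee ((sqrt l * w u)\<^sup>2)) (at u)"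
        by (rule vector_diff_chain_at[OF _ F])
           (auto intro!: derivative_eq_intros dw[OF u] simp: has_real_derivative_iff_has_vector_derivative[symmetric])
      then have "((\<lambda>u. F (sqrt l * w u) / of_real (s0 * sqrt l)) has_vector_derivative
          ((sqrt l * w' u) *\<^sub>R ee ((sqrt l * w u)\<^sup>2)) / of_real (s0 * sqrt l)) (at u)"
        unfolding o_def by (rule has_vector_derivative_divide)
      moreover have "((sqrt l * w' u) *\<^sub>R ee ((sqrt l * w u)\<^sup>2)) / of_real (s0 * sqrt l) = of_real (w' u / s0) * ee (l * \<psi> u)"
        using l s0 psiw[OF u] by (simp add: scaleR_conv_of_real power_mult_distrib divide_simps)
      ultimately show ?thesis
        by (simp add: has_vector_derivative_at_within)
    qed
    then have "((\<lambda>u. of_real (w' u / s0) * ee (l * \<psi> u)) has_integral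
       (F (sqrt l * w b) / of_real (s0 * sqrt l) - F (sqrt l * w a) / of_real (s0 * sqrt l))) {a..b}"
      using az zb by (intro fundamental_theorem_of_calculus) auto
    then have A: "?A = (F (sqrt l * w b) - F (sqrt l * w a)) / of_real (s0 * sqrt l)"
      by (subst integral_unique) (auto simp: diff_divide_distrib)
    have "?A - ((c - d) / of_real s0) / of_real (sqrt l)
        = ((F (sqrt l * w b) - c) - (F (- (sqrt l * (- w a))) - d)) / of_real (s0 * sqrt l)"
      unfolding A by (simp add: diff_divide_distrib)
    also have "norm \<dots> \<le> (1 / (sqrt l * w b) + 1 / (sqrt l * (- w a))) / (s0 * sqrt l)"
      unfolding norm_divide
    proof (rule frac_le)
      show "norm ((F (sqrt l * w b) - c) - (F (- (sqrt l * (- w a))) - d)) \<le> 1 / (sqrt l * w b) + 1 / (sqrt l * (- w a))"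
        using norm_triangle_ineq4 c[of "sqrt l * w b"] d[of "sqrt l * (- w a)"] l wa
        by (smt (verit) mult_pos_pos real_sqrt_gt_zero)
      show "0 \<le> 1 / (sqrt l * w b) + 1 / (sqrt l * (- w a))"
        using l wa by (intro add_nonneg_nonneg divide_nonneg_nonneg mult_nonneg_nonneg) auto
    qed (use l s0 in \<open>auto simp: norm_mult\<close>)
    also have "\<dots> = ((1 / w b + 1 / (- w a)) / s0) / (sqrt l * sqrt l)"
      using l s0 wa by (simp add: divide_simps)
    also have "sqrt l * sqrt l = l" using l by simp
    finally have 1: "norm (?A - ((c - d) / of_real s0) / of_real (sqrt l)) \<le> ((1 / w b + 1 / (- w a)) / s0) / l" .
    have "norm ?B \<le> (\<bar>r a\<bar> + \<bar>r b\<bar> + (K * b - K * a)) / (2 * pi * l)"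
    proof (rule oscillatory_integral_bound[OF _ l, where r' = r' and R' = "\<lambda>_. K"])
      show "((*) K has_real_derivative K) (at u within {a..b})" for u
        by (auto intro!: derivative_eq_intros)
    qed (use az zb K cr' cpsi dpsi r' has_field_derivative_at_within in \<open>blast intro: less_imp_le less_trans\<close>)+
    then have 2: "norm ?B \<le> ((\<bar>r a\<bar> + \<bar>r b\<bar> + (K * b - K * a)) / (2 * pi)) / l"
      unfolding divide_divide_eq_left .
    have "norm (?A + ?B - ((c - d) / of_real s0) / of_real (sqrt l)) \<le> norm (?A - ((c - d) / of_real s0) / of_real (sqrt l)) + norm ?B"
      using norm_triangle_ineq[of "?A - ((c - d) / of_real s0) / of_real (sqrt l)" ?B] by (simp only: diff_add_eq)
    also have "\<dots> \<le> D / l"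
      using 1 2 unfolding D_def by (simp add: add_divide_distrib)
    finally show ?thesis unfolding AB .
  qed
  then show ?thesis unfolding \<psi>_def by blast
qed

text \<open>The positive critical point of \<open>s x\<^sup>k - x\<close>.\<close>
definition crit :: "nat \<Rightarrow> real \<Rightarrow> real" where
  "crit k s = (real k * s) powr (- (1 / (real k - 1)))"

lemma crit_pos: "k \<ge> 2 \<Longrightarrow> s > 0 \<Longrightarrow> crit k s > 0"
  by (simp add: crit_def)

lemma crit_power:
  assumes "k \<ge> 2" "s > 0"
  shows "crit k s ^ (k - 1) = 1 / (real k * s)"
proof -
  have "crit k s ^ (k - 1) = (real k * s) powr (- (1 / (real k - 1)) * real (k - 1))"
    using assms crit_pos[OF assms] by (simp add: crit_def powr_powr flip: powr_realpow)
  also have "- (1 / (real k - 1)) * real (k - 1) = - 1"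
    using assms by (simp add: of_nat_diff field_simps)
  finally show ?thesis
    using assms by (simp add: powr_minus_divide)
qed

section \<open>The rescaled phase and the Gram integrals\<close>

lemma geometric_factor: "(u - 1) * (\<Sum>i<n. u ^ i) = u ^ n - (1::real)"
  by (simp add: power_diff_1_eq)

text \<open>After the rescaling \<open>x = x0 u\<close> the phase is a multiple of
  \<open>u ^ k / k - u\<close>, with critical point 1. Subtracting the critical value leaves a
  double zero, and dividing it out by two geometric sums produces a polynomial with nonnegative
  coefficients, hence positive for \<open>u \<ge> 0\<close>. The last claim reads
  \<open>(u - 1) q = u ^ (k - 1) - 1\<close>, where both sides have the sign of
  \<open>u - 1\<close>. These are the hypotheses of \<open>stationary_phase\<close> at
  \<open>z = 1\<close>.\<close>

lemma phase_factor:
  assumes "k \<ge> 2"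
  obtains p :: "real poly" where
    "\<And>u. (u - 1)\<^sup>2 * poly p u = (u ^ k - 1) / real k - (u - 1)"
    "\<And>u. u \<ge> 0 \<Longrightarrow> poly p u > 0"
    "\<And>u. u \<ge> 0 \<Longrightarrow> 2 * poly p u + (u - 1) * poly (pderiv p) u > 0"
proof -
  define p :: "real poly" where "p = smult (1 / real k) (\<Sum>i<k. \<Sum>j<i. monom 1 j)"
  have pe: "poly p u = (\<Sum>i<k. \<Sum>j<i. u ^ j) / real k" for u
    by (simp add: p_def poly_sum poly_monom)
  have k: "real k > 0" using assms by simp
  have 1: "(u - 1)\<^sup>2 * poly p u = (u ^ k - 1) / real k - (u - 1)" for u
  proof -
    have "(u - 1)\<^sup>2 * poly p u = (u - 1) * (\<Sum>i<k. (u - 1) * (\<Sum>j<i. u ^ j)) / real k"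
      by (simp add: pe power2_eq_square sum_distrib_left mult.assoc)
    also have "\<dots> = (u - 1) * ((\<Sum>i<k. u ^ i) - real k) / real k"
      by (simp add: geometric_factor sum_subtractf)
    also have "\<dots> = ((u - 1) * (\<Sum>i<k. u ^ i) - (u - 1) * real k) / real k"
      by (simp add: algebra_simps)
    also have "\<dots> = (u ^ k - 1) / real k - (u - 1)"
      unfolding geometric_factor using k by (simp add: field_simps)
    finally show ?thesis .
  qed
  have 2: "poly p u > 0" if "u \<ge> 0" for u
  proof -
    have "0 < (\<Sum>j<(1::nat). u ^ j)" by simp
    also have "\<dots> \<le> (\<Sum>i<k. \<Sum>j<i. u ^ j)"
      by (rule member_le_sum[of 1 "{..<k}" "\<lambda>i. \<Sum>j<i. u ^ j"]) (use that assms in \<open>auto intro!: sum_nonneg\<close>)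
    finally show ?thesis using k by (simp add: pe)
  qed
  have 3: "2 * poly p u + (u - 1) * poly (pderiv p) u > 0" (is "?q > 0") if u: "u \<ge> 0" for u
  proof -
    have "((\<lambda>u. (u - 1)\<^sup>2 * poly p u) has_real_derivative (u - 1) * ?q) (at u)"
      by (auto intro!: derivative_eq_intros poly_DERIV simp: algebra_simps power2_eq_square)
    moreover have "((\<lambda>u. (u - 1)\<^sup>2 * poly p u) has_real_derivative u ^ (k - 1) - 1) (at u)"
      unfolding 1 using k by (auto intro!: derivative_eq_intros)
    ultimately have e: "(u - 1) * ?q = u ^ (k - 1) - 1"
      by (rule DERIV_unique)
    consider "u = 1" | "u < 1" | "u > 1" by linarith
    then show ?thesis
    proof cases
      case 2
      then have "u ^ (k - 1) < 1"
        using u assms by (intro power_less_one_iff[THEN iffD2]) auto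
      then have "(u - 1) * ?q < 0" using e by simp
      then show ?thesis using 2 by (simp add: mult_less_0_iff)
    next
      case 3
      then have "u ^ (k - 1) > 1"
        using assms by (intro one_less_power) auto
      then have "(u - 1) * ?q > 0" using e by simp
      then show ?thesis using 3 by (simp add: zero_less_mult_iff)
    qed (use \<open>\<And>u. u \<ge> 0 \<Longrightarrow> poly p u > 0\<close> in auto)
  qed
  show ?thesis using that 1 2 3 by blast
qed

text \<open>Scaling by the critical point gives one fixed phase with parameter
  \<open>l = h x0\<close> on \<open>{0..1 / x0}\<close>. Only the right end depends on
  \<open>s\<close>, so the interval is cut at a fixed \<open>V\<close>: stationary phase on
  \<open>{0..V}\<close> has constants independent of \<open>s\<close>, and the rest has no critical
  point. The Jacobian \<open>x0\<close> turns an error of order \<open>1 / l\<close> into one of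
  order \<open>1 / h\<close>.\<close>

lemma kernel_asymptotics:
  assumes k: "k \<ge> 3"
  shows "\<exists>c D. \<forall>h>0. \<forall>s\<ge>1.
    norm (integral {0..1} (\<lambda>x. ee (h * (s * x ^ k - x)))
      - c * of_real (sqrt (crit k s / h)) * ee (- ((1 - 1 / real k) * (h * crit k s)))) \<le> D / h"
proof -
  obtain p :: "real poly" where
    p1: "\<And>u. (u - 1)\<^sup>2 * poly p u = (u ^ k - 1) / real k - (u - 1)"
    and p2: "\<And>u. u \<ge> 0 \<Longrightarrow> poly p u > 0"
    and p3: "\<And>u. u \<ge> 0 \<Longrightarrow> 2 * poly p u + (u - 1) * poly (pderiv p) u > 0"
    using phase_factor[of k] k by auto
  define \<psi> where "\<psi> u = (u ^ k - 1) / real k - (u - 1)" for u :: real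
  \<comment> \<open>The smallest right end over all \<open>s \<ge> 1\<close>. Here
    \<open>V ^ (k - 1) = k\<close>, so on \<open>{V..U}\<close> the derivative
    \<open>u ^ (k - 1) - 1\<close> is at least \<open>k - 1 \<ge> 1\<close> and the tail is at most
    \<open>1 / l\<close>.\<close>
  define V where "V = 1 / crit k 1"
  have V1: "V > 1"
  proof -
    have "crit k 1 < 1"
      unfolding crit_def using k by (intro powr_less_one) auto
    then show ?thesis using crit_pos[of k 1] k by (simp add: V_def)
  qed
  have Vk: "V ^ (k - 1) = real k"
    using crit_power[of k 1] k by (simp add: V_def power_divide)
  have "\<exists>c D. \<forall>l>0. norm (integral {0..V} (\<lambda>u. ee (l * ((u - 1)\<^sup>2 * poly p u))) - c / of_real (sqrt l)) \<le> D / l"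
    by (rule stationary_phase) (use V1 p2 p3 in auto)
  then obtain c D where cD: "\<And>l. l > 0 \<Longrightarrow> norm (integral {0..V} (\<lambda>u. ee (l * \<psi> u)) - c / of_real (sqrt l)) \<le> D / l"
    unfolding p1 \<psi>_def by auto
  have cpsi: "continuous_on S \<psi>" for S
    unfolding \<psi>_def using k by (intro continuous_intros) auto
  have main: "norm (integral {0..1} (\<lambda>x. ee (h * (s * x ^ k - x)))
      - c * of_real (sqrt (crit k s / h)) * ee (- ((1 - 1 / real k) * (h * crit k s)))) \<le> (D + 1) / h"
    if h: "h > 0" and s: "s \<ge> 1" for h s
  proof -
    define x0 where "x0 = crit k s"
    define l where "l = h * x0"
    define U where "U = 1 / x0"
    define w where "w = ee (- ((1 - 1 / real k) * l))"
    have x0: "x0 > 0" using crit_pos[of k s] k s by (simp add: x0_def)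
    have l: "l > 0" using h x0 by (simp add: l_def)
    have "x0 \<le> crit k 1"
      unfolding x0_def crit_def using k s by (intro powr_mono2') (auto intro: divide_nonneg_nonneg)
    then have UV: "V \<le> U" unfolding U_def V_def using x0 by (intro divide_left_mono) auto
    \<comment> \<open>The critical point equation times \<open>x0\<close>. It makes the critical
      value of the phase \<open>- (1 - 1 / k) h x0\<close>.\<close>
    have xk: "s * x0 ^ k = x0 / real k"
    proof -
      have "x0 ^ k = x0 * x0 ^ (k - 1)"
        using k by (metis power_eq_if not_numeral_le_zero)
      then show ?thesis using crit_power[of k s] k s by (simp add: x0_def)
    qed
    have "((\<lambda>u. x0 *\<^sub>R ee (h * (s * (x0 * u) ^ k - x0 * u))) has_integral
        integral {x0 * 0..x0 * U} (\<lambda>x. ee (h * (s * x ^ k - x)))) {0..U}"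
      by (rule has_integral_substitution[where c = 0 and d = 1])
         (use x0 in \<open>auto intro!: continuous_intros derivative_eq_intros simp: U_def field_simps\<close>)
    moreover have "x0 *\<^sub>R ee (h * (s * (x0 * u) ^ k - x0 * u)) = (of_real x0 * w) * ee (l * \<psi> u)" for u
    proof -
      have "h * (s * (x0 * u) ^ k - x0 * u) = h * ((s * x0 ^ k) * u ^ k - x0 * u)"
        by (simp add: power_mult_distrib)
      also have "\<dots> = - ((1 - 1 / real k) * l) + l * \<psi> u"
        unfolding xk \<psi>_def l_def using k by (simp add: field_simps)
      finally show ?thesis
        by (simp only: ee_add w_def scaleR_conv_of_real mult.assoc)
    qed
    moreover have "{x0 * 0..x0 * U} = {0..1}" using x0 by (simp add: U_def)
    ultimately have "integral {0..1} (\<lambda>x. ee (h * (s * x ^ k - x))) = integral {0..U} (\<lambda>u. (of_real x0 * w) * ee (l * \<psi> u))"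
      by (simp only: integral_unique)
    also have "\<dots> = (of_real x0 * w) * integral {0..U} (\<lambda>u. ee (l * \<psi> u))"
      by simp
    also have "integral {0..U} (\<lambda>u. ee (l * \<psi> u)) = integral {0..V} (\<lambda>u. ee (l * \<psi> u)) + integral {V..U} (\<lambda>u. ee (l * \<psi> u))"
      using V1 UV by (intro Henstock_Kurzweil_Integration.integral_combine[symmetric] integrable_continuous_real continuous_intros cpsi) auto
    finally have I: "integral {0..1} (\<lambda>x. ee (h * (s * x ^ k - x)))
      = (of_real x0 * w) * (integral {0..V} (\<lambda>u. ee (l * \<psi> u)) + integral {V..U} (\<lambda>u. ee (l * \<psi> u)))" .
    have "norm (integral {V..U} (\<lambda>u. ee (l * \<psi> u))) \<le> 1 / (l * (V ^ (k - 1) - 1))"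
      by (rule first_derivative_test[where \<phi>' = "\<lambda>u. u ^ (k - 1) - 1" and \<phi>'' = "\<lambda>u. real (k - 1) * u ^ (k - 1 - 1)"])
         (use V1 UV l k Vk in \<open>auto intro!: derivative_eq_intros continuous_intros simp: \<psi>_def\<close>)
    also have "\<dots> \<le> 1 / l"
      unfolding Vk using l k by (intro divide_left_mono) (auto simp: mult_le_cancel_left1)
    finally have tail: "norm (integral {V..U} (\<lambda>u. ee (l * \<psi> u))) \<le> 1 / l" .
    have sq: "x0 / sqrt l = sqrt (x0 / h)"
      using x0 h by (simp add: l_def real_sqrt_mult real_sqrt_divide field_simps)
    have "integral {0..1} (\<lambda>x. ee (h * (s * x ^ k - x))) - c * of_real (sqrt (x0 / h)) * w
      = (of_real x0 * w) * ((integral {0..V} (\<lambda>u. ee (l * \<psi> u)) - c / of_real (sqrt l)) + integral {V..U} (\<lambda>u. ee (l * \<psi> u)))"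
      unfolding I sq[symmetric] by (simp add: algebra_simps)
    also have "norm \<dots> \<le> x0 * (D / l + 1 / l)"
      using norm_triangle_mono[OF cD[OF l] tail] x0 by (simp add: norm_mult w_def)
    also have "\<dots> = (D + 1) / h"
      using x0 h by (simp add: l_def field_simps)
    finally show ?thesis by (simp add: x0_def w_def l_def)
  qed
  then show ?thesis by blast
qed

section \<open>Exponential sums\<close>

text \<open>All sums over consecutive indices are bounded, not only the full one. This is the
  hypothesis that partial summation needs and also the conclusion it yields, so that monotone
  weights can be attached one after the other.\<close>

definition bounded_sums :: "(nat \<Rightarrow> complex) \<Rightarrow> nat \<Rightarrow> nat \<Rightarrow> real \<Rightarrow> bool" where
  "bounded_sums z a b B \<longleftrightarrow> (\<forall>i j. a \<le> i \<longrightarrow> i \<le> j \<longrightarrow> j \<le> b \<longrightarrow> norm (\<Sum>m=i..<j. z m) \<le> B)"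

text \<open>Induction on the length: subtracting the last weight from all weights makes the last
  term disappear and leaves the others decreasing and nonnegative. The two contributions
  \<open>w j0 * B\<close> and \<open>(w i - w j0) * B\<close> add up exactly.\<close>

lemma abel_decreasing:
  fixes w :: "nat \<Rightarrow> real" and z :: "nat \<Rightarrow> complex"
  assumes "i < j" and "\<And>j'. i \<le> j' \<Longrightarrow> j' \<le> j \<Longrightarrow> norm (\<Sum>m=i..<j'. z m) \<le> B"
    and "\<And>m m'. i \<le> m \<Longrightarrow> m \<le> m' \<Longrightarrow> m' < j \<Longrightarrow> w m' \<le> w m"
    and "\<And>m. i \<le> m \<Longrightarrow> m < j \<Longrightarrow> 0 \<le> w m"
  shows "norm (\<Sum>m=i..<j. of_real (w m) * z m) \<le> w i * B"
  using assms
proof (induction "j - i" arbitrary: j w)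
  case (Suc d)
  obtain j0 where j: "j = Suc j0" using Suc.prems(1) by (cases j) auto
  then have ij: "i \<le> j0" using Suc.prems(1) by simp
  have split: "(\<Sum>m=i..<j. of_real (w m) * z m)
      = of_real (w j0) * (\<Sum>m=i..<j. z m) + (\<Sum>m=i..<j0. of_real (w m - w j0) * z m)"
    unfolding j using ij by (simp add: sum_distrib_left sum.distrib[symmetric] algebra_simps)
  have 1: "norm (of_real (w j0) * (\<Sum>m=i..<j. z m)) \<le> w j0 * B"
    using Suc.prems(2)[of j] Suc.prems(4)[of j0] ij j by (simp add: norm_mult mult_left_mono)
  have 2: "norm (\<Sum>m=i..<j0. of_real (w m - w j0) * z m) \<le> (w i - w j0) * B"
  proof (cases "i = j0")
    case False
    show ?thesis
      by (rule Suc.hyps(1)) (use Suc ij j False in auto)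
  qed auto
  show ?case
    unfolding split using norm_triangle_mono[OF 1 2] by (simp add: algebra_simps)
qed simp

lemma bounded_sums_antimono_weight:
  fixes w :: "nat \<Rightarrow> real"
  assumes z: "bounded_sums z a b B"
    and w: "\<And>m m'. a \<le> m \<Longrightarrow> m \<le> m' \<Longrightarrow> m' < b \<Longrightarrow> w m' \<le> w m"
    and w0: "\<And>m. a \<le> m \<Longrightarrow> m < b \<Longrightarrow> 0 \<le> w m \<and> w m \<le> W" and W: "0 \<le> W" and B: "0 \<le> B"
  shows "bounded_sums (\<lambda>m. of_real (w m) * z m) a b (W * B)"
  unfolding bounded_sums_def
proof (intro allI impI)
  fix i j assume ij: "a \<le> i" "i \<le> j" "j \<le> b"
  show "norm (\<Sum>m=i..<j. of_real (w m) * z m) \<le> W * B"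
  proof (cases "i = j")
    case False
    have "norm (\<Sum>m=i..<j. of_real (w m) * z m) \<le> w i * B"
      by (rule abel_decreasing) (use False ij z w w0 in \<open>auto simp: bounded_sums_def\<close>)
    also have "\<dots> \<le> W * B"
      using w0[of i] ij False B by (intro mult_right_mono) auto
    finally show ?thesis .
  qed (use W B in auto)
qed

text \<open>The weights \<open>W - w m\<close> decrease, and \<open>w = W - (W - w)\<close>; the two
  parts account for the factor 2.\<close>

lemma bounded_sums_mono_weight:
  fixes w :: "nat \<Rightarrow> real"
  assumes z: "bounded_sums z a b B"
    and w: "\<And>m m'. a \<le> m \<Longrightarrow> m \<le> m' \<Longrightarrow> m' < b \<Longrightarrow> w m \<le> w m'"
    and w0: "\<And>m. a \<le> m \<Longrightarrow> m < b \<Longrightarrow> 0 \<le> w m \<and> w m \<le> W" and W: "0 \<le> W" and B: "0 \<le> B"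
  shows "bounded_sums (\<lambda>m. of_real (w m) * z m) a b (2 * W * B)"
  unfolding bounded_sums_def
proof (intro allI impI)
  fix i j assume ij: "a \<le> i" "i \<le> j" "j \<le> b"
  have "bounded_sums (\<lambda>m. of_real (W - w m) * z m) a b (W * B)"
    by (rule bounded_sums_antimono_weight[OF z]) (use w w0 W B in auto)
  then have 1: "norm (\<Sum>m=i..<j. of_real (W - w m) * z m) \<le> W * B"
    using ij by (simp add: bounded_sums_def)
  have 2: "norm (of_real W * (\<Sum>m=i..<j. z m)) \<le> W * B"
    using z ij W by (simp add: bounded_sums_def norm_mult mult_left_mono)
  have "(\<Sum>m=i..<j. of_real (w m) * z m) = of_real W * (\<Sum>m=i..<j. z m) - (\<Sum>m=i..<j. of_real (W - w m) * z m)"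
    by (simp add: sum_distrib_left sum_subtractf[symmetric] algebra_simps)
  then show "norm (\<Sum>m=i..<j. of_real (w m) * z m) \<le> 2 * W * B"
    using norm_triangle_ineq4[of "of_real W * (\<Sum>m=i..<j. z m)" "\<Sum>m=i..<j. of_real (W - w m) * z m"] 1 2 by simp
qed

text \<open>The identity \<open>1 / (1 - ee d) = 1/2 + (i/2) cot (pi d)\<close>. Its real part is
  constant and its imaginary part is monotone in \<open>d\<close>, which makes the factor accessible
  to partial summation.\<close>

lemma ee_geometric:
  assumes s: "sin (pi * d) \<noteq> 0"
  shows "(1 / 2 + \<i> / 2 * of_real (cos (pi * d) / sin (pi * d))) * (1 - ee d) = 1"
proof -
  have "cos (2 * pi * d) = 1 - 2 * (sin (pi * d))\<^sup>2" and "sin (2 * pi * d) = 2 * sin (pi * d) * cos (pi * d)"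
    using cos_double_sin[of "pi * d"] sin_double[of "pi * d"] by (simp_all add: mult.assoc)
  then have e: "1 - ee d = 2 * of_real (sin (pi * d)) * (of_real (sin (pi * d)) - \<i> * of_real (cos (pi * d)))"
    by (simp add: ee_def complex_eq_iff power2_eq_square)
  have p: "of_real (sin (pi * d)) * of_real (sin (pi * d)) + of_real (cos (pi * d)) * of_real (cos (pi * d)) = (1::complex)"
    by (metis (no_types, lifting) of_real_1 of_real_add of_real_mult power2_eq_square sin_cos_squared_add)
  have "(1 / 2 + \<i> / 2 * (C / S)) * (2 * S * (S - \<i> * C)) = S * S + C * C" if "S \<noteq> 0" for S C :: complex
    using that by (simp add: field_simps)
  then show ?thesis
    unfolding e using s p by (simp del: of_real_mult of_real_add)
qed

text \<open>Up to \<open>1/6\<close> the cosine stays above \<open>1/2\<close> and the mean value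
  theorem gives \<open>pi d / 2\<close>; beyond \<open>1/6\<close> the sine is at least
  \<open>1/2\<close>.\<close>

lemma sin_pi_ge:
  assumes "0 \<le> d" "d \<le> 1 / 2"
  shows "d \<le> sin (pi * d)"
proof (cases "d \<le> 1 / 6")
  case True
  show ?thesis
  proof (cases "d = 0")
    case False
    then have d: "0 < pi * d" using assms by simp
    obtain x where x: "0 < x" "x < pi * d" "sin (pi * d) - sin 0 = (pi * d - 0) * cos x"
      using MVT2[OF d, of sin cos] by (auto intro: DERIV_sin)
    have "x \<le> pi / 3" using x(2) mult_left_mono[OF True pi_ge_zero] pi_gt_zero by linarith
    then have "cos (pi / 3) \<le> cos x" using x(1) by (intro cos_monotone_0_pi_le) auto
    then have "1 / 2 \<le> cos x" by (simp add: cos_60)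
    then have "(pi * d) * (1 / 2) \<le> (pi * d) * cos x" using d by (intro mult_left_mono) auto
    moreover have "2 * d \<le> pi * d" using pi_ge_two assms by (intro mult_right_mono)
    moreover have "sin (pi * d) = (pi * d) * cos x" using x(3) by simp
    ultimately show ?thesis by linarith
  qed simp
next
  case False
  then have "pi / 6 \<le> pi * d" "pi * d \<le> pi / 2"
    using mult_left_mono[of "1 / 6" d pi] mult_left_mono[OF assms(2), of pi] by auto
  then have "sin (pi / 6) \<le> sin (pi * d)"
    using pi_gt_zero by (intro sin_monotone_2pi_le) auto
  then show ?thesis using assms by (simp add: sin_30)
qed

text \<open>Each term is the difference \<open>ee (f m) - ee (f (Suc m))\<close>, whose sums
  telescope, times \<open>1 / (1 - ee (d m))\<close>. By \<open>ee_geometric\<close> this factor is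
  a constant plus a multiple of \<open>cot (pi d m)\<close>. As the increments decrease within
  \<open>\<theta>\<close> and \<open>1/2\<close>, the cotangent increases in \<open>m\<close> and
  stays between 0 and \<open>1 / \<theta>\<close>.\<close>

lemma kusmin_landau:
  fixes f :: "nat \<Rightarrow> real"
  assumes t: "0 < \<theta>"
    and lo: "\<And>m. a \<le> m \<Longrightarrow> m < b \<Longrightarrow> \<theta> \<le> f (Suc m) - f m"
    and hi: "\<And>m. a \<le> m \<Longrightarrow> m < b \<Longrightarrow> f (Suc m) - f m \<le> 1 / 2"
    and mono: "\<And>m m'. a \<le> m \<Longrightarrow> m \<le> m' \<Longrightarrow> m' < b \<Longrightarrow> f (Suc m') - f m' \<le> f (Suc m) - f m"
  shows "bounded_sums (\<lambda>m. ee (f m)) a b (3 / \<theta>)"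
  unfolding bounded_sums_def
proof (intro allI impI)
  fix i j assume ij: "a \<le> i" "i \<le> j" "j \<le> b"
  define d where "d m = f (Suc m) - f m" for m
  define z where "z m = ee (f m) - ee (f (Suc m))" for m
  define w where "w m = cos (pi * d m) / sin (pi * d m)" for m
  show "norm (\<Sum>m=i..<j. ee (f m)) \<le> 3 / \<theta>"
  proof (cases "i = j")
    case True
    then show ?thesis using t by simp
  next
    case False
    \<comment> \<open>A nonempty range forces this; it later absorbs the telescoping contribution 1
      into \<open>3 / \<theta>\<close>.\<close>
    then have t2: "\<theta> \<le> 1 / 2" using lo[of i] hi[of i] ij by linarith
    have d: "\<theta> \<le> d m" "d m \<le> 1 / 2" if "a \<le> m" "m < b" for m
      using lo hi that by (auto simp: d_def)
    have sn: "\<theta> \<le> sin (pi * d m)" if "a \<le> m" "m < b" for m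
      using sin_pi_ge[of "d m"] d[OF that] t by linarith
    have cs: "0 \<le> cos (pi * d m)" if "a \<le> m" "m < b" for m
      using d[OF that] t by (intro cos_ge_zero) (auto intro: order_trans[of _ 0])
    have z: "bounded_sums z a b 2"
      unfolding bounded_sums_def
    proof (intro allI impI)
      fix i j :: nat assume "i \<le> j"
      then have "(\<Sum>m=i..<j. z m) = - (ee (f j) - ee (f i))"
        unfolding z_def using sum_Suc_diff'[of i j "\<lambda>m. ee (f m)"]
        by (metis (no_types, lifting) minus_diff_eq sum.cong sum_negf)
      then show "norm (\<Sum>m=i..<j. z m) \<le> 2"
        using norm_triangle_ineq4[of "ee (f j)" "ee (f i)"] by (simp add: norm_minus_commute)
    qed
    have "bounded_sums (\<lambda>m. of_real (w m) * z m) a b (2 * (1 / \<theta>) * 2)"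
    proof (rule bounded_sums_mono_weight[OF z])
      fix m m' assume m: "a \<le> m" "m \<le> m'" "m' < b"
      then have dd: "d m' \<le> d m" using mono by (simp add: d_def)
      have "pi * d m \<le> pi * (1 / 2)"
        using d[of m] m by (intro mult_left_mono) auto
      then have "cos (pi * d m) \<le> cos (pi * d m')" "sin (pi * d m') \<le> sin (pi * d m)"
        using d[of m] d[of m'] m t dd
        by (intro cos_monotone_0_pi_le sin_monotone_2pi_le; auto intro: order_trans[of _ 0])+
      then show "w m \<le> w m'"
        unfolding w_def using sn[of m'] t m cs[of m'] by (intro frac_le) auto
    next
      fix m assume m: "a \<le> m" "m < b"
      show "0 \<le> w m \<and> w m \<le> 1 / \<theta>"
        unfolding w_def using sn[OF m] cs[OF m] t by (auto intro!: frac_le)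
    qed (use t in auto)
    then have 1: "norm (\<Sum>m=i..<j. of_real (w m) * z m) \<le> 4 / \<theta>"
      using ij by (simp add: bounded_sums_def)
    have 2: "norm (\<Sum>m=i..<j. z m) \<le> 2"
      using z ij by (simp add: bounded_sums_def)
    have "ee (f m) = 1 / 2 * z m + \<i> / 2 * (of_real (w m) * z m)" if m: "m \<in> {i..<j}" for m
    proof -
      have "ee (f (Suc m)) = ee (f m) * ee (d m)"
        by (simp add: d_def flip: ee_add)
      then have "1 / 2 * z m + \<i> / 2 * (of_real (w m) * z m)
          = ee (f m) * ((1 / 2 + \<i> / 2 * of_real (w m)) * (1 - ee (d m)))"
        unfolding z_def by (simp add: field_simps)
      also have "\<dots> = ee (f m)"
        unfolding w_def using sn[of m] m ij t by (subst ee_geometric) auto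
      finally show ?thesis ..
    qed
    then have "(\<Sum>m=i..<j. ee (f m)) = 1 / 2 * (\<Sum>m=i..<j. z m) + \<i> / 2 * (\<Sum>m=i..<j. of_real (w m) * z m)"
      by (simp add: sum_distrib_left sum.distrib)
    also have "norm \<dots> \<le> 1 + 2 / \<theta>"
      using 1 2 by (intro norm_triangle_mono) (simp_all add: norm_mult)
    also have "\<dots> \<le> 3 / \<theta>"
      using t t2 by (simp add: field_simps)
    finally show ?thesis .
  qed
qed

section \<open>Differences of negative powers\<close>

lemma second_difference_eq_deriv2:
  fixes f f' f'' :: "real \<Rightarrow> real"
  assumes f: "\<And>x. s \<le> x \<Longrightarrow> (f has_real_derivative f' x) (at x)"
    and f': "\<And>x. s \<le> x \<Longrightarrow> (f' has_real_derivative f'' x) (at x)"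
  obtains x where "s < x" "x < s + 2" "f (s + 2) - 2 * f (s + 1) + f s = f'' x"
proof -
  have "\<exists>y. s < y \<and> y < s + 1 \<and> (f (s + 1 + 1) - f (s + 1)) - (f (s + 1) - f s) = (s + 1 - s) * (f' (y + 1) - f' y)"
    by (rule MVT2) (auto intro!: derivative_eq_intros DERIV_shift[THEN iffD1] f)
  then obtain y where y: "s < y" "y < s + 1" "f (s + 2) - 2 * f (s + 1) + f s = f' (y + 1) - f' y"
    by (auto simp: add.assoc)
  have "\<exists>x. y < x \<and> x < y + 1 \<and> f' (y + 1) - f' y = (y + 1 - y) * f'' x"
    by (rule MVT2) (use y f' in auto)
  then obtain x where "y < x" "x < y + 1" "f' (y + 1) - f' y = f'' x" by auto
  then show ?thesis using that[of x] y by simp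
qed

text \<open>A unit step in \<open>n\<close> or in \<open>m\<close> is a unit step in
  \<open>s = n + m\<close>. The second difference in \<open>s\<close> is therefore also the mixed
  difference of \<open>(n + m) powr (- \<alpha>)\<close>.\<close>

definition diff2_powr :: "real \<Rightarrow> real \<Rightarrow> real" where
  "diff2_powr \<alpha> s = (s + 2) powr (- \<alpha>) - 2 * (s + 1) powr (- \<alpha>) + s powr (- \<alpha>)"

lemma diff2_powr_bounds:
  assumes a: "\<alpha> > 0" and s: "s > 0"
  shows "\<alpha> * (\<alpha> + 1) * (s + 2) powr (- \<alpha> - 2) \<le> diff2_powr \<alpha> s"
    and "diff2_powr \<alpha> s \<le> \<alpha> * (\<alpha> + 1) * s powr (- \<alpha> - 2)"
proof -
  have f: "((\<lambda>x. x powr (- \<alpha>)) has_real_derivative - \<alpha> * x powr (- \<alpha> - 1)) (at x)"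
    and f': "((\<lambda>x. - \<alpha> * x powr (- \<alpha> - 1)) has_real_derivative \<alpha> * (\<alpha> + 1) * x powr (- \<alpha> - 2)) (at x)"
    if "s \<le> x" for x
    using s that by (auto intro!: derivative_eq_intros simp: algebra_simps)
  obtain x where x: "s < x" "x < s + 2" "diff2_powr \<alpha> s = \<alpha> * (\<alpha> + 1) * x powr (- \<alpha> - 2)"
    unfolding diff2_powr_def
    using second_difference_eq_deriv2[of s "\<lambda>x. x powr (- \<alpha>)" "\<lambda>x. - \<alpha> * x powr (- \<alpha> - 1)" "\<lambda>x. \<alpha> * (\<alpha> + 1) * x powr (- \<alpha> - 2)"] f f'
    by blast
  show "\<alpha> * (\<alpha> + 1) * (s + 2) powr (- \<alpha> - 2) \<le> diff2_powr \<alpha> s"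
    and "diff2_powr \<alpha> s \<le> \<alpha> * (\<alpha> + 1) * s powr (- \<alpha> - 2)"
    unfolding x(3) using x a s by (auto intro!: mult_left_mono powr_mono2')
qed

text \<open>The derivative of the second difference is the second difference of the derivative,
  hence a value of the third derivative of \<open>x powr (- \<alpha>)\<close>, which is
  negative.\<close>

lemma diff2_powr_antimono:
  assumes a: "\<alpha> > 0" and s: "0 < s" "s \<le> t"
  shows "diff2_powr \<alpha> t \<le> diff2_powr \<alpha> s"
proof (rule DERIV_nonpos_imp_nonincreasing[OF s(2)])
  fix u assume u: "s \<le> u" "u \<le> t"
  let ?f = "\<lambda>x. - \<alpha> * x powr (- \<alpha> - 1)"
  have "(diff2_powr \<alpha> has_real_derivative ?f (u + 2) - 2 * ?f (u + 1) + ?f u) (at u)"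
    unfolding diff2_powr_def[abs_def] using u s by (auto intro!: derivative_eq_intros)
  moreover have f': "(?f has_real_derivative \<alpha> * (\<alpha> + 1) * x powr (- \<alpha> - 2)) (at x)"
    and f'': "((\<lambda>x. \<alpha> * (\<alpha> + 1) * x powr (- \<alpha> - 2)) has_real_derivative - (\<alpha> * (\<alpha> + 1) * (\<alpha> + 2)) * x powr (- \<alpha> - 3)) (at x)"
    if "u \<le> x" for x
    using s u that by (auto intro!: derivative_eq_intros simp: algebra_simps)
  obtain x where "u < x" "?f (u + 2) - 2 * ?f (u + 1) + ?f u = - (\<alpha> * (\<alpha> + 1) * (\<alpha> + 2)) * x powr (- \<alpha> - 3)"
    using second_difference_eq_deriv2[OF f' f''] by blast
  then have "?f (u + 2) - 2 * ?f (u + 1) + ?f u \<le> 0"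
    using a by simp
  ultimately show "\<exists>y. (diff2_powr \<alpha> has_real_derivative y) (at u) \<and> y \<le> 0" by blast
qed

text \<open>In a unit cell the factors of the two middle corners are \<open>\<nu> + 1 - m\<close>
  and \<open>\<nu> - 1 - m\<close>, both at argument \<open>\<nu> + m + 1\<close>. The shifts
  cancel, so \<open>\<nu> - m\<close> factors out of a plain second difference. Summing the cells
  telescopes in \<open>\<nu>\<close>, which reduces distant \<open>n\<close> and \<open>n'\<close>
  to neighbours.\<close>

lemma mixed_difference:
  fixes \<alpha> :: real and n n' m :: nat
  assumes "n' \<le> n"
  defines "F \<equiv> \<lambda>\<nu> m. (real \<nu> - real m) * (real \<nu> + real m) powr (- \<alpha>)"
  shows "(F n (Suc m) - F n' (Suc m)) - (F n m - F n' m) = (\<Sum>\<nu>=n'..<n. (real \<nu> - real m) * diff2_powr \<alpha> (real \<nu> + real m))"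
proof -
  have "(\<Sum>\<nu>=n'..<n. (F (Suc \<nu>) (Suc m) - F (Suc \<nu>) m) - (F \<nu> (Suc m) - F \<nu> m))
     = (F n (Suc m) - F n m) - (F n' (Suc m) - F n' m)"
    using sum_Suc_diff'[OF assms(1), of "\<lambda>\<nu>. F \<nu> (Suc m) - F \<nu> m"] .
  moreover have "(F (Suc \<nu>) (Suc m) - F (Suc \<nu>) m) - (F \<nu> (Suc m) - F \<nu> m) = (real \<nu> - real m) * diff2_powr \<alpha> (real \<nu> + real m)" for \<nu>
  proof -
    have "real (Suc \<nu>) + real (Suc m) = real \<nu> + real m + 2" "real (Suc \<nu>) + real m = real \<nu> + real m + 1"
      "real \<nu> + real (Suc m) = real \<nu> + real m + 1" by simp_all
    then show ?thesis
      unfolding F_def diff2_powr_def by (simp only:) (simp add: algebra_simps)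
  qed
  ultimately have "(\<Sum>\<nu>=n'..<n. (real \<nu> - real m) * diff2_powr \<alpha> (real \<nu> + real m))
     = (F n (Suc m) - F n m) - (F n' (Suc m) - F n' m)"
    by (simp only:)
  then show ?thesis by linarith
qed

section \<open>The main term of the Gram kernel\<close>

text \<open>Leading term of the Gram kernel, restricted to \<open>H \<le> n - m < 2 H\<close>.\<close>
definition main_kernel :: "nat \<Rightarrow> nat \<Rightarrow> nat \<Rightarrow> nat \<Rightarrow> complex" where
  "main_kernel k H n m =
    (if m + H \<le> n \<and> n < m + 2 * H
     then of_real (sqrt (crit k (real n + real m) / (real n - real m)))
       * ee (- ((1 - 1 / real k) * ((real n - real m) * crit k (real n + real m))))
     else 0)"

lemma crit_antimono: "k \<ge> 2 \<Longrightarrow> 0 < s \<Longrightarrow> s \<le> t \<Longrightarrow> crit k t \<le> crit k s"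
  unfolding crit_def by (intro powr_mono2') (auto intro: divide_nonneg_nonneg)

lemma crit_le_powr:
  assumes "k \<ge> 2" "0 < t" "t \<le> s"
  shows "crit k s \<le> t powr (- (1 / (real k - 1)))"
proof -
  have "1 * s \<le> real k * s" using assms by (intro mult_right_mono) auto
  then show ?thesis
    unfolding crit_def using assms by (intro powr_mono2') (auto simp del: mult_le_cancel_right1 intro: order_trans)
qed

text \<open>The phase increments in \<open>m\<close> are sums of \<open>n - n'\<close> mixed
  differences, each at least of order \<open>H M powr (- \<alpha> - 2)\<close> and decreasing in
  \<open>m\<close>. Kusmin-Landau bounds the exponential sum by the reciprocal of their total, and
  the amplitude contributes at most \<open>M powr (- \<alpha>) / H\<close>. The powers with exponent
  \<open>\<alpha>\<close> cancel, leaving \<open>(M / H)\<^sup>2 / (n - n')\<close>.\<close>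

lemma main_kernel_correlation:
  assumes k: "k \<ge> 3"
  shows "\<exists>C>0. \<forall>M H n n'. 1 \<le> M \<longrightarrow> 1 \<le> H \<longrightarrow> n \<in> {M..<2*M} \<longrightarrow> n' \<in> {M..<2*M} \<longrightarrow> n' < n \<longrightarrow>
     norm (\<Sum>m=M..<2*M. main_kernel k H n m * cnj (main_kernel k H n' m))
       \<le> C * (real M / real H)\<^sup>2 / (real n - real n')"
proof -
  define \<alpha> where "\<alpha> = 1 / (real k - 1)"
  define \<beta> where "\<beta> = (1 - 1 / real k) * real k powr (- \<alpha>)"
  define \<gamma> where "\<gamma> = \<beta> * (\<alpha> * (\<alpha> + 1))"
  \<comment> \<open>The leading 6 is 3 from Kusmin-Landau times 2 from the increasing weight; the
    power of 6 arises because \<open>6 M\<close> bounds the arguments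
    \<open>\<nu> + m + 2\<close>.\<close>
  define C where "C = 6 * 6 powr (\<alpha> + 2) / \<gamma>"
  have a: "0 < \<alpha>" "\<alpha> \<le> 1 / 2" using k by (auto simp: \<alpha>_def field_simps)
  have "real k powr (- \<alpha>) \<le> real k powr 0"
    using a k by (intro powr_mono) auto
  then have "real k powr (- \<alpha>) \<le> 1" using k by simp
  then have b: "0 < \<beta>" "\<beta> \<le> 1" using k by (auto simp: \<beta>_def intro!: mult_le_one)
  have g: "\<gamma> > 0" using a b by (simp add: \<gamma>_def)
  have C: "C > 0" using g by (simp add: C_def)
  have "norm (\<Sum>m=M..<2*M. main_kernel k H n m * cnj (main_kernel k H n' m))
       \<le> C * (real M / real H)\<^sup>2 / (real n - real n')"
    if M: "1 \<le> M" and H: "1 \<le> H" and n: "n \<in> {M..<2*M}" and n': "n' \<in> {M..<2*M}" and nn': "n' < n" for M H n n'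
  proof -
    \<comment> \<open>The range of \<open>m\<close> where both entries are nonzero: since
      \<open>n' < n\<close>, the binding conditions are \<open>n < m + 2 H\<close> and
      \<open>m + H \<le> n'\<close>. Truncated subtraction is harmless: at the lower end the maximum
      with \<open>M\<close> takes over, and at the upper end 0 gives an empty range.\<close>
    define lo hi where "lo = max M (n + 1 - 2 * H)" and "hi = min (2 * M) (n' + 1 - H)"
    define F where "F \<nu> m = (real \<nu> - real m) * (real \<nu> + real m) powr (- \<alpha>)" for \<nu> m :: nat
    define f where "f m = \<beta> * (F n m - F n' m)" for m
    \<comment> \<open>The amplitude is split because \<open>w1\<close> decreases and
      \<open>w2\<close> increases in \<open>m\<close>, so that their product need not be monotone.
      Each factor is attached by its own partial summation.\<close>
    define w1 where "w1 m = sqrt (crit k (real n + real m)) * sqrt (crit k (real n' + real m))" for m :: nat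
    define w2 where "w2 m = 1 / (sqrt (real n - real m) * sqrt (real n' - real m))" for m :: nat
    define t where "t = \<gamma> * (6 * real M) powr (- \<alpha> - 2) * (real H * (real n - real n'))"
    have rng: "M \<le> m" "m + H \<le> n'" "n < m + 2 * H" "m < 2 * M" "m < n'"
      if "lo \<le> m" "m < hi" for m
      using that H unfolding lo_def hi_def by auto
    have t0: "t > 0" using g M H nn' by (simp add: t_def)
    have phase: "(1 - 1 / real k) * ((real \<nu> - real m) * crit k (real \<nu> + real m)) = \<beta> * F \<nu> m" for \<nu> m
      using k by (simp add: crit_def \<beta>_def F_def \<alpha>_def powr_mult)
    have prod: "main_kernel k H n m * cnj (main_kernel k H n' m)
        = (if lo \<le> m \<and> m < hi then cnj (of_real (w1 m) * (of_real (w2 m) * ee (f m))) else 0)"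
      if m: "m \<in> {M..<2*M}" for m
    proof (cases "lo \<le> m \<and> m < hi")
      case True
      then have r: "m + H \<le> n'" "n < m + 2 * H" using rng by auto
      then have "main_kernel k H n m * cnj (main_kernel k H n' m)
        = of_real (sqrt (crit k (real n + real m) / (real n - real m)) * sqrt (crit k (real n' + real m) / (real n' - real m)))
           * (ee (- (\<beta> * F n m)) * ee (\<beta> * F n' m))"
        using nn' by (simp add: main_kernel_def phase flip: ee_minus)
      also have "ee (- (\<beta> * F n m)) * ee (\<beta> * F n' m) = ee (- f m)"
        by (simp add: f_def algebra_simps flip: ee_add)
      also have "sqrt (crit k (real n + real m) / (real n - real m)) * sqrt (crit k (real n' + real m) / (real n' - real m)) = w1 m * w2 m"
        by (simp add: w1_def w2_def real_sqrt_divide)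
      finally show ?thesis using True by (simp add: ee_minus)
    next
      case False
      then have "\<not> (m + H \<le> n' \<and> n < m + 2 * H)"
        using m unfolding lo_def hi_def by auto
      then have "main_kernel k H n m = 0 \<or> main_kernel k H n' m = 0"
        unfolding main_kernel_def by auto
      then show ?thesis using False by (auto simp del: complex_cnj_mult)
    qed
    have diff: "f (Suc m) - f m = \<beta> * (\<Sum>\<nu>=n'..<n. (real \<nu> - real m) * diff2_powr \<alpha> (real \<nu> + real m))" for m
      unfolding f_def F_def using mixed_difference[of n' n m \<alpha>] nn' by (simp flip: right_diff_distrib)
    have KL: "bounded_sums (\<lambda>m. ee (f m)) lo hi (3 / t)"
    proof (rule kusmin_landau[OF t0])
      fix m assume m: "lo \<le> m" "m < hi"
      note r = rng[OF m]
      have "(\<Sum>\<nu>=n'..<n. real H * (\<alpha> * (\<alpha> + 1) * (6 * real M) powr (- \<alpha> - 2)))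
          \<le> (\<Sum>\<nu>=n'..<n. (real \<nu> - real m) * diff2_powr \<alpha> (real \<nu> + real m))"
      proof (rule sum_mono)
        fix \<nu> assume \<nu>: "\<nu> \<in> {n'..<n}"
        have "(6 * real M) powr (- \<alpha> - 2) \<le> (real \<nu> + real m + 2) powr (- \<alpha> - 2)"
          using \<nu> r a M n by (intro powr_mono2') auto
        then have "\<alpha> * (\<alpha> + 1) * (6 * real M) powr (- \<alpha> - 2) \<le> \<alpha> * (\<alpha> + 1) * (real \<nu> + real m + 2) powr (- \<alpha> - 2)"
          using a by (intro mult_left_mono) auto
        also have "\<dots> \<le> diff2_powr \<alpha> (real \<nu> + real m)"
          using diff2_powr_bounds(1)[of \<alpha> "real \<nu> + real m"] a r M by simp
        finally show "real H * (\<alpha> * (\<alpha> + 1) * (6 * real M) powr (- \<alpha> - 2)) \<le> (real \<nu> - real m) * diff2_powr \<alpha> (real \<nu> + real m)"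
          using \<nu> r a by (intro mult_mono) auto
      qed
      then have "\<beta> * ((real n - real n') * (real H * (\<alpha> * (\<alpha> + 1) * (6 * real M) powr (- \<alpha> - 2)))) \<le> f (Suc m) - f m"
        unfolding diff using b nn' by (intro mult_left_mono) (auto simp: of_nat_diff)
      then show "t \<le> f (Suc m) - f m"
        by (simp add: t_def \<gamma>_def mult_ac)
      \<comment> \<open>Increments must stay below \<open>1/2\<close> for Kusmin-Landau. Here
        \<open>\<alpha> \<le> 1/2\<close>, from \<open>k \<ge> 3\<close>, gives
        \<open>\<alpha> (\<alpha> + 1) \<le> 3/4\<close>; both \<open>\<nu> - m\<close> and the
        number of summands are at most \<open>M\<close>, so the total is at most
        \<open>3/16\<close>.\<close>
      have "(\<Sum>\<nu>=n'..<n. (real \<nu> - real m) * diff2_powr \<alpha> (real \<nu> + real m))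
          \<le> (\<Sum>\<nu>=n'..<n. real M * (3 / 4 * (1 / (2 * real M)\<^sup>2)))"
      proof (rule sum_mono)
        fix \<nu> assume \<nu>: "\<nu> \<in> {n'..<n}"
        have "diff2_powr \<alpha> (real \<nu> + real m) \<le> \<alpha> * (\<alpha> + 1) * (real \<nu> + real m) powr (- \<alpha> - 2)"
          using a r M by (intro diff2_powr_bounds) auto
        also have "\<dots> \<le> 3 / 4 * (1 / (2 * real M)\<^sup>2)"
        proof (rule mult_mono)
          have "\<alpha> * (\<alpha> + 1) \<le> 1 / 2 * (1 / 2 + 1)" using a by (intro mult_mono) auto
          then show "\<alpha> * (\<alpha> + 1) \<le> 3 / 4" by simp
          have "(real \<nu> + real m) powr (- \<alpha> - 2) \<le> (2 * real M) powr (- \<alpha> - 2)"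
            using \<nu> r a M n' by (intro powr_mono2') auto
          also have "\<dots> \<le> (2 * real M) powr (- 2)"
            using M a by (intro powr_mono) auto
          finally show "(real \<nu> + real m) powr (- \<alpha> - 2) \<le> 1 / (2 * real M)\<^sup>2"
            using M by (simp add: powr_minus_divide)
        qed auto
        finally show "(real \<nu> - real m) * diff2_powr \<alpha> (real \<nu> + real m) \<le> real M * (3 / 4 * (1 / (2 * real M)\<^sup>2))"
          using \<nu> r a M n diff2_powr_bounds(1)[of \<alpha> "real \<nu> + real m"]
          by (intro mult_mono) (auto intro: order_trans[rotated])
      qed
      also have "\<dots> = (real n - real n') * (real M * (3 / 4 * (1 / (2 * real M)\<^sup>2)))"
        using nn' by (simp add: of_nat_diff)
      also have "\<dots> \<le> real M * (real M * (3 / 4 * (1 / (2 * real M)\<^sup>2)))"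
        using n n' by (intro mult_right_mono) auto
      also have "\<dots> = 3 / 16" using M by (simp add: power2_eq_square)
      finally have S: "(\<Sum>\<nu>=n'..<n. (real \<nu> - real m) * diff2_powr \<alpha> (real \<nu> + real m)) \<le> 3 / 16" .
      have "f (Suc m) - f m \<le> \<beta> * (3 / 16)"
        unfolding diff using b S by (intro mult_left_mono) auto
      also have "\<dots> \<le> 1 / 2" using b by simp
      finally show "f (Suc m) - f m \<le> 1 / 2" .
    next
      fix m m' assume m: "lo \<le> m" "m \<le> m'" "m' < hi"
      note r = rng[of m] rng[of m']
      show "f (Suc m') - f m' \<le> f (Suc m) - f m"
        unfolding diff
      proof (intro mult_left_mono sum_mono)
        fix \<nu> assume \<nu>: "\<nu> \<in> {n'..<n}"
        have "0 \<le> \<alpha> * (\<alpha> + 1) * (real \<nu> + real m' + 2) powr (- \<alpha> - 2)" using a by simp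
        also have "\<dots> \<le> diff2_powr \<alpha> (real \<nu> + real m')"
          using a r m M by (intro diff2_powr_bounds) auto
        finally show "(real \<nu> - real m') * diff2_powr \<alpha> (real \<nu> + real m') \<le> (real \<nu> - real m) * diff2_powr \<alpha> (real \<nu> + real m)"
          using \<nu> r m M a by (intro mult_mono diff2_powr_antimono) auto
      qed (use b in auto)
    qed
    have k2: "k \<ge> 2" using k by simp
    have B2: "bounded_sums (\<lambda>m. of_real (w2 m) * ee (f m)) lo hi (2 * (1 / real H) * (3 / t))"
    proof (rule bounded_sums_mono_weight[OF KL])
      fix m m' assume m: "lo \<le> m" "m \<le> m'" "m' < hi"
      then show "w2 m \<le> w2 m'"
        unfolding w2_def using rng[of m'] nn'
        by (intro divide_left_mono mult_mono mult_pos_pos) auto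
    next
      fix m assume m: "lo \<le> m" "m < hi"
      have "real H = sqrt (real H) * sqrt (real H)" by simp
      also have "\<dots> \<le> sqrt (real n - real m) * sqrt (real n' - real m)"
        using rng[OF m] nn' by (intro mult_mono) auto
      finally have "1 / (sqrt (real n - real m) * sqrt (real n' - real m)) \<le> 1 / real H"
        using rng[OF m] nn' H by (intro divide_left_mono mult_pos_pos) auto
      then show "0 \<le> w2 m \<and> w2 m \<le> 1 / real H"
        unfolding w2_def using rng[OF m] nn' by auto
    qed (use t0 in auto)
    have B1: "bounded_sums (\<lambda>m. of_real (w1 m) * (of_real (w2 m) * ee (f m))) lo hi (real M powr (- \<alpha>) * (2 * (1 / real H) * (3 / t)))"
    proof (rule bounded_sums_antimono_weight[OF B2])
      fix m m' assume m: "lo \<le> m" "m \<le> m'" "m' < hi"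
      then have "0 < real n + real m" "0 < real n' + real m" using M n n' by auto
      then show "w1 m' \<le> w1 m"
        unfolding w1_def using m
        by (intro mult_mono real_sqrt_le_mono crit_antimono k2) (auto intro!: less_imp_le crit_pos k2)
    next
      fix m assume m: "lo \<le> m" "m < hi"
      have p: "0 < real n + real m" "0 < real n' + real m" "0 < real M" using M n n' by auto
      have "sqrt (crit k (real n + real m)) * sqrt (crit k (real n' + real m)) \<le> sqrt (real M powr (- \<alpha>)) * sqrt (real M powr (- \<alpha>))"
        unfolding \<alpha>_def using n n' p crit_pos[OF k2, THEN less_imp_le]
        by (intro mult_mono real_sqrt_le_mono crit_le_powr k2) auto
      then have "w1 m \<le> real M powr (- \<alpha>)" by (simp add: w1_def)
      moreover have "0 \<le> w1 m"
        unfolding w1_def using p crit_pos[OF k2, THEN less_imp_le] by simp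
      ultimately show "0 \<le> w1 m \<and> w1 m \<le> real M powr (- \<alpha>)" by blast
    qed (use t0 in auto)
    have "(\<Sum>m=M..<2*M. main_kernel k H n m * cnj (main_kernel k H n' m))
      = (\<Sum>m=M..<2*M. if lo \<le> m \<and> m < hi then cnj (of_real (w1 m) * (of_real (w2 m) * ee (f m))) else 0)"
      by (rule sum.cong[OF refl prod])
    also have "\<dots> = (\<Sum>m \<in> {M..<2*M} \<inter> {m. lo \<le> m \<and> m < hi}. cnj (of_real (w1 m) * (of_real (w2 m) * ee (f m))))"
      by (simp only: sum.inter_restrict[OF finite_atLeastLessThan] mem_Collect_eq)
    also have "{M..<2*M} \<inter> {m. lo \<le> m \<and> m < hi} = {lo..<hi}"
      unfolding lo_def hi_def by auto
    also have "(\<Sum>m\<in>{lo..<hi}. cnj (of_real (w1 m) * (of_real (w2 m) * ee (f m))))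
      = cnj (\<Sum>m\<in>{lo..<hi}. of_real (w1 m) * (of_real (w2 m) * ee (f m)))"
      by (simp only: cnj_sum)
    finally have "norm (\<Sum>m=M..<2*M. main_kernel k H n m * cnj (main_kernel k H n' m))
      = norm (\<Sum>m\<in>{lo..<hi}. of_real (w1 m) * (of_real (w2 m) * ee (f m)))"
      by (simp only: complex_mod_cnj)
    also have "\<dots> \<le> real M powr (- \<alpha>) * (2 * (1 / real H) * (3 / t))"
    proof (cases "lo \<le> hi")
      case True then show ?thesis using B1 unfolding bounded_sums_def by blast
    qed (use t0 in auto)
    also have "\<dots> = C * (real M / real H)\<^sup>2 / (real n - real n')"
    proof -
      have e: "real M powr (- \<alpha>) / (6 * real M) powr (- \<alpha> - 2) = 6 powr (\<alpha> + 2) * (real M)\<^sup>2"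
      proof -
        have "(6 * real M) powr (- \<alpha> - 2) = 6 powr (- \<alpha> - 2) * (real M powr (- \<alpha>) * real M powr (- 2))"
          using M by (simp add: powr_mult powr_add[symmetric])
        also have "6 powr (- \<alpha> - 2) = 1 / (6::real) powr (\<alpha> + 2)"
          by (simp add: powr_minus_divide[symmetric])
        finally show ?thesis using M by (simp add: powr_minus_divide)
      qed
      have "real M powr (- \<alpha>) * (2 * (1 / real H) * (3 / t))
        = 6 * (real M powr (- \<alpha>) / (6 * real M) powr (- \<alpha> - 2)) / (\<gamma> * (real H)\<^sup>2 * (real n - real n'))"
        by (simp add: t_def power2_eq_square mult_ac)
      also have "\<dots> = C * (real M / real H)\<^sup>2 / (real n - real n')"
        unfolding e C_def by (simp add: power_divide)
      finally show ?thesis .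
    qed
    finally show ?thesis .
  qed
  then show ?thesis using C by blast
qed

section \<open>Bounds for bilinear forms\<close>

lemma schur_test:
  fixes K :: "nat \<Rightarrow> nat \<Rightarrow> complex"
  assumes row: "\<And>n. n \<in> S \<Longrightarrow> (\<Sum>m\<in>S. norm (K n m)) \<le> R"
    and col: "\<And>m. m \<in> S \<Longrightarrow> (\<Sum>n\<in>S. norm (K n m)) \<le> R"
  shows "norm (\<Sum>n\<in>S. \<Sum>m\<in>S. a n * cnj (a m) * K n m) \<le> R * (\<Sum>n\<in>S. (norm (a n))\<^sup>2)"
proof -
  have "norm (\<Sum>n\<in>S. \<Sum>m\<in>S. a n * cnj (a m) * K n m)
      \<le> (\<Sum>n\<in>S. \<Sum>m\<in>S. ((norm (a n))\<^sup>2 / 2) * norm (K n m) + ((norm (a m))\<^sup>2 / 2) * norm (K n m))"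
  proof (intro order_trans[OF norm_sum] sum_mono)
    fix n m
    have "norm (a n) * norm (a m) \<le> (norm (a n))\<^sup>2 / 2 + (norm (a m))\<^sup>2 / 2"
      using sum_squares_bound[of "norm (a n)" "norm (a m)"] by simp
    then have "(norm (a n) * norm (a m)) * norm (K n m) \<le> ((norm (a n))\<^sup>2 / 2 + (norm (a m))\<^sup>2 / 2) * norm (K n m)"
      by (intro mult_right_mono) auto
    then show "norm (a n * cnj (a m) * K n m) \<le> ((norm (a n))\<^sup>2 / 2) * norm (K n m) + ((norm (a m))\<^sup>2 / 2) * norm (K n m)"
      by (simp add: norm_mult distrib_right)
  qed
  also have "\<dots> = (\<Sum>n\<in>S. ((norm (a n))\<^sup>2 / 2) * (\<Sum>m\<in>S. norm (K n m))) + (\<Sum>m\<in>S. ((norm (a m))\<^sup>2 / 2) * (\<Sum>n\<in>S. norm (K n m)))"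
    by (simp only: sum.distrib sum_distrib_left[symmetric])
       (subst sum.swap, simp only: sum_distrib_left[symmetric])
  also have "\<dots> \<le> (\<Sum>n\<in>S. ((norm (a n))\<^sup>2 / 2) * R) + (\<Sum>m\<in>S. ((norm (a m))\<^sup>2 / 2) * R)"
    by (intro add_mono sum_mono mult_left_mono row col) auto
  also have "\<dots> = R * (\<Sum>n\<in>S. (norm (a n))\<^sup>2)"
    by (simp add: sum_distrib_right[symmetric] sum_divide_distrib[symmetric])
  finally show ?thesis .
qed

text \<open>Cauchy-Schwarz in \<open>m\<close> strips off \<open>cnj (a m)\<close> and leaves the
  square norm of \<open>v\<close>, a form with kernel \<open>K K*\<close>. Schur's test applies to
  that kernel, and since it is Hermitian its row sums also bound its column sums. Unlike Schur's
  test for \<open>K\<close>, this sees cancellation within rows.\<close>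

lemma correlation_test:
  fixes K :: "nat \<Rightarrow> nat \<Rightarrow> complex"
  assumes R: "R \<ge> 0"
    and row: "\<And>n. n \<in> S \<Longrightarrow> (\<Sum>n'\<in>S. norm (\<Sum>m\<in>S. K n m * cnj (K n' m))) \<le> R"
  shows "norm (\<Sum>n\<in>S. \<Sum>m\<in>S. a n * cnj (a m) * K n m) \<le> sqrt R * (\<Sum>n\<in>S. (norm (a n))\<^sup>2)"
proof -
  define A where "A = (\<Sum>n\<in>S. (norm (a n))\<^sup>2)"
  define v where "v m = (\<Sum>n\<in>S. a n * K n m)" for m
  have A0: "A \<ge> 0" by (simp add: A_def sum_nonneg)
  have "of_real (\<Sum>m\<in>S. (norm (v m))\<^sup>2) = (\<Sum>m\<in>S. v m * cnj (v m))"
    by (simp only: of_real_sum complex_norm_square)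
  also have "\<dots> = (\<Sum>m\<in>S. \<Sum>n\<in>S. \<Sum>n'\<in>S. a n * cnj (a n') * (K n m * cnj (K n' m)))"
    unfolding v_def cnj_sum sum_product by (simp add: mult_ac)
  also have "\<dots> = (\<Sum>n\<in>S. \<Sum>n'\<in>S. a n * cnj (a n') * (\<Sum>m\<in>S. K n m * cnj (K n' m)))"
    by (subst sum.swap, rule sum.cong[OF refl], subst sum.swap) (simp add: sum_distrib_left)
  finally have v2: "of_real (\<Sum>m\<in>S. (norm (v m))\<^sup>2) = (\<Sum>n\<in>S. \<Sum>n'\<in>S. a n * cnj (a n') * (\<Sum>m\<in>S. K n m * cnj (K n' m)))" .
  have sym: "norm (\<Sum>m\<in>S. K n m * cnj (K n' m)) = norm (\<Sum>m\<in>S. K n' m * cnj (K n m))" for n n'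
  proof -
    have "(\<Sum>m\<in>S. K n m * cnj (K n' m)) = cnj (\<Sum>m\<in>S. K n' m * cnj (K n m))"
      by (simp add: mult.commute)
    then show ?thesis by (simp only: complex_mod_cnj)
  qed
  have "norm (\<Sum>n\<in>S. \<Sum>n'\<in>S. a n * cnj (a n') * (\<Sum>m\<in>S. K n m * cnj (K n' m))) \<le> R * A"
    unfolding A_def
  proof (rule schur_test[OF row])
    fix n' assume "n' \<in> S"
    then show "(\<Sum>n\<in>S. norm (\<Sum>m\<in>S. K n m * cnj (K n' m))) \<le> R"
      using row[of n'] by (simp only: sym[of _ n'])
  qed
  then have v: "(\<Sum>m\<in>S. (norm (v m))\<^sup>2) \<le> R * A"
    unfolding v2[symmetric] norm_of_real by linarith
  have "(\<Sum>n\<in>S. \<Sum>m\<in>S. a n * cnj (a m) * K n m) = (\<Sum>m\<in>S. cnj (a m) * v m)"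
    unfolding v_def by (subst sum.swap) (simp add: sum_distrib_left mult_ac)
  also have "norm \<dots> \<le> (\<Sum>m\<in>S. norm (a m) * norm (v m))"
    by (rule order_trans[OF norm_sum]) (simp add: norm_mult)
  also have "\<dots> \<le> sqrt (A * (\<Sum>m\<in>S. (norm (v m))\<^sup>2))"
    unfolding A_def by (intro real_le_rsqrt Cauchy_Schwarz_ineq_sum)
  also have "\<dots> \<le> sqrt (A * (R * A))"
    using v A0 by (intro real_sqrt_le_mono mult_left_mono)
  also have "A * (R * A) = R * A\<^sup>2" by (simp add: power2_eq_square)
  also have "sqrt (R * A\<^sup>2) = sqrt R * A" using A0 by (simp add: real_sqrt_mult)
  finally show ?thesis by (simp add: A_def)
qed

lemma sum_inverse_distance:
  assumes L: "1 \<le> L" and n: "n \<in> {p..<p + L}"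
  shows "(\<Sum>m\<in>{p..<p + L} - {n}. 1 / \<bar>real n - real m\<bar>) \<le> 2 * (1 + ln (real L))"
proof -
  \<comment> \<open>The harmonic numbers minus the logarithm decrease from the value 1 at the first
    index.\<close>
  have harm: "(\<Sum>j=1..L. 1 / real j) \<le> 1 + ln (real L)"
    using decseqD[OF decseq_harm_diff_ln, of 0 "L - 1"] L by (simp add: harm_def inverse_eq_divide)
  have "(\<Sum>m\<in>{p..<n}. 1 / \<bar>real n - real m\<bar>) = (\<Sum>j\<in>(\<lambda>m. n - m) ` {p..<n}. 1 / real j)"
    by (subst sum.reindex) (auto simp: inj_on_def of_nat_diff intro!: sum.cong)
  also have "\<dots> \<le> (\<Sum>j=1..L. 1 / real j)"
    using n by (intro sum_mono2) auto
  finally have 1: "(\<Sum>m\<in>{p..<n}. 1 / \<bar>real n - real m\<bar>) \<le> 1 + ln (real L)"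
    using harm by linarith
  have "(\<Sum>m\<in>{n<..<p+L}. 1 / \<bar>real n - real m\<bar>) = (\<Sum>j\<in>(\<lambda>m. m - n) ` {n<..<p+L}. 1 / real j)"
    by (subst sum.reindex) (auto simp: inj_on_def of_nat_diff intro!: sum.cong)
  also have "\<dots> \<le> (\<Sum>j=1..L. 1 / real j)"
    using n by (intro sum_mono2) auto
  finally have 2: "(\<Sum>m\<in>{n<..<p+L}. 1 / \<bar>real n - real m\<bar>) \<le> 1 + ln (real L)"
    using harm by linarith
  have U: "{p..<p + L} - {n} = {p..<n} \<union> {n<..<p+L}" using n by auto
  have "(\<Sum>m\<in>{p..<n} \<union> {n<..<p+L}. 1 / \<bar>real n - real m\<bar>)
     = (\<Sum>m\<in>{p..<n}. 1 / \<bar>real n - real m\<bar>) + (\<Sum>m\<in>{n<..<p+L}. 1 / \<bar>real n - real m\<bar>)"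
    by (rule sum.union_disjoint) auto
  also have "\<dots> \<le> (1 + ln (real L)) + (1 + ln (real L))"
    by (rule add_mono[OF 1 2])
  finally show ?thesis unfolding U by simp
qed

lemma norm_main_kernel_le:
  assumes k: "k \<ge> 3" and M: "1 \<le> M" "M \<le> n" and H: "1 \<le> H"
  shows "norm (main_kernel k H n m) \<le> sqrt (real M powr (- (1 / (real k - 1))) / real H)"
proof (cases "m + H \<le> n \<and> n < m + 2 * H")
  case True
  have "crit k (real n + real m) / (real n - real m) \<le> real M powr (- (1 / (real k - 1))) / real H"
    using k M H True by (intro frac_le crit_le_powr) auto
  moreover have "0 \<le> crit k (real n + real m) / (real n - real m)"
    using k M True by (intro divide_nonneg_nonneg less_imp_le[OF crit_pos]) auto
  ultimately show ?thesis
    using True by (simp add: main_kernel_def norm_mult)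
qed (auto simp: main_kernel_def)

text \<open>A row or column has at most \<open>H\<close> nonzero entries of size at most
  \<open>sqrt (X / H)\<close>, so Schur's test gives \<open>sqrt (X H)\<close>. With
  \<open>T ^ 3 = X M\<close>, whenever this exceeds \<open>T\<close> one has
  \<open>T\<^sup>2 M < X H M = T ^ 3 H\<close>, that is \<open>M / H < T\<close>, and the
  correlation bound takes over.\<close>

lemma main_kernel_form:
  assumes k: "k \<ge> 3"
  shows "\<exists>C>0. \<forall>M H a. 1 \<le> M \<longrightarrow> 1 \<le> H \<longrightarrow>
    norm (\<Sum>n=M..<2*M. \<Sum>m=M..<2*M. a n * cnj (a m) * main_kernel k H n m)
     \<le> C * (1 + ln (real M)) * real M powr ((real k - 2) / (3 * (real k - 1))) * (\<Sum>n=M..<2*M. (norm (a n))\<^sup>2)"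
proof -
  obtain C0 where C0: "C0 > 0" and corr: "\<And>M H n n'. 1 \<le> M \<Longrightarrow> 1 \<le> H \<Longrightarrow> n \<in> {M..<2*M} \<Longrightarrow> n' \<in> {M..<2*M} \<Longrightarrow> n' < n \<Longrightarrow>
     norm (\<Sum>m=M..<2*M. main_kernel k H n m * cnj (main_kernel k H n' m))
       \<le> C0 * (real M / real H)\<^sup>2 / (real n - real n')"
    using main_kernel_correlation[OF k] by blast
  define \<alpha> where "\<alpha> = 1 / (real k - 1)"
  have \<alpha>: "\<alpha> > 0" using k by (simp add: \<alpha>_def)
  have e: "(real k - 2) / (3 * (real k - 1)) = (1 - \<alpha>) / 3"
    using k by (simp add: \<alpha>_def field_simps)
  \<comment> \<open>The 1 covers the correlation of a row with itself, the \<open>2 * C0\<close> the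
    harmonic sums on both sides of the diagonal.\<close>
  let ?C = "1 + 2 * C0"
  have "norm (\<Sum>n=M..<2*M. \<Sum>m=M..<2*M. a n * cnj (a m) * main_kernel k H n m)
     \<le> ?C * (1 + ln (real M)) * real M powr ((1 - \<alpha>) / 3) * (\<Sum>n=M..<2*M. (norm (a n))\<^sup>2)" (is "?Q \<le> _ * ?A")
    if M: "1 \<le> M" and H: "1 \<le> H" for M H a
  proof -
    define X where "X = real M powr (- \<alpha>)"
    define T where "T = real M powr ((1 - \<alpha>) / 3)"
    define S where "S = {M..<2*M}"
    define lg where "lg = 1 + ln (real M)"
    have lg: "lg \<ge> 1" using M by (simp add: lg_def)
    have X: "0 < X" "X \<le> 1"
      using M \<alpha> powr_mono[of "- \<alpha>" 0 "real M"] by (auto simp: X_def)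
    have T: "0 < T" "T ^ 3 = X * M"
    proof -
      have "T ^ 3 = real M powr ((1 - \<alpha>) / 3 * real 3)"
        using M by (simp only: T_def powr_powr[symmetric] powr_realpow powr_gt_zero)
      also have "(1 - \<alpha>) / 3 * real 3 = 1 - \<alpha>" by simp
      finally have "T ^ 3 = real M powr (1 - \<alpha>)" .
      also have "\<dots> = real M powr (- \<alpha>) * real M powr 1" by (simp only: powr_add[symmetric]) simp
      finally show "T ^ 3 = X * M" by (simp add: X_def)
    qed (use M in \<open>simp add: T_def\<close>)
    have A: "?A \<ge> 0" by (simp add: sum_nonneg)
    have nb: "norm (main_kernel k H n m) \<le> sqrt (X / H)" if "n \<in> S" for n m
      unfolding X_def \<alpha>_def using that M H k by (intro norm_main_kernel_le) (auto simp: S_def)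
    have row: "(\<Sum>m\<in>S. norm (main_kernel k H n m)) \<le> real H * sqrt (X / H)" if n: "n \<in> S" for n
    proof -
      have "(\<Sum>m\<in>S. norm (main_kernel k H n m)) = (\<Sum>m\<in>{m\<in>S. m + H \<le> n \<and> n < m + 2 * H}. norm (main_kernel k H n m))"
        by (rule sum.mono_neutral_right) (auto simp: main_kernel_def S_def)
      also have "\<dots> \<le> of_nat (card {m\<in>S. m + H \<le> n \<and> n < m + 2 * H}) * sqrt (X / H)"
        using nb[OF n] by (intro sum_bounded_above)
      also have "card {m\<in>S. m + H \<le> n \<and> n < m + 2 * H} \<le> card {n + 1 - 2 * H..<n + 1 - H}"
        by (intro card_mono) auto
      then have "of_nat (card {m\<in>S. m + H \<le> n \<and> n < m + 2 * H}) * sqrt (X / H) \<le> real H * sqrt (X / H)"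
        using X by (intro mult_right_mono) auto
      finally show ?thesis .
    qed
    have col: "(\<Sum>n\<in>S. norm (main_kernel k H n m)) \<le> real H * sqrt (X / H)" for m
    proof -
      have "(\<Sum>n\<in>S. norm (main_kernel k H n m)) = (\<Sum>n\<in>{n\<in>S. m + H \<le> n \<and> n < m + 2 * H}. norm (main_kernel k H n m))"
        by (rule sum.mono_neutral_right) (auto simp: main_kernel_def S_def)
      also have "\<dots> \<le> of_nat (card {n\<in>S. m + H \<le> n \<and> n < m + 2 * H}) * sqrt (X / H)"
        using nb by (intro sum_bounded_above) auto
      also have "card {n\<in>S. m + H \<le> n \<and> n < m + 2 * H} \<le> card {m + H..<m + 2 * H}"
        by (intro card_mono) auto
      then have "of_nat (card {n\<in>S. m + H \<le> n \<and> n < m + 2 * H}) * sqrt (X / H) \<le> real H * sqrt (X / H)"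
        using X by (intro mult_right_mono) auto
      finally show ?thesis .
    qed
    \<comment> \<open>For \<open>H \<ge> M\<close> the kernel vanishes on the block. Discarding that
      case also ensures \<open>M / H \<ge> 1\<close>, by which the diagonal correlation, at most
      \<open>X \<le> 1\<close>, is absorbed below.\<close>
    consider "M \<le> H" | "X * H \<le> T\<^sup>2" | "H < M" "T\<^sup>2 < X * H" by linarith
    then have "?Q \<le> ?C * lg * T * ?A"
    proof cases
      case 1
      have "?Q = 0"
        using 1 by (auto simp: main_kernel_def intro!: sum.neutral)
      then show ?thesis using A T lg C0 by simp
    next
      case 2
      have q: "?Q \<le> (real H * sqrt (X / H)) * ?A"
        using row col unfolding S_def by (rule schur_test)
      have "real H * sqrt (X / H) = sqrt (X * H)"
        using H by (simp add: real_sqrt_divide real_sqrt_mult field_simps)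
      also have "sqrt (X * H) \<le> 1 * T"
        using 2 T by (simp add: real_le_lsqrt)
      also have "\<dots> \<le> (?C * lg) * T"
        using T lg C0 mult_mono[of 1 ?C 1 lg] by (intro mult_right_mono) auto
      finally show ?thesis
        by (rule order_trans[OF q mult_right_mono[OF _ A]])
    next
      case 3
      define R where "R = ?C * lg * (real M / real H)\<^sup>2"
      have R0: "R \<ge> 0" using C0 lg by (simp add: R_def)
      have MH: "1 \<le> (real M / real H)\<^sup>2" using 3 H by (intro one_le_power) simp
      have "(\<Sum>n'\<in>S. norm (\<Sum>m\<in>S. main_kernel k H n m * cnj (main_kernel k H n' m))) \<le> R"
        if n: "n \<in> S" for n
      proof -
        have "norm (\<Sum>m\<in>S. main_kernel k H n m * cnj (main_kernel k H n m))
            \<le> (\<Sum>m\<in>S. sqrt (X / H) * norm (main_kernel k H n m))"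
          using nb[OF n] by (intro order_trans[OF norm_sum] sum_mono) (simp add: norm_mult mult_right_mono)
        also have "\<dots> \<le> sqrt (X / H) * (real H * sqrt (X / H))"
          unfolding sum_distrib_left[symmetric] using row[OF n] X by (intro mult_left_mono) auto
        also have "\<dots> = X" using X H by (simp add: mult.left_commute)
        also have "\<dots> \<le> lg * (real M / real H)\<^sup>2"
          using X(2) mult_mono[OF lg MH] lg by simp
        finally have D: "norm (\<Sum>m\<in>S. main_kernel k H n m * cnj (main_kernel k H n m)) \<le> lg * (real M / real H)\<^sup>2" .
        have off: "norm (\<Sum>m\<in>S. main_kernel k H n m * cnj (main_kernel k H n' m)) \<le> C0 * (real M / real H)\<^sup>2 * (1 / \<bar>real n - real n'\<bar>)"
          if n': "n' \<in> S - {n}" for n'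
        proof (cases "n' < n")
          case True
          then show ?thesis using corr[OF M H, of n n'] n n' by (simp add: S_def)
        next
          case False
          have "(\<Sum>m\<in>S. main_kernel k H n m * cnj (main_kernel k H n' m)) = cnj (\<Sum>m\<in>S. main_kernel k H n' m * cnj (main_kernel k H n m))"
            by (simp add: mult.commute)
          then have "norm (\<Sum>m\<in>S. main_kernel k H n m * cnj (main_kernel k H n' m)) = norm (\<Sum>m\<in>S. main_kernel k H n' m * cnj (main_kernel k H n m))"
            by (simp only: complex_mod_cnj)
          then show ?thesis using corr[OF M H, of n' n] n n' False by (simp add: S_def)
        qed
        have "(\<Sum>n'\<in>S - {n}. norm (\<Sum>m\<in>S. main_kernel k H n m * cnj (main_kernel k H n' m)))
          \<le> (\<Sum>n'\<in>S - {n}. C0 * (real M / real H)\<^sup>2 * (1 / \<bar>real n - real n'\<bar>))"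
          by (rule sum_mono[OF off])
        also have "\<dots> \<le> C0 * (real M / real H)\<^sup>2 * (2 * lg)"
          unfolding sum_distrib_left[symmetric] lg_def S_def mult_2
          using sum_inverse_distance[OF M, of n M] n C0 by (intro mult_left_mono) (auto simp: S_def)
        finally show ?thesis
          using D n by (subst sum.remove[of S n]) (auto simp: S_def R_def algebra_simps)
      qed
      then have q: "?Q \<le> sqrt R * ?A"
        unfolding S_def by (rule correlation_test[OF R0])
      have "sqrt R \<le> ?C * lg * T"
      proof (rule real_le_lsqrt)
        \<comment> \<open>A number that is at least 1 bounds its own square root, so the root of the
          logarithm is replaced by the logarithm.\<close>
        have "1 \<le> ?C * lg" using mult_mono[of 1 ?C 1 lg] C0 lg by simp
        then have c: "?C * lg \<le> (?C * lg)\<^sup>2" using mult_left_mono[of 1 "?C * lg" "?C * lg"] by (simp add: power2_eq_square)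
        have "T\<^sup>2 * real M < (X * H) * M" using 3 by (intro mult_strict_right_mono) auto
        also have "\<dots> = T ^ 3 * H" using T by simp
        finally have "T\<^sup>2 * real M < T\<^sup>2 * (T * H)" by (simp add: power2_eq_square power3_eq_cube mult_ac)
        then have "real M < T * H" using T by (simp add: mult_less_cancel_left_pos)
        then have "real M / H \<le> T" using H by (simp add: pos_divide_le_eq)
        then have "(real M / H)\<^sup>2 \<le> T\<^sup>2" by (intro power_mono) auto
        then have "R \<le> ?C * lg * T\<^sup>2" unfolding R_def using C0 lg by (intro mult_left_mono) auto
        also have "\<dots> \<le> (?C * lg)\<^sup>2 * T\<^sup>2" using c by (intro mult_right_mono) auto
        finally show "R \<le> (?C * lg * T)\<^sup>2" by (simp add: power_mult_distrib)
      qed (use C0 lg T R0 in auto)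
      then show ?thesis
        by (rule order_trans[OF q mult_right_mono[OF _ A]])
    qed
    then show ?thesis by (simp only: lg_def T_def)
  qed
  moreover have "?C > 0" using C0 by simp
  ultimately show ?thesis unfolding e by blast
qed

section \<open>The upper bound\<close>

lemma gram_expansion:
  fixes a :: "nat \<Rightarrow> complex" and \<phi> :: "nat \<Rightarrow> real \<Rightarrow> real"
  assumes fin: "finite S" and cont: "\<And>n. n \<in> S \<Longrightarrow> continuous_on {0..1} (\<phi> n)"
  shows "of_real (integral {0..1} (\<lambda>x. (norm (\<Sum>n\<in>S. a n * ee (\<phi> n x)))\<^sup>2))
    = (\<Sum>n\<in>S. \<Sum>m\<in>S. a n * cnj (a m) * integral {0..1} (\<lambda>x. ee (\<phi> n x - \<phi> m x)))"
proof -
  let ?f = "\<lambda>x. (norm (\<Sum>n\<in>S. a n * ee (\<phi> n x)))\<^sup>2"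
  have "?f integrable_on {0..1}"
    by (intro integrable_continuous_real continuous_intros cont)
  then have "of_real (integral {0..1} ?f) = integral {0..1} (\<lambda>x. of_real (?f x) :: complex)"
    using integral_linear[of ?f "{0..1}" "of_real :: real \<Rightarrow> complex"] by (simp only: o_def bounded_linear_of_real)
  also have "(\<lambda>x. of_real (?f x)) = (\<lambda>x. \<Sum>n\<in>S. \<Sum>m\<in>S. a n * cnj (a m) * ee (\<phi> n x - \<phi> m x))"
    by (simp only: complex_norm_square cnj_sum sum_product ee_diff complex_cnj_mult mult_ac)
  also have "integral {0..1} \<dots> = (\<Sum>n\<in>S. integral {0..1} (\<lambda>x. \<Sum>m\<in>S. a n * cnj (a m) * ee (\<phi> n x - \<phi> m x)))"
    using fin by (intro integral_sum integrable_continuous_real continuous_intros cont) auto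
  also have "\<dots> = (\<Sum>n\<in>S. \<Sum>m\<in>S. integral {0..1} (\<lambda>x. a n * cnj (a m) * ee (\<phi> n x - \<phi> m x)))"
    using fin by (intro sum.cong refl integral_sum integrable_continuous_real continuous_intros cont) auto
  finally show ?thesis by simp
qed

text \<open>The terms with \<open>n < m\<close> sum to the conjugate of those with
  \<open>m < n\<close>, and the unit diagonal contributes the sum of squares. Kernel estimates are
  thus required only for \<open>m < n\<close>, where \<open>h = n - m\<close> is positive.\<close>

lemma hermitian_form_bound:
  fixes K :: "nat \<Rightarrow> nat \<Rightarrow> complex"
  assumes fin: "finite S" and diag: "\<And>n. n \<in> S \<Longrightarrow> K n n = 1"
    and herm: "\<And>n m. n \<in> S \<Longrightarrow> m \<in> S \<Longrightarrow> K m n = cnj (K n m)"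
    and up: "norm (\<Sum>n\<in>S. \<Sum>m\<in>S. a n * cnj (a m) * (if m < n then K n m else 0)) \<le> B * (\<Sum>n\<in>S. (norm (a n))\<^sup>2)"
  shows "norm (\<Sum>n\<in>S. \<Sum>m\<in>S. a n * cnj (a m) * K n m) \<le> (1 + 2 * B) * (\<Sum>n\<in>S. (norm (a n))\<^sup>2)"
proof -
  let ?A = "\<Sum>n\<in>S. (norm (a n))\<^sup>2"
  define U where "U = (\<Sum>n\<in>S. \<Sum>m\<in>S. a n * cnj (a m) * (if m < n then K n m else 0))"
  have "(\<Sum>n\<in>S. \<Sum>m\<in>S. a n * cnj (a m) * K n m)
    = (\<Sum>n\<in>S. \<Sum>m\<in>S. a n * cnj (a m) * (if m < n then K n m else 0)
        + cnj (a m * cnj (a n) * (if n < m then K m n else 0))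
        + (if n = m then a n * cnj (a n) else 0))"
  proof (intro sum.cong refl)
    fix n m assume nm: "n \<in> S" "m \<in> S"
    show "a n * cnj (a m) * K n m = a n * cnj (a m) * (if m < n then K n m else 0)
        + cnj (a m * cnj (a n) * (if n < m then K m n else 0)) + (if n = m then a n * cnj (a n) else 0)"
      using diag[OF nm(1)] herm[OF nm] by (cases n m rule: linorder_cases) auto
  qed
  also have "\<dots> = U + cnj (\<Sum>n\<in>S. \<Sum>m\<in>S. a m * cnj (a n) * (if n < m then K m n else 0)) + (\<Sum>n\<in>S. a n * cnj (a n))"
    unfolding U_def using fin by (simp only: sum.distrib cnj_sum sum.delta' if_True cong: sum.cong)
  also have "(\<Sum>n\<in>S. \<Sum>m\<in>S. a m * cnj (a n) * (if n < m then K m n else 0)) = U"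
    unfolding U_def by (rule sum.swap)
  also have "(\<Sum>n\<in>S. a n * cnj (a n)) = of_real ?A"
    by (simp only: of_real_sum complex_norm_square)
  finally have "norm (\<Sum>n\<in>S. \<Sum>m\<in>S. a n * cnj (a m) * K n m) = norm (U + cnj U + of_real ?A)" by simp
  also have "\<dots> \<le> norm U + norm (cnj U) + norm (of_real ?A :: complex)"
    by (intro norm_triangle_le add_right_mono norm_triangle_ineq)
  also have "norm (of_real ?A :: complex) = ?A"
    unfolding norm_of_real by (simp add: sum_nonneg)
  also have "norm U + norm (cnj U) + ?A \<le> (1 + 2 * B) * ?A"
    using up unfolding U_def[symmetric] by (simp add: algebra_simps)
  finally show ?thesis .
qed

text \<open>Only the size of \<open>E\<close> enters, so the harmonic sum in Schur's test costs a
  logarithm. This treats the stationary phase error and the whole off-diagonal kernel of the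
  negative frequencies.\<close>

lemma inverse_distance_form_bound:
  fixes E :: "nat \<Rightarrow> nat \<Rightarrow> complex"
  assumes L: "1 \<le> L" and D: "0 \<le> D"
    and E: "\<And>n m. n \<in> {p..<p + L} \<Longrightarrow> m \<in> {p..<p + L} \<Longrightarrow> m < n \<Longrightarrow> norm (E n m) \<le> D / (real n - real m)"
  shows "norm (\<Sum>n=p..<p+L. \<Sum>m=p..<p+L. a n * cnj (a m) * (if m < n then E n m else 0))
     \<le> D * (2 * (1 + ln (real L))) * (\<Sum>n=p..<p+L. (norm (a n))\<^sup>2)"
proof (rule schur_test)
  have le: "norm (if m < n then E n m else 0) \<le> (if m = n then 0 else D * (1 / \<bar>real n - real m\<bar>))"
    if "n \<in> {p..<p + L}" "m \<in> {p..<p + L}" for n m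
    using E[OF that] D by auto
  fix n assume n: "n \<in> {p..<p+L}"
  have "(\<Sum>m=p..<p+L. norm (if m < n then E n m else 0)) \<le> (\<Sum>m=p..<p+L. if m = n then 0 else D * (1 / \<bar>real n - real m\<bar>))"
    by (intro sum_mono le n)
  also have "\<dots> = (\<Sum>m\<in>{p..<p+L} - {n}. D * (1 / \<bar>real n - real m\<bar>))"
    by (intro sum.mono_neutral_cong_right) auto
  also have "\<dots> \<le> D * (2 * (1 + ln (real L)))"
    unfolding sum_distrib_left[symmetric] using sum_inverse_distance[OF L n] D by (rule mult_left_mono)
  finally show "(\<Sum>m=p..<p+L. norm (if m < n then E n m else 0)) \<le> D * (2 * (1 + ln (real L)))" .
  have "(\<Sum>m=p..<p+L. norm (if n < m then E m n else 0)) \<le> (\<Sum>m=p..<p+L. if m = n then 0 else D * (1 / \<bar>real n - real m\<bar>))"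
  proof (rule sum_mono)
    fix m assume m: "m \<in> {p..<p+L}"
    show "norm (if n < m then E m n else 0) \<le> (if m = n then 0 else D * (1 / \<bar>real n - real m\<bar>))"
      using le[OF m n] unfolding abs_minus_commute[of "real m"] eq_commute[of n m] .
  qed
  also have "\<dots> = (\<Sum>m\<in>{p..<p+L} - {n}. D * (1 / \<bar>real n - real m\<bar>))"
    by (intro sum.mono_neutral_cong_right) auto
  also have "\<dots> \<le> D * (2 * (1 + ln (real L)))"
    unfolding sum_distrib_left[symmetric] using sum_inverse_distance[OF L n] D by (rule mult_left_mono)
  finally show "(\<Sum>m=p..<p+L. norm (if n < m then E m n else 0)) \<le> D * (2 * (1 + ln (real L)))" .
qed

text \<open>\<open>L\<close> counts dyadic scales and thereby measures the loss in decompositions.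
  The factor 2 in the last bound comes from \<open>ln 2 \<ge> 1/2\<close>.\<close>

lemma dyadic_length:
  assumes "1 \<le> M"
  obtains L :: nat where "M < 2 ^ L" "2 ^ L \<le> 2 * M" "real L \<le> 2 * (1 + ln (real M))"
proof -
  obtain i where i: "2 ^ i \<le> M" "M < 2 ^ (i + 1)" using ex_power_ivl1[of 2 M] assms by auto
  have "real i * ln 2 = ln (2 ^ i)" by (simp add: ln_realpow)
  also have "\<dots> \<le> ln (real M)" using i(1) assms by (metis ln_mono of_nat_le_iff of_nat_numeral of_nat_power zero_less_numeral zero_less_power)
  finally have "real i * ln 2 \<le> ln (real M)" .
  moreover have "real i * (1 / 2) \<le> real i * ln 2"
    using ln2_ge_two_thirds by (intro mult_left_mono) auto
  ultimately have "real (i + 1) \<le> 2 * (1 + ln (real M))" by simp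
  then show ?thesis using that[of "i + 1"] i by simp
qed

text \<open>The ranges from \<open>2 ^ i\<close> up to \<open>2 ^ (i + 1)\<close> are disjoint and
  cover all distances, so the sum of \<open>main_kernel\<close> over these scales has one nonzero
  term per pair and recovers the full leading term.\<close>

lemma main_kernel_dyadic:
  assumes "m < n" "n - m < 2 ^ L"
  obtains i where "i < L" "\<And>j. j \<noteq> i \<Longrightarrow> main_kernel k (2 ^ j) n m = 0"
    "main_kernel k (2 ^ i) n m = of_real (sqrt (crit k (real n + real m) / (real n - real m)))
       * ee (- ((1 - 1 / real k) * ((real n - real m) * crit k (real n + real m))))"
proof -
  have "1 \<le> n - m" using assms by simp
  then obtain i where i: "2 ^ i \<le> n - m" "n - m < 2 ^ (i + 1)" using ex_power_ivl1[of 2 "n - m"] by auto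
  have iL: "i < L" using i assms by (metis le_less_trans power_less_imp_less_exp one_less_numeral_iff semiring_norm(76))
  have "main_kernel k (2 ^ j) n m = 0" if "j \<noteq> i" for j
  proof (rule ccontr)
    assume "main_kernel k (2 ^ j) n m \<noteq> 0"
    then have "m + 2 ^ j \<le> n" "n < m + 2 * 2 ^ j" by (auto simp: main_kernel_def split: if_splits)
    then have j: "2 ^ j \<le> n - m" "n - m < 2 ^ (j + 1)" by auto
    have "(2::nat) ^ j < 2 ^ (i + 1)" "(2::nat) ^ i < 2 ^ (j + 1)" using i j by linarith+
    then have "j < i + 1" "i < j + 1" using power_less_imp_less_exp by (metis one_less_numeral_iff semiring_norm(76))+
    then show False using that by simp
  qed
  moreover have "m + 2 ^ i \<le> n \<and> n < m + 2 * 2 ^ i" using i assms by auto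
  ultimately show ?thesis using that[OF iL] by (simp add: main_kernel_def)
qed

lemma real_le_of_complex_eq:
  fixes z :: complex
  assumes "norm z \<le> B" "of_real r = z"
  shows "r \<le> B"
  using assms abs_le_D1 by auto

text \<open>Below the diagonal the Gram kernel is \<open>c * P + E\<close>. The form of
  \<open>P\<close> is the sum of at most \<open>2 * lg\<close> forms of \<open>main_kernel\<close>,
  each of which carries one logarithm already; \<open>E\<close> is of inverse distance type.\<close>

lemma block_bound:
  assumes k: "k \<ge> 3"
  shows "\<exists>C>0. \<forall>M a. 1 \<le> M \<longrightarrow>
    integral {0..1} (\<lambda>x. (norm (\<Sum>n=M..<2*M. a n * ee ((real n)\<^sup>2 * x ^ k - real n * x)))\<^sup>2)
     \<le> C * (1 + ln (real M))\<^sup>2 * real M powr ((real k - 2) / (3 * (real k - 1))) * (\<Sum>n=M..<2*M. (norm (a n))\<^sup>2)"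
proof -
  obtain c D where cD: "\<And>h s. h > 0 \<Longrightarrow> s \<ge> 1 \<Longrightarrow>
    norm (integral {0..1} (\<lambda>x. ee (h * (s * x ^ k - x)))
      - c * of_real (sqrt (crit k s / h)) * ee (- ((1 - 1 / real k) * (h * crit k s)))) \<le> D / h"
    using kernel_asymptotics[OF k] by blast
  obtain C0 where C0: "C0 > 0" and form: "\<And>M H a. 1 \<le> M \<Longrightarrow> 1 \<le> H \<Longrightarrow>
    norm (\<Sum>n=M..<2*M. \<Sum>m=M..<2*M. a n * cnj (a m) * main_kernel k H n m)
     \<le> C0 * (1 + ln (real M)) * real M powr ((real k - 2) / (3 * (real k - 1))) * (\<Sum>n=M..<2*M. (norm (a n))\<^sup>2)"
    using main_kernel_form[OF k] by blast
  \<comment> \<open>One instance, at \<open>h = s = 1\<close>, shows that \<open>D\<close> is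
    nonnegative, as it dominates a norm.\<close>
  have "norm (integral {0..1} (\<lambda>x. ee (1 * (1 * x ^ k - x)))
      - c * of_real (sqrt (crit k 1 / 1)) * ee (- ((1 - 1 / real k) * (1 * crit k 1)))) \<le> D / 1"
    by (rule cD) auto
  from order_trans[OF norm_ge_zero this] have D0: "D \<ge> 0" by simp
  \<comment> \<open>The 1 is the diagonal and the outer 2 counts both triangles. Inside,
    \<open>2 * C0\<close> uses the bound \<open>2 * lg\<close> on the number of scales, and
    \<open>2 * D\<close> comes from the harmonic sums.\<close>
  define C where "C = 1 + 2 * (norm c * (2 * C0) + 2 * D)"
  have C: "C > 0" using C0 D0 by (simp add: C_def add_pos_nonneg)
  have "integral {0..1} (\<lambda>x. (norm (\<Sum>n=M..<2*M. a n * ee ((real n)\<^sup>2 * x ^ k - real n * x)))\<^sup>2)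
     \<le> C * (1 + ln (real M))\<^sup>2 * real M powr ((real k - 2) / (3 * (real k - 1))) * (\<Sum>n=M..<2*M. (norm (a n))\<^sup>2)"
    if M: "1 \<le> M" for M a
  proof -
    define S where "S = {M..<2*M}"
    define A where "A = (\<Sum>n\<in>S. (norm (a n))\<^sup>2)"
    define lg where "lg = 1 + ln (real M)"
    define T where "T = real M powr ((real k - 2) / (3 * (real k - 1)))"
    define \<phi> where "\<phi> n x = (real n)\<^sup>2 * x ^ k - real n * x" for n :: nat and x :: real
    define K where "K n m = integral {0..1} (\<lambda>x. ee (\<phi> n x - \<phi> m x))" for n m
    have cphi: "continuous_on {0..1} (\<phi> n)" for n
      unfolding \<phi>_def by (intro continuous_intros)
    have lg: "lg \<ge> 1" using M by (simp add: lg_def)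
    have T: "T \<ge> 1" unfolding T_def using M k by (intro ge_one_powr_ge_zero) auto
    have A: "A \<ge> 0" by (simp add: A_def sum_nonneg)
    obtain L :: nat where L: "M < 2 ^ L" "real L \<le> 2 * lg" using dyadic_length[OF M] by (auto simp: lg_def)
    define P where "P n m = (\<Sum>i<L. main_kernel k (2 ^ i) n m)" for n m
    define E where "E n m = K n m - c * P n m" for n m
    have E: "norm (E n m) \<le> D / (real n - real m)" if nm: "n \<in> S" "m \<in> S" "m < n" for n m
    proof -
      have "n - m < 2 ^ L" using L(1) nm by (auto simp: S_def)
      then obtain i where i: "i < L" "\<And>j. j \<noteq> i \<Longrightarrow> main_kernel k (2 ^ j) n m = 0"
        "main_kernel k (2 ^ i) n m = of_real (sqrt (crit k (real n + real m) / (real n - real m)))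
          * ee (- ((1 - 1 / real k) * ((real n - real m) * crit k (real n + real m))))"
        using main_kernel_dyadic[OF nm(3)] by metis
      have "P n m = (\<Sum>j<L. if j = i then main_kernel k (2 ^ i) n m else 0)"
        unfolding P_def using i(2) by (intro sum.cong) auto
      then have P: "P n m = main_kernel k (2 ^ i) n m" using i(1) by simp
      have "\<phi> n x - \<phi> m x = (real n - real m) * ((real n + real m) * x ^ k - x)" for x
        by (simp add: \<phi>_def algebra_simps power2_eq_square)
      then have "E n m = integral {0..1} (\<lambda>x. ee ((real n - real m) * ((real n + real m) * x ^ k - x)))
         - c * of_real (sqrt (crit k (real n + real m) / (real n - real m)))
          * ee (- ((1 - 1 / real k) * ((real n - real m) * crit k (real n + real m))))"
        unfolding E_def K_def P i(3) by (simp add: mult.assoc)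
      then show ?thesis using cD[of "real n - real m" "real n + real m"] nm M by (simp add: S_def)
    qed
    have "norm (\<Sum>n\<in>S. \<Sum>m\<in>S. a n * cnj (a m) * (if m < n then K n m else 0)) \<le> (norm c * (2 * C0) + 2 * D) * lg\<^sup>2 * T * A"
    proof -
      have P0: "P n m = 0" if "\<not> m < n" for n m
        unfolding P_def using that by (intro sum.neutral) (auto simp: main_kernel_def)
      have "(\<Sum>n\<in>S. \<Sum>m\<in>S. a n * cnj (a m) * (if m < n then K n m else 0))
        = (\<Sum>n\<in>S. \<Sum>m\<in>S. c * (a n * cnj (a m) * P n m) + a n * cnj (a m) * (if m < n then E n m else 0))"
        using P0 by (intro sum.cong refl) (auto simp: E_def algebra_simps)
      also have "\<dots> = c * (\<Sum>n\<in>S. \<Sum>m\<in>S. a n * cnj (a m) * P n m) + (\<Sum>n\<in>S. \<Sum>m\<in>S. a n * cnj (a m) * (if m < n then E n m else 0))"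
        by (simp only: sum.distrib sum_distrib_left)
      also have "(\<Sum>n\<in>S. \<Sum>m\<in>S. a n * cnj (a m) * P n m) = (\<Sum>i<L. \<Sum>n\<in>S. \<Sum>m\<in>S. a n * cnj (a m) * main_kernel k (2 ^ i) n m)"
        unfolding P_def sum_distrib_left by (simp only: sum.swap[where A = "{..<L}" and B = S])
      finally have eq: "(\<Sum>n\<in>S. \<Sum>m\<in>S. a n * cnj (a m) * (if m < n then K n m else 0))
        = c * (\<Sum>i<L. \<Sum>n\<in>S. \<Sum>m\<in>S. a n * cnj (a m) * main_kernel k (2 ^ i) n m)
          + (\<Sum>n\<in>S. \<Sum>m\<in>S. a n * cnj (a m) * (if m < n then E n m else 0))" .
      have "norm (\<Sum>i<L. \<Sum>n\<in>S. \<Sum>m\<in>S. a n * cnj (a m) * main_kernel k (2 ^ i) n m) \<le> of_nat (card {..<L}) * (C0 * lg * T * A)"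
        unfolding S_def A_def lg_def T_def by (intro sum_norm_bound form M) auto
      also have "\<dots> \<le> (2 * lg) * (C0 * lg * T * A)"
        using L(2) C0 lg T A by (intro mult_right_mono) auto
      finally have 1: "norm (c * (\<Sum>i<L. \<Sum>n\<in>S. \<Sum>m\<in>S. a n * cnj (a m) * main_kernel k (2 ^ i) n m)) \<le> norm c * ((2 * lg) * (C0 * lg * T * A))"
        by (simp add: norm_mult mult_left_mono)
      have "norm (\<Sum>n\<in>S. \<Sum>m\<in>S. a n * cnj (a m) * (if m < n then E n m else 0)) \<le> D * (2 * lg) * A"
        using inverse_distance_form_bound[OF M D0, of M E a] E unfolding S_def A_def lg_def mult_2 by blast
      also have "\<dots> \<le> D * (2 * (lg\<^sup>2 * T)) * A"
        using lg T mult_mono[of lg "lg\<^sup>2" 1 T] D0 A by (intro mult_right_mono mult_left_mono) (auto simp: self_le_power)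
      finally have 2: "norm (\<Sum>n\<in>S. \<Sum>m\<in>S. a n * cnj (a m) * (if m < n then E n m else 0)) \<le> D * (2 * (lg\<^sup>2 * T)) * A" .
      show ?thesis
        unfolding eq by (rule order_trans[OF norm_triangle_mono[OF 1 2]]) (simp add: algebra_simps power2_eq_square)
    qed
    then have "norm (\<Sum>n\<in>S. \<Sum>m\<in>S. a n * cnj (a m) * K n m) \<le> (1 + 2 * ((norm c * (2 * C0) + 2 * D) * lg\<^sup>2 * T)) * A"
      unfolding A_def
    proof (intro hermitian_form_bound)
      fix n m
      have "ee (\<phi> m x - \<phi> n x) = cnj (ee (\<phi> n x - \<phi> m x))" for x
        by (metis ee_minus minus_diff_eq)
      then show "K m n = cnj (K n m)" by (simp add: K_def integral_cnj)
    qed (auto simp: K_def S_def)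
    moreover have "of_real (integral {0..1} (\<lambda>x. (norm (\<Sum>n\<in>S. a n * ee (\<phi> n x)))\<^sup>2)) = (\<Sum>n\<in>S. \<Sum>m\<in>S. a n * cnj (a m) * K n m)"
      unfolding K_def by (rule gram_expansion[OF _ cphi]) (simp add: S_def)
    ultimately have "integral {0..1} (\<lambda>x. (norm (\<Sum>n\<in>S. a n * ee (\<phi> n x)))\<^sup>2) \<le> (1 + 2 * ((norm c * (2 * C0) + 2 * D) * lg\<^sup>2 * T)) * A"
        by (rule real_le_of_complex_eq)
    also have "\<dots> \<le> (C * lg\<^sup>2 * T) * A"
    proof (rule mult_right_mono[OF _ A])
      have "1 \<le> lg\<^sup>2 * T" using mult_mono[of 1 "lg\<^sup>2" 1 T] lg T by (simp add: one_le_power)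
      then show "1 + 2 * ((norm c * (2 * C0) + 2 * D) * lg\<^sup>2 * T) \<le> C * lg\<^sup>2 * T"
        by (simp add: C_def algebra_simps)
    qed
    finally show ?thesis
      by (simp only: S_def A_def lg_def T_def \<phi>_def)
  qed
  then show ?thesis using C by blast
qed

text \<open>These are the negative frequencies with \<open>n\<close> replaced by \<open>- n\<close>.
  The phase difference is \<open>h (s x ^ k + x)\<close>, and the derivative of the bracket is 1 at
  0 and increases on the interval. Every off-diagonal entry is thus at most
  \<open>1 / (n - m)\<close>, and the full range can be treated at once, without dyadic
  blocks.\<close>

lemma nonstationary_block_bound:
  assumes k: "k \<ge> 2" and N: "1 \<le> N"
  shows "integral {0..1} (\<lambda>x. (norm (\<Sum>n=1..<1+N. a n * ee ((real n)\<^sup>2 * x ^ k + real n * x)))\<^sup>2)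
     \<le> 5 * (1 + ln (real N)) * (\<Sum>n=1..<1+N. (norm (a n))\<^sup>2)"
proof -
  define S where "S = {1..<1+N}"
  define A where "A = (\<Sum>n\<in>S. (norm (a n))\<^sup>2)"
  define \<phi> where "\<phi> n x = (real n)\<^sup>2 * x ^ k + real n * x" for n :: nat and x :: real
  define K where "K n m = integral {0..1} (\<lambda>x. ee (\<phi> n x - \<phi> m x))" for n m
  have cphi: "continuous_on {0..1} (\<phi> n)" for n
      unfolding \<phi>_def by (intro continuous_intros)
  have "norm (K n m) \<le> 1 / (real n - real m)" if nm: "n \<in> S" "m \<in> S" "m < n" for n m
  proof -
    have "\<phi> n x - \<phi> m x = (real n - real m) * ((real n + real m) * x ^ k + x)" for x
      by (simp add: \<phi>_def algebra_simps power2_eq_square)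
    then have "K n m = integral {0..1} (\<lambda>x. ee ((real n - real m) * ((real n + real m) * x ^ k + x)))"
      by (simp add: K_def)
    also have "norm \<dots> \<le> 1 / ((real n - real m) * ((real n + real m) * (real k * 0 ^ (k - 1)) + 1))"
      by (rule first_derivative_test[where \<phi>' = "\<lambda>x. (real n + real m) * (real k * x ^ (k - 1)) + 1"
            and \<phi>'' = "\<lambda>x. (real n + real m) * (real k * (real (k - 1) * x ^ (k - 1 - 1)))"])
         (use nm k in \<open>auto intro!: derivative_eq_intros continuous_intros simp: power_0_left\<close>)
    finally show ?thesis using k by (simp add: power_0_left)
  qed
  then have "norm (\<Sum>n\<in>S. \<Sum>m\<in>S. a n * cnj (a m) * (if m < n then K n m else 0)) \<le> 1 * (2 * (1 + ln (real N))) * A"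
    unfolding S_def A_def by (intro inverse_distance_form_bound N) auto
  then have "norm (\<Sum>n\<in>S. \<Sum>m\<in>S. a n * cnj (a m) * K n m) \<le> (1 + 2 * (1 * (2 * (1 + ln (real N))))) * A"
    unfolding A_def
  proof (intro hermitian_form_bound)
    fix n m
    have "ee (\<phi> m x - \<phi> n x) = cnj (ee (\<phi> n x - \<phi> m x))" for x
      by (metis ee_minus minus_diff_eq)
    then show "K m n = cnj (K n m)" by (simp add: K_def integral_cnj)
  qed (auto simp: K_def S_def)
  moreover have "of_real (integral {0..1} (\<lambda>x. (norm (\<Sum>n\<in>S. a n * ee (\<phi> n x)))\<^sup>2)) = (\<Sum>n\<in>S. \<Sum>m\<in>S. a n * cnj (a m) * K n m)"
    unfolding K_def by (rule gram_expansion[OF _ cphi]) (simp add: S_def)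
  ultimately have "integral {0..1} (\<lambda>x. (norm (\<Sum>n\<in>S. a n * ee (\<phi> n x)))\<^sup>2) \<le> (1 + 2 * (1 * (2 * (1 + ln (real N))))) * A"
    by (rule real_le_of_complex_eq)
  also have "\<dots> \<le> (5 * (1 + ln (real N))) * A"
    using N by (intro mult_right_mono) (auto simp: A_def sum_nonneg)
  finally show ?thesis
    by (simp only: S_def A_def \<phi>_def)
qed

section \<open>From blocks to the full norm\<close>

lemma L2_norm_on_eq_integral:
  assumes "continuous_on {-1..1} f"
  shows "L2_norm_on {-1<..<1} f = sqrt (integral {-1..1} (\<lambda>x. (norm (f x))\<^sup>2))"
proof -
  have "set_integrable lborel {-1..1} (\<lambda>x. (norm (f x))\<^sup>2)"
    by (intro borel_integrable_atLeastAtMost' continuous_intros assms)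
  then have "set_integrable lborel {-1<..<1} (\<lambda>x. (norm (f x))\<^sup>2)"
    by (rule set_integrable_subset) auto
  then show ?thesis
    unfolding L2_norm_on_def
    by (simp add: set_borel_integral_eq_integral integral_open_interval_real)
qed

lemma curve_sum_eq: "curve_sum N k a x = (\<Sum>n=- int N..int N. a n * ee (real_of_int n * x - (real_of_int n)\<^sup>2 * x ^ k))"
  by (simp only: curve_sum_def e_char_of_real)

lemma continuous_on_curve_sum: "continuous_on S (curve_sum N k a)"
  unfolding curve_sum_eq[abs_def] by (intro continuous_intros)

lemma sum_symmetric_int:
  fixes f :: "int \<Rightarrow> 'a :: comm_monoid_add"
  shows "(\<Sum>n=- int N..int N. f n) = f 0 + (\<Sum>n=1..<1+N. f (int n)) + (\<Sum>n=1..<1+N. f (- int n))"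
proof (induction N)
  case (Suc N)
  have "{- int (Suc N)..int (Suc N)} = insert (int (Suc N)) (insert (- int (Suc N)) {- int N..int N})"
    by auto
  then show ?case using Suc by (simp add: algebra_simps)
qed simp

lemma sum_dyadic_blocks:
  fixes g :: "nat \<Rightarrow> 'a :: comm_monoid_add"
  shows "(\<Sum>n=1..<2^L. g n) = (\<Sum>j<L. \<Sum>n=2^j..<2*2^j. g n)"
proof (induction L)
  case (Suc L)
  have "(\<Sum>n=1..<2^Suc L. g n) = (\<Sum>n=1..<2^L. g n) + (\<Sum>n=2^L..<2*2^L. g n)"
    using sum.atLeastLessThan_concat[of 1 "2^L" "2*2^L" g] by simp
  then show ?case using Suc by simp
qed simp

lemma norm_sum_power2_le:
  fixes z :: "'b \<Rightarrow> complex"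
  shows "(norm (\<Sum>i\<in>I. z i))\<^sup>2 \<le> real (card I) * (\<Sum>i\<in>I. (norm (z i))\<^sup>2)"
proof -
  have "(norm (\<Sum>i\<in>I. z i))\<^sup>2 \<le> (\<Sum>i\<in>I. norm (z i))\<^sup>2"
    by (intro power_mono norm_sum norm_ge_zero)
  also have "\<dots> \<le> real (card I) * (\<Sum>i\<in>I. (norm (z i))\<^sup>2)"
    using Cauchy_Schwarz_ineq_sum[of "\<lambda>i. 1" "\<lambda>i. norm (z i)" I] by simp
  finally show ?thesis .
qed

lemma norm_add3_power2_le:
  fixes u v w :: complex
  shows "(norm (u + v + w))\<^sup>2 \<le> 3 * (norm u)\<^sup>2 + 3 * (norm v)\<^sup>2 + 3 * (norm w)\<^sup>2"
  using norm_sum_power2_le[of "(!) [u, v, w]" "{..<3}"] by (simp add: eval_nat_numeral)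

text \<open>The frequency 0, the positive and the negative frequencies are separated at the cost of
  a factor 3. Cauchy-Schwarz over the dyadic blocks costs their number \<open>L\<close>, which is
  the third logarithm. The sum is conjugated so that its phases take the form used in the two block
  bounds.\<close>

lemma half_interval_bound:
  assumes k: "k \<ge> 3"
  shows "\<exists>C>0. \<forall>N a. 2 \<le> N \<longrightarrow>
    integral {0..1} (\<lambda>x. (norm (curve_sum N k a x))\<^sup>2)
      \<le> C * (ln (real N)) ^ 3 * real N powr ((real k - 2) / (3 * (real k - 1))) * (\<Sum>n=- int N..int N. (norm (a n))\<^sup>2)"
proof -
  define \<theta> where "\<theta> = (real k - 2) / (3 * (real k - 1))"
  have \<theta>: "\<theta> \<ge> 0" using k by (simp add: \<theta>_def)
  obtain C0 where C0: "C0 > 0" and block: "\<And>M a. 1 \<le> M \<Longrightarrow>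
    integral {0..1} (\<lambda>x. (norm (\<Sum>n=M..<2*M. a n * ee ((real n)\<^sup>2 * x ^ k - real n * x)))\<^sup>2)
     \<le> C0 * (1 + ln (real M))\<^sup>2 * real M powr \<theta> * (\<Sum>n=M..<2*M. (norm (a n))\<^sup>2)"
    using block_bound[OF k] unfolding \<theta>_def by blast
  \<comment> \<open>The 18 is 3 for the frequency 0 plus \<open>3 * 5\<close> for the negative ones;
    6 is the separation factor 3 times the 2 of \<open>L \<le> 2 * lg\<close>. The 27 in the claim
    is the cube of 3 in \<open>1 + ln N \<le> 3 ln N\<close>.\<close>
  let ?C = "18 + 6 * C0"
  have "integral {0..1} (\<lambda>x. (norm (curve_sum N k a x))\<^sup>2)
      \<le> (27 * ?C) * (ln (real N)) ^ 3 * real N powr \<theta> * (\<Sum>n=- int N..int N. (norm (a n))\<^sup>2)"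
    if N: "2 \<le> N" for N a
  proof -
    define lg where "lg = 1 + ln (real N)"
    define T where "T = real N powr \<theta>"
    define A0 where "A0 = (norm (a 0))\<^sup>2"
    define A1 where "A1 = (\<Sum>n=1..<1+N. (norm (a (int n)))\<^sup>2)"
    define A2 where "A2 = (\<Sum>n=1..<1+N. (norm (a (- int n)))\<^sup>2)"
    have A: "(\<Sum>n=- int N..int N. (norm (a n))\<^sup>2) = A0 + A1 + A2"
      unfolding A0_def A1_def A2_def by (rule sum_symmetric_int)
    have Apos: "A0 \<ge> 0" "A1 \<ge> 0" "A2 \<ge> 0" by (simp_all add: A0_def A1_def A2_def sum_nonneg)
    have lg: "lg \<ge> 1" using N by (simp add: lg_def)
    have T: "T \<ge> 1" unfolding T_def using N \<theta> by (intro ge_one_powr_ge_zero) auto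
    obtain L :: nat where L: "N < 2 ^ L" "2 ^ L \<le> 2 * N" "real L \<le> 2 * lg"
      using dyadic_length[of N] N by (auto simp: lg_def)
    \<comment> \<open>Zero beyond \<open>N\<close>, so that the last dyadic block may
      overshoot.\<close>
    define b where "b n = (if n \<le> N then cnj (a (int n)) else 0)" for n
    define p where "p j x = (\<Sum>n=2^j..<2*2^j. b n * ee ((real n)\<^sup>2 * x ^ k - real n * x))" for j :: nat and x :: real
    define q where "q x = (\<Sum>n=1..<1+N. cnj (a (- int n)) * ee ((real n)\<^sup>2 * x ^ k + real n * x))" for x :: real
    have cp: "continuous_on {0..1} (p j)" for j
      unfolding p_def by (intro continuous_intros)
    have cq: "continuous_on {0..1} q"
      unfolding q_def by (intro continuous_intros)
    have decomp: "cnj (curve_sum N k a x) = cnj (a 0) + (\<Sum>j<L. p j x) + q x" for x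
    proof -
      have "cnj (curve_sum N k a x) = (\<Sum>n=- int N..int N. cnj (a n) * ee ((real_of_int n)\<^sup>2 * x ^ k - real_of_int n * x))"
        unfolding curve_sum_eq cnj_sum by (intro sum.cong refl) (simp flip: ee_minus)
      also have "\<dots> = cnj (a 0) + (\<Sum>n=1..<1+N. cnj (a (int n)) * ee ((real n)\<^sup>2 * x ^ k - real n * x)) + q x"
        unfolding sum_symmetric_int q_def by simp
      also have "(\<Sum>n=1..<1+N. cnj (a (int n)) * ee ((real n)\<^sup>2 * x ^ k - real n * x))
          = (\<Sum>n=1..<2^L. b n * ee ((real n)\<^sup>2 * x ^ k - real n * x))"
        using L(1) by (intro sum.mono_neutral_cong_left) (auto simp: b_def)
      also have "\<dots> = (\<Sum>j<L. p j x)"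
        unfolding p_def by (rule sum_dyadic_blocks)
      finally show ?thesis .
    qed
    have "(norm (curve_sum N k a x))\<^sup>2 \<le> 3 * A0 + 3 * (real L * (\<Sum>j<L. (norm (p j x))\<^sup>2)) + 3 * (norm (q x))\<^sup>2" for x
    proof -
      have "(norm (curve_sum N k a x))\<^sup>2 = (norm (cnj (a 0) + (\<Sum>j<L. p j x) + q x))\<^sup>2"
        using decomp by (metis complex_mod_cnj)
      also have "\<dots> \<le> 3 * A0 + 3 * (norm (\<Sum>j<L. p j x))\<^sup>2 + 3 * (norm (q x))\<^sup>2"
        using norm_add3_power2_le[of "cnj (a 0)" "\<Sum>j<L. p j x" "q x"] by (simp add: A0_def)
      also have "(norm (\<Sum>j<L. p j x))\<^sup>2 \<le> real L * (\<Sum>j<L. (norm (p j x))\<^sup>2)"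
        using norm_sum_power2_le[of "\<lambda>j. p j x" "{..<L}"] by simp
      finally show ?thesis by simp
    qed
    then have "integral {0..1} (\<lambda>x. (norm (curve_sum N k a x))\<^sup>2)
      \<le> integral {0..1} (\<lambda>x. 3 * A0 + 3 * (real L * (\<Sum>j<L. (norm (p j x))\<^sup>2)) + 3 * (norm (q x))\<^sup>2)"
      by (intro integral_le integrable_continuous_real continuous_intros continuous_on_curve_sum cp cq) auto
    also have "\<dots> = 3 * A0 + 3 * (real L * (\<Sum>j<L. integral {0..1} (\<lambda>x. (norm (p j x))\<^sup>2))) + 3 * integral {0..1} (\<lambda>x. (norm (q x))\<^sup>2)"
    proof -
      have 1: "integral {0..1} (\<lambda>x. 3 * A0 + 3 * (real L * (\<Sum>j<L. (norm (p j x))\<^sup>2)) + 3 * (norm (q x))\<^sup>2)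
         = integral {0..1} (\<lambda>x::real. 3 * A0) + integral {0..1} (\<lambda>x. 3 * (real L * (\<Sum>j<L. (norm (p j x))\<^sup>2))) + integral {0..1} (\<lambda>x. 3 * (norm (q x))\<^sup>2)"
        by (subst integral_add integral_add; (intro integrable_continuous_real continuous_intros cp cq)?)+ simp
      have 2: "integral {0..1} (\<lambda>x::real. 3 * A0) = 3 * A0"
        by (subst integral_const_real) simp
      have 3: "integral {0..1} (\<lambda>x. \<Sum>j<L. (norm (p j x))\<^sup>2) = (\<Sum>j<L. integral {0..1} (\<lambda>x. (norm (p j x))\<^sup>2))"
        by (intro integral_sum integrable_continuous_real continuous_intros cp) auto
      show ?thesis
        unfolding 1 2 by (simp add: 3)
    qed
    also have "\<dots> \<le> 3 * A0 + 3 * ((2 * lg) * (C0 * lg\<^sup>2 * T * A1)) + 3 * (5 * lg * A2)"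
    proof (intro add_mono mult_left_mono order_refl)
      have "(\<Sum>j<L. integral {0..1} (\<lambda>x. (norm (p j x))\<^sup>2)) \<le> (\<Sum>j<L. C0 * lg\<^sup>2 * T * (\<Sum>n=2^j..<2*2^j. (norm (b n))\<^sup>2))"
      proof (rule sum_mono)
        fix j assume "j \<in> {..<L}"
        \<comment> \<open>Combined with \<open>2 ^ L \<le> 2 * N\<close>, every block starts at or
          below \<open>N\<close>, so its logarithm and its power are dominated by those of
          \<open>N\<close>.\<close>
        then have "2 * 2 ^ j \<le> (2::nat) ^ L"
          using power_increasing[of "Suc j" L "2::nat"] by simp
        then have jN: "(2::nat) ^ j \<le> N" using L(2) by linarith
        then have jN': "(2::real) ^ j \<le> real N" by (metis of_nat_le_iff of_nat_numeral of_nat_power)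
        have "integral {0..1} (\<lambda>x. (norm (p j x))\<^sup>2) \<le> C0 * (1 + ln (real (2 ^ j)))\<^sup>2 * real (2 ^ j) powr \<theta> * (\<Sum>n=2^j..<2*2^j. (norm (b n))\<^sup>2)"
          unfolding p_def by (rule block) simp
        also have "\<dots> \<le> C0 * lg\<^sup>2 * T * (\<Sum>n=2^j..<2*2^j. (norm (b n))\<^sup>2)"
        proof (intro mult_mono order_refl)
          have "0 \<le> ln (real (2 ^ j))" "ln (real (2 ^ j)) \<le> ln (real N)"
            using jN' by (auto intro!: ln_ge_zero ln_mono simp del: of_nat_le_iff simp flip: of_nat_power)
          then show "(1 + ln (real (2 ^ j)))\<^sup>2 \<le> lg\<^sup>2"
            unfolding lg_def by (intro power_mono add_left_mono) auto
          show "real (2 ^ j) powr \<theta> \<le> T"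
            unfolding T_def using jN' \<theta> by (intro powr_mono2) auto
        qed (use C0 T in \<open>auto intro!: sum_nonneg\<close>)
        finally show "integral {0..1} (\<lambda>x. (norm (p j x))\<^sup>2) \<le> C0 * lg\<^sup>2 * T * (\<Sum>n=2^j..<2*2^j. (norm (b n))\<^sup>2)" .
      qed
      also have "\<dots> = C0 * lg\<^sup>2 * T * (\<Sum>n=1..<2^L. (norm (b n))\<^sup>2)"
        unfolding sum_dyadic_blocks by (simp add: sum_distrib_left)
      also have "(\<Sum>n=1..<2^L. (norm (b n))\<^sup>2) = A1"
        unfolding A1_def using L(1) by (intro sum.mono_neutral_cong_right) (auto simp: b_def)
      finally have S: "(\<Sum>j<L. integral {0..1} (\<lambda>x. (norm (p j x))\<^sup>2)) \<le> C0 * lg\<^sup>2 * T * A1" .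
      have "0 \<le> C0 * lg\<^sup>2 * T * A1" using C0 T Apos by simp
      then show "real L * (\<Sum>j<L. integral {0..1} (\<lambda>x. (norm (p j x))\<^sup>2)) \<le> (2 * lg) * (C0 * lg\<^sup>2 * T * A1)"
        using L(3) S lg by (intro mult_mono) (auto intro!: sum_nonneg integral_nonneg integrable_continuous_real continuous_intros cp)
      show "integral {0..1} (\<lambda>x. (norm (q x))\<^sup>2) \<le> 5 * lg * A2"
        using nonstationary_block_bound[of k N "\<lambda>n. cnj (a (- int n))"] k N
        unfolding q_def lg_def A2_def by simp
    qed auto
    also have "\<dots> \<le> ?C * lg ^ 3 * T * (A0 + A1 + A2)"
    proof -
      have l3: "1 \<le> lg ^ 3" "lg \<le> lg ^ 3" using lg by (auto simp: one_le_power self_le_power)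
      have P: "1 \<le> lg ^ 3 * T" using mult_mono[of 1 "lg ^ 3" 1 T] l3 T lg by simp
      have Q: "lg \<le> lg ^ 3 * T" using mult_mono[of lg "lg ^ 3" 1 T] l3 T lg by simp
      have "3 * A0 \<le> 3 * (lg ^ 3 * T) * A0" using P Apos by (intro mult_right_mono) auto
      moreover have "3 * (5 * lg * A2) \<le> 15 * (lg ^ 3 * T) * A2"
        using mult_right_mono[OF Q Apos(3)] by simp
      moreover have "3 * ((2 * lg) * (C0 * lg\<^sup>2 * T * A1)) = 6 * C0 * (lg ^ 3 * T) * A1"
        by (simp add: power2_eq_square power3_eq_cube)
      moreover have "0 \<le> (lg ^ 3 * T) * A0" "0 \<le> (lg ^ 3 * T) * A1" "0 \<le> (lg ^ 3 * T) * A2"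
        using P Apos by auto
      moreover have "?C * lg ^ 3 * T * (A0 + A1 + A2) = 18 * ((lg ^ 3 * T) * A0) + 18 * ((lg ^ 3 * T) * A1) + 18 * ((lg ^ 3 * T) * A2)
         + 6 * C0 * (lg ^ 3 * T) * A1 + 6 * (C0 * ((lg ^ 3 * T) * A0)) + 6 * (C0 * ((lg ^ 3 * T) * A2))"
        by (simp add: algebra_simps)
      moreover have "0 \<le> C0 * ((lg ^ 3 * T) * A0)" "0 \<le> C0 * ((lg ^ 3 * T) * A2)"
        using calculation C0 by (auto intro: mult_nonneg_nonneg)
      ultimately show ?thesis by linarith
    qed
    also have "\<dots> \<le> ?C * (3 * ln (real N)) ^ 3 * T * (A0 + A1 + A2)"
    proof -
      have "2 / 3 \<le> ln (real N)" using ln2_ge_two_thirds N ln_mono[of 2 "real N"] by linarith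
      then have "lg \<le> 3 * ln (real N)" by (simp add: lg_def)
      then have "lg ^ 3 \<le> (3 * ln (real N)) ^ 3" using lg by (intro power_mono) auto
      then show ?thesis using C0 T Apos by (intro mult_right_mono mult_left_mono) auto
    qed
    finally show ?thesis unfolding A T_def by (simp add: power_mult_distrib algebra_simps)
  qed
  moreover have "27 * ?C > 0" using C0 by simp
  ultimately show ?thesis unfolding \<theta>_def by blast
qed

text \<open>For even \<open>k\<close> the reflection changes only the linear part of the phase,
  which \<open>n\<close> to \<open>- n\<close> undoes. For odd \<open>k\<close> it changes the sign
  of the whole phase, which amounts to conjugation.\<close>

lemma curve_sum_reflect:
  obtains a' where "\<And>x. norm (curve_sum N k a (- x)) = norm (curve_sum N k a' x)"
    "(\<Sum>n=- int N..int N. (norm (a' n))\<^sup>2) = (\<Sum>n=- int N..int N. (norm (a n))\<^sup>2)"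
proof (cases "even k")
  case True
  have flip: "(\<Sum>n=- int N..int N. f (- n)) = (\<Sum>n=- int N..int N. f n)" for f :: "int \<Rightarrow> 'b :: comm_monoid_add"
    by (rule sum.reindex_bij_witness[of _ uminus uminus]) auto
  show ?thesis
  proof (rule that[of "\<lambda>n. a (- n)"])
    fix x
    have "curve_sum N k a (- x) = curve_sum N k (\<lambda>n. a (- n)) x"
      unfolding curve_sum_eq using True
      by (subst flip[symmetric]) simp
    then show "norm (curve_sum N k a (- x)) = norm (curve_sum N k (\<lambda>n. a (- n)) x)" by simp
  qed (rule flip)
next
  case False
  show ?thesis
  proof (rule that[of "\<lambda>n. cnj (a n)"])
    fix x
    have "curve_sum N k a (- x) = cnj (curve_sum N k (\<lambda>n. cnj (a n)) x)"
      unfolding curve_sum_eq cnj_sum using False by (simp flip: ee_minus)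
    then show "norm (curve_sum N k a (- x)) = norm (curve_sum N k (\<lambda>n. cnj (a n)) x)" by simp
  qed simp
qed

text \<open>Both halves of the interval obey the same bound, whence \<open>2 * C\<close>. The square
  root halves the exponent of \<open>N\<close> and turns the third power of the logarithm into the
  power \<open>3/2\<close>.\<close>

lemma best_const_upper:
  assumes k: "k \<ge> 3"
  shows "\<exists>C>0. \<forall>N. 2 \<le> N \<longrightarrow> best_const N k \<le> C * (ln (real N)) powr (3 / 2) * real N powr ((real k - 2) / (6 * (real k - 1)))"
proof -
  define \<theta> where "\<theta> = (real k - 2) / (6 * (real k - 1))"
  obtain C where C: "C > 0" and bound: "\<And>N a. 2 \<le> N \<Longrightarrow>
    integral {0..1} (\<lambda>x. (norm (curve_sum N k a x))\<^sup>2)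
      \<le> C * (ln (real N)) ^ 3 * real N powr ((real k - 2) / (3 * (real k - 1))) * (\<Sum>n=- int N..int N. (norm (a n))\<^sup>2)"
    using half_interval_bound[OF k] by blast
  have "best_const N k \<le> sqrt (2 * C) * (ln (real N)) powr (3 / 2) * real N powr \<theta>" if N: "2 \<le> N" for N
  proof (rule admissible_best_const(2), unfold admissible_const_def, intro allI)
    fix a :: "int \<Rightarrow> complex"
    let ?A = "\<Sum>n=- int N..int N. (norm (a n))\<^sup>2"
    let ?f = "\<lambda>x. (norm (curve_sum N k a x))\<^sup>2"
    let ?B = "C * (ln (real N)) ^ 3 * real N powr ((real k - 2) / (3 * (real k - 1)))"
    obtain a' where a': "\<And>x. norm (curve_sum N k a (- x)) = norm (curve_sum N k a' x)"
      "(\<Sum>n=- int N..int N. (norm (a' n))\<^sup>2) = ?A" using curve_sum_reflect by blast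
    have c: "continuous_on S ?f" for S by (intro continuous_intros continuous_on_curve_sum)
    have "integral {-1..1} ?f = integral {-1..0} ?f + integral {0..1} ?f"
      by (intro Henstock_Kurzweil_Integration.integral_combine[symmetric] integrable_continuous_real c) auto
    also have "integral {-1..0} ?f = integral {0..1} (\<lambda>x. ?f (- x))"
      using Henstock_Kurzweil_Integration.integral_reflect_real[of 0 "- 1" ?f] by simp
    also have "\<dots> \<le> ?B * ?A"
      unfolding a'(1) a'(2)[symmetric] by (rule bound[OF N])
    also have "integral {0..1} ?f \<le> ?B * ?A" by (rule bound[OF N])
    finally have "integral {-1..1} ?f \<le> (2 * ?B) * ?A" by (simp only: mult_2 distrib_right)
    then have "L2_norm_on {-1<..<1} (curve_sum N k a) \<le> sqrt ((2 * ?B) * ?A)"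
      unfolding L2_norm_on_eq_integral[OF continuous_on_curve_sum] by (rule real_sqrt_le_mono)
    also have "\<dots> = sqrt (2 * ?B) * sqrt ?A" by (rule real_sqrt_mult)
    also have "sqrt (2 * ?B) = sqrt (2 * C) * (ln (real N)) powr (3 / 2) * real N powr \<theta>"
    proof -
      have half: "sqrt (z powr r) = z powr (r / 2)" for z r :: real
        by (simp only: powr_half_sqrt[symmetric] powr_ge_zero powr_powr) simp
      have "(ln (real N)) ^ 3 = ln (real N) powr 3" using N by simp
      then have "sqrt ((ln (real N)) ^ 3) = (ln (real N)) powr (3 / 2)" by (simp only: half)
      moreover have "sqrt (real N powr ((real k - 2) / (3 * (real k - 1)))) = real N powr \<theta>"
        by (simp only: half \<theta>_def divide_divide_eq_left) simp
      ultimately show ?thesis by (simp add: real_sqrt_mult)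
    qed
    finally show "L2_norm_on {-1<..<1} (curve_sum N k a) \<le> sqrt (2 * C) * (ln (real N)) powr (3 / 2) * real N powr \<theta> * sqrt ?A" .
  qed
  moreover have "sqrt (2 * C) > 0" using C by simp
  ultimately show ?thesis unfolding \<theta>_def by blast
qed

section \<open>The lower bound\<close>

text \<open>Bernoulli's inequality continued by one term; the induction step discards only a
  negative cubic term. Together with Bernoulli's lower bound it encloses \<open>x ^ k\<close> near
  \<open>x0\<close> to second order, the order that survives the cancellation of the linear
  terms.\<close>

lemma power_one_minus_le:
  fixes y :: real
  assumes "0 \<le> y" "y \<le> 1"
  shows "(1 - y) ^ k \<le> 1 - real k * y + real k * (real k - 1) / 2 * y\<^sup>2"
proof (induction k)
  case (Suc k)
  have "(1 - y) ^ Suc k \<le> (1 - y) * (1 - real k * y + real k * (real k - 1) / 2 * y\<^sup>2)"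
    using Suc assms by (simp add: mult_left_mono)
  also have "\<dots> = 1 - real (Suc k) * y + real (Suc k) * (real (Suc k) - 1) / 2 * y\<^sup>2 - real k * (real k - 1) / 2 * y ^ 3"
    by (simp add: field_simps power2_eq_square power3_eq_cube)
  finally have "(1 - y) ^ Suc k \<le> 1 - real (Suc k) * y + real (Suc k) * (real (Suc k) - 1) / 2 * y\<^sup>2 - real k * (real k - 1) / 2 * y ^ 3" .
  moreover have "0 \<le> real k * (real k - 1) / 2 * y ^ 3"
    using assms by (cases k) auto
  ultimately show ?case by linarith
qed simp

lemma Re_ee_ge:
  assumes "\<bar>t\<bar> \<le> 1 / 8"
  shows "1 / 2 \<le> Re (ee t)"
proof -
  have "\<bar>2 * pi * t\<bar> \<le> pi / 3"
    using mult_left_mono[OF assms, of "2 * pi"] pi_gt_zero by (simp add: abs_mult)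
  then have "cos (pi / 3) \<le> cos \<bar>2 * pi * t\<bar>"
    by (intro cos_monotone_0_pi_le) auto
  then show ?thesis by (simp add: ee_def cos_60)
qed

text \<open>The \<open>L\<close> coefficients are unimodular, so their square norm is
  \<open>sqrt L\<close>, while the sum has modulus at least \<open>L / 2\<close> on an interval of
  length \<open>T\<close>. The quotient is \<open>sqrt (T * L) / 2\<close>. The two
  \<open>JT\<close> hypotheses keep all phases within \<open>1/8\<close> of a common one, where the
  cosine is still at least \<open>1/2\<close>.\<close>

lemma coherent_lower_bound:
  assumes k: "k \<ge> 2" and J: "1 \<le> n0" "n0 + L \<le> N + 1"
    and x0: "0 < x0" "x0 \<le> 1" "2 * real k * real n0 * x0 ^ (k - 1) = 1"
    and T: "0 \<le> T" "T \<le> x0"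
    and JT: "\<And>j. j < L \<Longrightarrow> real j * T\<^sup>2 \<le> x0 / (4 * real k)" "\<And>j. j < L \<Longrightarrow> (real j)\<^sup>2 * T \<le> real n0 / (4 * real k)"
    and L: "0 < L"
  shows "sqrt (T * L) / 2 \<le> best_const N k"
proof -
  define \<phi> where "\<phi> n x = real n * x - (real n)\<^sup>2 * x ^ k" for n :: nat and x :: real
  \<comment> \<open>These coefficients cancel the phases at \<open>x0\<close>, where all terms of
    the sum equal 1.\<close>
  define a where "a n = (if int n0 \<le> n \<and> n < int (n0 + L) then ee (- \<phi> (nat n) x0) else 0)" for n :: int
  let ?A = "\<Sum>n=- int N..int N. (norm (a n))\<^sup>2"
  have restrict: "(\<Sum>n=- int N..int N. g n) = (\<Sum>j<L. g (int (n0 + j)))"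
    if "\<And>n. a n = 0 \<Longrightarrow> g n = 0" for g :: "int \<Rightarrow> 'b :: comm_monoid_add"
  proof -
    have "(\<Sum>n=- int N..int N. g n) = (\<Sum>n\<in>(\<lambda>j. int (n0 + j)) ` {..<L}. g n)"
    proof (rule sum.mono_neutral_right)
      show "\<forall>n\<in>{- int N..int N} - (\<lambda>j. int (n0 + j)) ` {..<L}. g n = 0"
      proof
        fix n assume n: "n \<in> {- int N..int N} - (\<lambda>j. int (n0 + j)) ` {..<L}"
        have "n \<in> (\<lambda>j. int (n0 + j)) ` {..<L}" if "int n0 \<le> n \<and> n < int (n0 + L)"
          using that by (intro image_eqI[of _ _ "nat (n - int n0)"]) auto
        then have "a n = 0" using n by (auto simp: a_def)
        then show "g n = 0" by fact
      qed
    qed (use J in auto)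
    also have "\<dots> = (\<Sum>j<L. g (int (n0 + j)))"
      by (subst sum.reindex) (auto simp: inj_on_def)
    finally show ?thesis .
  qed
  have A: "?A = real L"
    by (subst restrict) (auto simp: a_def)
  have err: "\<bar>(\<phi> (n0 + j) x - \<phi> (n0 + j) x0) - (\<phi> n0 x - \<phi> n0 x0)\<bar> \<le> 1 / 8"
    if j: "j < L" and x: "x \<in> {x0 - T..x0}" for j x
  proof -
    define t where "t = x0 - x"
    define y where "y = t / x0"
    define \<Delta> where "\<Delta> = x0 ^ k - x ^ k"
    have t: "0 \<le> t" "t \<le> T" using x by (auto simp: t_def)
    have y: "0 \<le> y" "y \<le> 1" using t x0 T by (auto simp: y_def field_simps)
    have xy: "x = x0 * (1 - y)" using x0 by (simp add: y_def t_def field_simps)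
    have n0: "real n0 > 0" using J by simp
    have "x0 ^ k = x0 * x0 ^ (k - 1)"
      using k by (metis power_eq_if not_numeral_le_zero)
    then have xk: "x0 ^ k * real k = x0 / (2 * real n0)"
      using x0(3) n0 by (simp add: field_simps)
    have D: "\<Delta> = x0 ^ k * (1 - (1 - y) ^ k)"
      unfolding \<Delta>_def xy power_mult_distrib by (simp add: right_diff_distrib)
    have "1 - real k * y \<le> (1 - y) ^ k"
      using Bernoulli_inequality[of "- y" k] y by simp
    then have "\<Delta> \<le> x0 ^ k * (real k * y)"
      unfolding D using x0 by (intro mult_left_mono) auto
    also have "\<dots> = t / (2 * real n0)"
      using xk x0 by (simp add: y_def mult.assoc[symmetric])
    finally have up: "\<Delta> \<le> t / (2 * real n0)" .
    have "x0 ^ k * (real k * y - real k * (real k - 1) / 2 * y\<^sup>2) \<le> \<Delta>"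
      unfolding D using x0 power_one_minus_le[OF y, of k] by (intro mult_left_mono) auto
    also have "x0 ^ k * (real k * y - real k * (real k - 1) / 2 * y\<^sup>2) = (x0 ^ k * real k) * (y - (real k - 1) / 2 * y\<^sup>2)"
      by (simp add: algebra_simps)
    also have "\<dots> = (t - (real k - 1) * t\<^sup>2 / (2 * x0)) / (2 * real n0)"
      unfolding xk y_def using x0(1) n0 by (simp add: field_simps power2_eq_square)
    finally have lo: "(t - (real k - 1) * t\<^sup>2 / (2 * x0)) / (2 * real n0) \<le> \<Delta>" .
    \<comment> \<open>The equation for \<open>x0\<close> gives \<open>\<Delta> = t / (2 n0)\<close>
      up to second order in \<open>t\<close>, so the bracket is only of order
      \<open>t\<^sup>2 / x0\<close>. Both \<open>\<Delta>\<close> and the bracket are nonnegative,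
      so bounding each of the two terms by \<open>1/8\<close> bounds their difference by
      \<open>1/8\<close>.\<close>
    have E: "(\<phi> (n0 + j) x - \<phi> (n0 + j) x0) - (\<phi> n0 x - \<phi> n0 x0) = (real j)\<^sup>2 * \<Delta> - real j * (t - 2 * real n0 * \<Delta>)"
      by (simp add: \<phi>_def \<Delta>_def t_def algebra_simps power2_eq_square)
    have 1: "0 \<le> t - 2 * real n0 * \<Delta>" using up n0 by (simp add: field_simps)
    have 2: "t - 2 * real n0 * \<Delta> \<le> (real k - 1) * t\<^sup>2 / (2 * x0)"
      using lo n0 by (simp add: pos_divide_le_eq mult.commute)
    have D0: "0 \<le> \<Delta>" unfolding D using x0(1) power_le_one[of "1 - y" k] y by simp
    have "(real j)\<^sup>2 * \<Delta> \<le> (real j)\<^sup>2 * (T / (2 * real n0))"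
      using up t n0 by (intro mult_left_mono order_trans[OF up] divide_right_mono) auto
    also have "\<dots> = ((real j)\<^sup>2 * T) / (2 * real n0)" by simp
    also have "\<dots> \<le> (real n0 / (4 * real k)) / (2 * real n0)"
      using JT(2)[OF j] by (intro divide_right_mono) auto
    also have "\<dots> = 1 / (8 * real k)" using n0 by simp
    also have "\<dots> \<le> 1 / 8" using k by (simp add: field_simps)
    finally have hi: "(real j)\<^sup>2 * \<Delta> \<le> 1 / 8" .
    have "real j * (t - 2 * real n0 * \<Delta>) \<le> real j * ((real k - 1) * T\<^sup>2 / (2 * x0))"
      using t x0 k by (intro mult_left_mono order_trans[OF 2] divide_right_mono power_mono) auto
    also have "\<dots> = (real k - 1) / (2 * x0) * (real j * T\<^sup>2)" by simp
    also have "\<dots> \<le> (real k - 1) / (2 * x0) * (x0 / (4 * real k))"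
      using JT(1)[OF j] x0 k by (intro mult_left_mono) auto
    also have "\<dots> = (real k - 1) / (8 * real k)" using x0 by simp
    also have "\<dots> \<le> 1 / 8" using k by (simp add: field_simps)
    finally have "real j * (t - 2 * real n0 * \<Delta>) \<le> 1 / 8" .
    moreover have "0 \<le> (real j)\<^sup>2 * \<Delta>" "0 \<le> real j * (t - 2 * real n0 * \<Delta>)"
      using D0 1 by auto
    ultimately show ?thesis unfolding E using hi by linarith
  qed
  have pt: "(real L / 2)\<^sup>2 \<le> (norm (curve_sum N k a x))\<^sup>2" if x: "x \<in> {x0 - T..x0}" for x
  proof (rule power_mono)
    let ?w = "ee (\<phi> n0 x - \<phi> n0 x0)"
    let ?e = "\<lambda>j. ee ((\<phi> (n0 + j) x - \<phi> (n0 + j) x0) - (\<phi> n0 x - \<phi> n0 x0))"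
    have "curve_sum N k a x = (\<Sum>j<L. a (int (n0 + j)) * ee (\<phi> (n0 + j) x))"
      unfolding curve_sum_eq by (subst restrict) (auto simp: \<phi>_def)
    also have "\<dots> = (\<Sum>j<L. ?w * ?e j)"
      by (intro sum.cong refl) (simp add: a_def nat_int_add algebra_simps flip: ee_add)
    finally have "curve_sum N k a x = ?w * (\<Sum>j<L. ?e j)" by (simp only: sum_distrib_left)
    then have "norm (curve_sum N k a x) = norm (\<Sum>j<L. ?e j)" by (simp only: norm_mult norm_ee mult_1)
    moreover have "real (card {..<L}) * (1 / 2) \<le> (\<Sum>j<L. Re (?e j))"
      by (intro sum_bounded_below Re_ee_ge err x) simp
    then have "real L / 2 \<le> Re (\<Sum>j<L. ?e j)" by (simp only: Re_sum card_lessThan)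
    ultimately show "real L / 2 \<le> norm (curve_sum N k a x)"
      using complex_Re_le_cmod[of "\<Sum>j<L. ?e j"] by linarith
  qed simp
  let ?f = "\<lambda>x. (norm (curve_sum N k a x))\<^sup>2"
  have c: "continuous_on S ?f" for S by (intro continuous_intros continuous_on_curve_sum)
  have "T * (real L / 2)\<^sup>2 = integral {x0 - T..x0} (\<lambda>x. (real L / 2)\<^sup>2)"
    using T by (subst integral_const_real) simp
  also have "\<dots> \<le> integral {x0 - T..x0} ?f"
    by (intro integral_le integrable_continuous_real c continuous_on_const pt)
  also have "\<dots> \<le> integral {-1..1} ?f"
    using x0 T by (intro integral_subset_le integrable_continuous_real c) auto
  finally have "sqrt (T * (real L / 2)\<^sup>2) \<le> L2_norm_on {-1<..<1} (curve_sum N k a)"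
    unfolding L2_norm_on_eq_integral[OF continuous_on_curve_sum] by (rule real_sqrt_le_mono)
  also have "\<dots> \<le> best_const N k * sqrt ?A"
    using admissible_best_const(1)[of N k] unfolding admissible_const_def by blast
  finally have "sqrt (T * (real L / 2)\<^sup>2) \<le> best_const N k * sqrt (real L)" unfolding A .
  moreover have "sqrt (T * (real L / 2)\<^sup>2) = (sqrt (T * L) / 2) * sqrt (real L)"
    by (simp add: real_sqrt_mult real_sqrt_divide)
  ultimately show ?thesis using L by simp
qed

lemma best_const_lower:
  assumes k: "k \<ge> 3"
  shows "\<exists>c>0. \<forall>N. 2 \<le> N \<longrightarrow> c * real N powr ((real k - 2) / (6 * (real k - 1))) \<le> best_const N k"
proof -
  define \<alpha> where "\<alpha> = 1 / (real k - 1)"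
  have \<alpha>: "0 < \<alpha>" "\<alpha> \<le> 1" using k by (auto simp: \<alpha>_def field_simps)
  define \<kappa> where "\<kappa> = 1 / (4 * real k)"
  \<comment> \<open>A lower bound for \<open>(T J) ^ 3\<close> relative to
    \<open>N powr (1 - \<alpha>)\<close>: the power of \<open>2 k\<close> comes from
    \<open>crit\<close>, the power of \<open>1/3\<close> from \<open>n0 \<ge> N / 3\<close>.\<close>
  define c1 where "c1 = \<kappa>\<^sup>2 * ((2 * real k) powr (- \<alpha>) * (1 / 3) powr (1 - \<alpha>))"
  have \<kappa>: "\<kappa> > 0" using k by (simp add: \<kappa>_def)
  have c1: "c1 > 0" using \<kappa> k by (simp add: c1_def)
  have "sqrt (c1 powr (1 / 3)) / 2 * real N powr ((1 - \<alpha>) / 6) \<le> best_const N k" if N: "2 \<le> N" for N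
  proof -
    define n0 where "n0 = N div 2"
    \<comment> \<open>The argument \<open>2 * n0\<close> turns the equation of
      \<open>crit_power\<close> into \<open>2 k n0 x0 ^ (k - 1) = 1\<close>.\<close>
    define x0 where "x0 = crit k (2 * real n0)"
    have n0: "1 \<le> n0" "2 * n0 \<le> N" "N \<le> 3 * n0" using N by (auto simp: n0_def)
    have rn: "real n0 \<ge> 1" using n0 by simp
    have x0: "x0 > 0" unfolding x0_def using k rn by (intro crit_pos) auto
    have "1 * 1 \<le> real k * (2 * real n0)" using k rn by (intro mult_mono) auto
    then have kn: "1 \<le> real k * (2 * real n0)" by simp
    have "x0 \<le> (real k * (2 * real n0)) powr 0"
      unfolding x0_def crit_def using kn k by (intro powr_mono) auto
    then have x1: "x0 \<le> 1" using kn by (auto split: if_splits)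
    have xp: "2 * real k * real n0 * x0 ^ (k - 1) = 1"
      using crit_power[of k "2 * real n0"] k rn by (simp add: x0_def)
    \<comment> \<open>Since \<open>\<alpha> \<le> 1\<close>, the product \<open>n0 * x0\<close> is
      bounded below. The resulting \<open>\<kappa> \<le> n0 * x0\<close> is equivalent to both
      \<open>J \<le> n0\<close> and \<open>T \<le> x0\<close>, so that the frequencies stay up to
      \<open>N\<close> and the interval stays to the right of 0.\<close>
    have "(real k * (2 * real n0)) powr (- 1) \<le> x0"
      unfolding x0_def crit_def using kn \<alpha> by (intro powr_mono) (auto simp: \<alpha>_def)
    then have "1 / (real k * (2 * real n0)) \<le> x0" using kn by (simp add: powr_minus_divide)
    then have "1 / (2 * real k) \<le> real n0 * x0" using k rn by (simp add: field_simps)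
    moreover have "\<kappa> \<le> 1 / (2 * real k)" using k by (simp add: \<kappa>_def field_simps)
    ultimately have kx: "\<kappa> \<le> real n0 * x0" by linarith
    \<comment> \<open>\<open>J\<close> and \<open>T\<close> solve
      \<open>J * T\<^sup>2 = \<kappa> * x0\<close> and \<open>J\<^sup>2 * T = \<kappa> * n0\<close>,
      the extreme case of the coherence conditions. Consequently
      \<open>(T * J) ^ 3 = \<kappa>\<^sup>2 * (n0 * x0)\<close>. Cubes are compared below so as to
      avoid fractional powers.\<close>
    define J where "J = (\<kappa> * (real n0)\<^sup>2 / x0) powr (1 / 3)"
    define T where "T = (\<kappa> * x0\<^sup>2 / real n0) powr (1 / 3)"
    have cube: "(z powr (1 / 3)) ^ 3 = z" if "z > 0" for z :: real
    proof -
      have "(z powr (1 / 3)) ^ 3 = (z powr (1 / 3)) powr 3" using that by simp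
      also have "\<dots> = z" using that by (simp only: powr_powr) simp
      finally show ?thesis .
    qed
    have J: "J > 0" "J ^ 3 = \<kappa> * (real n0)\<^sup>2 / x0"
      unfolding J_def using \<kappa> rn x0 by (auto intro!: cube)
    have T: "T > 0" "T ^ 3 = \<kappa> * x0\<^sup>2 / real n0"
      unfolding T_def using \<kappa> rn x0 by (auto intro!: cube)
    have cube_le: "u \<le> v" if "u ^ 3 \<le> v ^ 3" "0 \<le> v" for u v :: real
      using that power_le_imp_le_base[of u 2 v] by (simp add: eval_nat_numeral)
    have alg: "(K * u\<^sup>2 / v) * (K * v\<^sup>2 / u)\<^sup>2 = (K * v) ^ 3"
        "(K * u\<^sup>2 / v)\<^sup>2 * (K * v\<^sup>2 / u) = (K * u) ^ 3"
        "(K * v\<^sup>2 / u) * (K * u\<^sup>2 / v) = K\<^sup>2 * (u * v)"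
      if "u \<noteq> 0" "v \<noteq> 0" for K u v :: real
      using that by (simp_all add: divide_simps) (simp_all add: eval_nat_numeral mult_ac)
    have "(J * T\<^sup>2) ^ 3 = J ^ 3 * (T ^ 3)\<^sup>2" by (simp add: power_mult_distrib flip: power_mult)
    also have "\<dots> = (\<kappa> * x0) ^ 3"
      unfolding J(2) T(2) by (rule alg(1)) (use rn x0 in auto)
    finally have JT1: "J * T\<^sup>2 \<le> \<kappa> * x0" by (rule cube_le[OF eq_refl]) (use \<kappa> x0 in simp)
    have "(J\<^sup>2 * T) ^ 3 = (J ^ 3)\<^sup>2 * T ^ 3" by (simp add: power_mult_distrib flip: power_mult)
    also have "\<dots> = (\<kappa> * real n0) ^ 3"
      unfolding J(2) T(2) by (rule alg(2)) (use rn x0 in auto)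
    finally have JT2: "J\<^sup>2 * T \<le> \<kappa> * real n0" by (rule cube_le[OF eq_refl]) (use \<kappa> in simp)
    have "J ^ 3 \<le> real n0 ^ 3"
      unfolding J using mult_left_mono[OF kx, of "(real n0)\<^sup>2"] x0
      by (simp add: field_simps power2_eq_square power3_eq_cube)
    then have Jn: "J \<le> real n0" by (rule cube_le) simp
    have "T ^ 3 \<le> x0 ^ 3"
      unfolding T using mult_left_mono[OF kx, of "x0\<^sup>2"] rn
      by (simp add: field_simps power2_eq_square power3_eq_cube)
    then have Tx: "T \<le> x0" by (rule cube_le) (use x0 in simp)
    \<comment> \<open>The number of integers \<open>j\<close> with \<open>0 \<le> j \<le> J\<close>.
      It is at least \<open>J\<close>, yet each \<open>j < L\<close> is at most \<open>J\<close>,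
      and the last frequency \<open>n0 + L - 1\<close> is at most
      \<open>2 * n0 \<le> N\<close>.\<close>
    define L where "L = nat \<lfloor>J\<rfloor> + 1"
    have LJ: "J \<le> real L" using J by (simp add: L_def) linarith
    have jJ: "real j \<le> J" if "j < L" for j
      using that J unfolding L_def by (simp add: le_nat_iff le_floor_iff less_Suc_eq_le)
    have "nat \<lfloor>J\<rfloor> \<le> n0" using Jn J by (simp add: nat_le_iff floor_le_iff)
    then have LN: "n0 + L \<le> N + 1" using n0 by (simp add: L_def)
    have "sqrt (T * L) / 2 \<le> best_const N k"
    proof (rule coherent_lower_bound[OF _ n0(1) LN x0 x1 xp _ Tx])
      fix j assume j: "j < L"
      have "real j * T\<^sup>2 \<le> J * T\<^sup>2" using jJ[OF j] by (intro mult_right_mono) auto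
      then show "real j * T\<^sup>2 \<le> x0 / (4 * real k)" using JT1 by (simp add: \<kappa>_def)
      have "(real j)\<^sup>2 * T \<le> J\<^sup>2 * T" using jJ[OF j] T by (intro mult_right_mono power_mono) auto
      then show "(real j)\<^sup>2 * T \<le> real n0 / (4 * real k)" using JT2 by (simp add: \<kappa>_def)
    qed (use k T in \<open>auto simp: L_def\<close>)
    moreover have "c1 powr (1 / 3) * real N powr ((1 - \<alpha>) / 3) \<le> T * L"
    proof -
      have "(T * J) ^ 3 = \<kappa>\<^sup>2 * (real n0 * x0)"
        unfolding power_mult_distrib J(2) T(2) by (rule alg(3)) (use rn x0 in auto)
      also have "real n0 * x0 = (2 * real k) powr (- \<alpha>) * (real n0 powr 1 * real n0 powr (- \<alpha>))"
        using rn by (simp add: x0_def crit_def \<alpha>_def[symmetric] powr_mult mult_ac)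
      also have "real n0 powr 1 * real n0 powr (- \<alpha>) = real n0 powr (1 - \<alpha>)"
        by (simp only: powr_add[symmetric]) simp
      finally have TJ: "(T * J) ^ 3 = \<kappa>\<^sup>2 * ((2 * real k) powr (- \<alpha>) * real n0 powr (1 - \<alpha>))" .
      have "(1 / 3 * real N) powr (1 - \<alpha>) \<le> real n0 powr (1 - \<alpha>)"
        using n0 \<alpha> by (intro powr_mono2) auto
      then have "(1 / 3) powr (1 - \<alpha>) * real N powr (1 - \<alpha>) \<le> real n0 powr (1 - \<alpha>)"
        by (subst powr_mult[symmetric]) auto
      then have "c1 * real N powr (1 - \<alpha>) \<le> (T * J) ^ 3"
        unfolding TJ c1_def mult.assoc by (intro mult_left_mono) auto
      moreover have "(c1 powr (1 / 3) * real N powr ((1 - \<alpha>) / 3)) ^ 3 = c1 * real N powr (1 - \<alpha>)"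
      proof -
        have "real N powr ((1 - \<alpha>) / 3) = (real N powr (1 - \<alpha>)) powr (1 / 3)" by (simp add: powr_powr)
        then show ?thesis using c1 N by (simp add: power_mult_distrib cube)
      qed
      ultimately have "(c1 powr (1 / 3) * real N powr ((1 - \<alpha>) / 3)) ^ 3 \<le> (T * J) ^ 3"
        by (simp only:)
      then have "c1 powr (1 / 3) * real N powr ((1 - \<alpha>) / 3) \<le> T * J"
        by (rule cube_le) (use T J in simp)
      also have "\<dots> \<le> T * L" using LJ T by (intro mult_left_mono) auto
      finally show ?thesis .
    qed
    then have "sqrt (c1 powr (1 / 3) * real N powr ((1 - \<alpha>) / 3)) \<le> sqrt (T * L)"
      by (rule real_sqrt_le_mono)
    moreover have "sqrt (real N powr ((1 - \<alpha>) / 3)) = real N powr ((1 - \<alpha>) / 6)"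
      by (simp add: powr_half_sqrt[symmetric] powr_powr)
    ultimately show ?thesis by (simp add: real_sqrt_mult)
  qed
  moreover have "(1 - \<alpha>) / 6 = (real k - 2) / (6 * (real k - 1))"
    using k by (simp add: \<alpha>_def field_simps)
  moreover have "sqrt (c1 powr (1 / 3)) / 2 > 0" using c1 by simp
  ultimately show ?thesis by metis
qed

theorem theorem1p2:
  fixes k :: nat
  assumes "k \<ge> 3"
  shows "\<exists>c C A :: real. c > 0 \<and> C > 0 \<and> A > 0 \<and>
    (\<forall>N::nat. N \<ge> 2 \<longrightarrow>
      c * real N powr ((real k - 2) / (6 * (real k - 1))) \<le> best_const N k \<and>
      best_const N k \<le> C * (ln (real N)) powr A * real N powr ((real k - 2) / (6 * (real k - 1))))"
proof -
  obtain c where c: "c > 0" "\<And>N. 2 \<le> N \<Longrightarrow> c * real N powr ((real k - 2) / (6 * (real k - 1))) \<le> best_const N k"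
    using best_const_lower[OF assms] by blast
  obtain C where C: "C > 0"
    "\<And>N. 2 \<le> N \<Longrightarrow> best_const N k \<le> C * (ln (real N)) powr (3 / 2) * real N powr ((real k - 2) / (6 * (real k - 1)))"
    using best_const_upper[OF assms] by blast
  show ?thesis
    using c C by (intro exI[of _ c] exI[of _ C] exI[of _ "3 / 2"]) auto
qed

end
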